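(* Let $X$ be a set, $\Psi=\{\psi_1,\dots,\psi_d\}$ a finite set of test functions on $X$, $\Lambda$ a preordering, and assume that all test functions are in $A(X,\mathcal K_\Lambda)$. Let $\mathcal H$ be a Hilbert space and $\varphi:X\to\mathcal L(\mathcal H)$ a function. The following are equivalent: (SC) $\varphi\in H_1^\infty(X,\mathcal K_{\Lambda,\mathcal H})$; (AD) there is a positive kernel $\Gamma\in\mathbb K_X^+(C_b(\Lambda),\mathcal L(\mathcal H))$ such that for all $x,y\in X$, $$1-\varphi(x)\varphi(y)^*=\Gamma(x,y)\big(E^+(x)E^+(y)^*-E^-(x)E^-(y)^*\big).$$ In this situation, $\varphi$ has a transfer function representation, i.e. there is a $C_b(\Lambda)$-unitary colligation $\Sigma$ with $\varphi=W_\Sigma$.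
   Context: Test functions: functions $\psi_i:X\to\mathbb C$ with $\max_i|\psi_i(x)|<1$ for every $x\in X$ and which together separate the points of $X$. Tuples in $\mathbb N^d$ ($0\in\mathbb N$) are ordered entrywise, $|\lambda|=\sum_i\lambda_i$, and $e_i$ is the $i$th unit tuple. A preordering is a finite set $\Lambda\subset\mathbb N^d$ such that for each $i$ there is $\lambda\in\Lambda$ with $e_i\le\lambda$. Function algebras: a kernel $k:X\times X\to\mathcal L(\mathcal H)$ is positive if $\sum_{i,j}\langle k(x_i,x_j)h_j,h_i\rangle\ge0$ for all finite families $x_i\in X$, $h_i\in\mathcal H$. The set $\mathcal K_{\Lambda,\mathcal H}$ of admissible kernels consists of all positive $\mathcal L(\mathcal H)$-valued kernels $k$ such that for each $\lambda\in\Lambda$ the kernel $(x,y)\mapsto\prod_i(1-\psi_i(x)\overline{\psi_i(y)})^{\lambda_i}k(x,y)$ is positive. $H^\infty(X,\mathcal K_{\Lambda,\mathcal H})$ is the algebra of functions $\varphi:X\to\mathcal L(\mathcal H)$ for which there is $c\ge0$ such that the kernel $(x,y)\mapsto(c^21_{\mathcal H}-\varphi(x)\varphi(y)^* )\otimes k(x,y)$ is positive for all $k\in\mathcal K_{\Lambda,\mathcal H}$; the norm $\|\varphi\|$ is the smallest such $c$, and $H^\infty_1(X,\mathcal K_{\Lambda,\mathcal H})$ is the closed unit ball. When $\mathcal H=\mathbb C$ one writes $\mathcal K_\Lambda$ for $\mathcal K_{\Lambda,\mathbb C}$. $X$ carries the weakest topology making the test functions continuous. Take the quotient of the space of continuous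 linear functionals on $H^\infty(X,\mathcal K_\Lambda)$ by those vanishing on $\Psi$, with the topology induced by the test functions; $\overline X$ is the closure in it of the image of $X$ under point evaluations (points not distinguished by the test functions being identified). $A(X,\mathcal K_\Lambda)$ is the algebra of those elements of $H^\infty(X,\mathcal K_\Lambda)$ which extend continuously to $\overline X$. Auxiliary test functions: for $0\ne\lambda\in\Lambda$ put $n_\lambda=2^{|\lambda|-1}$. Consider $|\lambda|$ factors, $\lambda_i$ of which equal $\psi_i$. Let $\psi_\lambda^+$ (resp. $\psi_\lambda^-$) be the row of length $n_\lambda$ whose entries are the products over all subsets of these factors of even (resp. odd) cardinality, in a fixed order, the first entry of $\psi^+_\lambda$ being the empty product $1$. Then $\psi_\lambda^+(x)\psi_\lambda^+(y)^*-\psi_\lambda^-(x)\psi_\lambda^-(y)^*=\prod_i(1-\psi_i(x)\overline{\psi_i(y)})^{\lambda_i}$. Put $\sigma_\lambda(x)=\psi_\lambda^+(x)^*\,(\psi_\lambda^+(x)\psi_\lambda^+(x)^* )^{-1}\psi_\lambda^-(x)\in M_{n_\lambda}(\mathbb C)$; then $\psi^+_\lambda\sigma_\lambda=\psi_\lambda^-$ and $\|\sigma_\lambda(x)\|<1$. In what follows functions on $\Lambda$ are considered at the nonzero $\lambda\in\Lambda$. $C_b(\Lambda)$ is the (finite dimensional) unital $C^*$-algebra generated by the matrix valued functions $E_x$, $x\in X$, on $\Lambda$ given by $E_x(\lambda)=\sigma_\lambda(x)$. Further, $E^\pm(x)(\lambda)=\psi_\lambda^\pm(x)$, so that $E^+(x)E^+(y)^*-E^-(x)E^-(y)^*$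 is the function $\lambda\mapsto\prod_i(1-\psi_i(x)\overline{\psi_i(y)})^{\lambda_i}$, regarded as an element of $C_b(\Lambda)$ (scalars being identified with multiples of the identity matrix). $\mathbb K_X^+(C_b(\Lambda),\mathcal L(\mathcal H))$ is the set of completely positive kernels $\Gamma:X\times X\to\mathcal L(C_b(\Lambda),\mathcal L(\mathcal H))$, that is, those with $\sum_{i,j}\langle\Gamma(x_i,x_j)(a_ia_j^* )h_j,h_i\rangle\ge0$ for all finite families $x_i\in X$, $a_i\in C_b(\Lambda)$, $h_i\in\mathcal H$; equivalently, those of the form $\Gamma(x,y)(fg^* )=\gamma(x)\rho(f)\rho(g)^*\gamma(y)^*$ for a Hilbert space $\mathcal E$, a function $\gamma:X\to\mathcal L(\mathcal E,\mathcal H)$ and a unital $*$-representation $\rho:C_b(\Lambda)\to\mathcal L(\mathcal E)$. Transfer functions: a $C_b(\Lambda)$-unitary colligation is a triple $\Sigma=(U,\mathcal E,\rho)$, where $\mathcal E$ is a Hilbert space, $U=\begin{pmatrix}A&B\\C&D\end{pmatrix}$ is a unitary operator on $\mathcal E\oplus\mathcal H$, and $\rho:C_b(\Lambda)\to\mathcal L(\mathcal E)$ is a unital $*$-representation. Such a $\rho$ has the form $\rho(f)=\sum_\lambda P_\lambda\otimes f(\lambda)$, where the $P_\lambda$ are orthogonal projections with orthogonal ranges and $\mathcal E=\bigoplus_\lambda\operatorname{ran}P_\lambda\otimes\mathbb C^{n_\lambda}$. With $S(x)=\sum_\lambda P_\lambda\otimes\sigma_\lambda(x)$, the associated transfer function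 is $W_\Sigma(x)=D+CS(x)(1-AS(x))^{-1}B$.
   Formalization: C_b(Λ) is taken to be generated by the E_x together with the functions E⁺(x)E⁺(y)*−E⁻(x)E⁻(y)*, since these need not lie in the algebra generated by the E_x alone (e.g. Λ={3e_1,3e_2}), where (AD) would be undefined; otherwise nothing changes. *)

theory Defs
  imports "HOL-Analysis.Analysis" "Jordan_Normal_Form.Schur_Decomposition"
begin

section \<open>Complex Hilbert spaces\<close>

text \<open>The complex structure refines the library's real one, so that norm, topology and
  completeness are those of \<^class>\<open>real_inner\<close>. The inner product is linear in the first
  argument.\<close>

class chilbert = real_inner + complete_space +
  fixes scaleC :: "complex \<Rightarrow> 'a \<Rightarrow> 'a"  (infixr "*\<^sub>C" 75)
    and cinner :: "'a \<Rightarrow> 'a \<Rightarrow> complex"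
  assumes scaleC_add_right: "a *\<^sub>C (x + y) = a *\<^sub>C x + a *\<^sub>C y"
    and scaleC_add_left: "(a + b) *\<^sub>C x = a *\<^sub>C x + b *\<^sub>C x"
    and scaleC_scaleC: "a *\<^sub>C b *\<^sub>C x = (a * b) *\<^sub>C x"
    and scaleC_of_real: "complex_of_real r *\<^sub>C x = r *\<^sub>R x"
    and cinner_commute: "cinner x y = cnj (cinner y x)"
    and cinner_add_left: "cinner (x + y) z = cinner x z + cinner y z"
    and cinner_scaleC_left: "cinner (a *\<^sub>C x) y = a * cinner x y"
    and Re_cinner: "Re (cinner x y) = inner x y"

instantiation complex :: chilbert
begin
definition "scaleC_complex = ((*) :: complex \<Rightarrow> complex \<Rightarrow> complex)"
definition "cinner_complex z w = z * cnj w" for z w :: complex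
instance
  by standard (auto simp: scaleC_complex_def cinner_complex_def algebra_simps scaleR_conv_of_real
      inner_complex_def)
end

instantiation prod :: (chilbert, chilbert) chilbert
begin
definition "scaleC_prod a p = (a *\<^sub>C fst p, a *\<^sub>C snd p)" for p :: "'a \<times> 'b"
definition "cinner_prod p q = cinner (fst p) (fst q) + cinner (snd p) (snd q)" for p q :: "'a \<times> 'b"
instance
proof
  fix x y :: "'a \<times> 'b"
  show "cinner x y = cnj (cinner y x)"
    by (simp add: cinner_prod_def cinner_commute[symmetric])
qed (auto simp: scaleC_prod_def cinner_prod_def algebra_simps scaleC_add_right scaleC_add_left
      scaleC_scaleC scaleC_of_real scaleR_prod_def cinner_add_left cinner_scaleC_left Re_cinner inner_prod_def)
end


section \<open>The Hilbert space of square summable families\<close>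

typedef 'i ell2 = "{f :: 'i \<Rightarrow> complex. (\<lambda>i. (cmod (f i))\<^sup>2) summable_on UNIV}"
  by (rule exI[of _ "\<lambda>_. 0"]) simp

setup_lifting type_definition_ell2

lemma ell2_add_closed:
  fixes f g :: "'i \<Rightarrow> complex"
  assumes "(\<lambda>i. (cmod (f i))\<^sup>2) summable_on UNIV" "(\<lambda>i. (cmod (g i))\<^sup>2) summable_on UNIV"
  shows "(\<lambda>i. (cmod (f i + g i))\<^sup>2) summable_on UNIV"
proof (rule summable_on_comparison_test)
  show "(\<lambda>i. 2 * (cmod (f i))\<^sup>2 + 2 * (cmod (g i))\<^sup>2) summable_on UNIV"
    by (intro summable_on_add summable_on_cmult_right assms)
  fix i
  have "(cmod (f i + g i))\<^sup>2 \<le> (cmod (f i) + cmod (g i))\<^sup>2"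
    by (intro power_mono norm_triangle_ineq) auto
  also have "\<dots> \<le> 2 * (cmod (f i))\<^sup>2 + 2 * (cmod (g i))\<^sup>2"
    using sum_squares_ge_zero[of "cmod (f i) - cmod (g i)" 0] by (simp add: power2_eq_square algebra_simps)
  finally show "(cmod (f i + g i))\<^sup>2 \<le> 2 * (cmod (f i))\<^sup>2 + 2 * (cmod (g i))\<^sup>2" .
qed auto

lemma ell2_scale_closed:
  fixes f :: "'i \<Rightarrow> complex"
  assumes "(\<lambda>i. (cmod (f i))\<^sup>2) summable_on UNIV"
  shows "(\<lambda>i. (cmod (c * f i))\<^sup>2) summable_on UNIV"
  by (simp add: norm_mult power_mult_distrib summable_on_cmult_right assms)

lemma ell2_mult_summable:
  fixes f g :: "'i \<Rightarrow> complex"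
  assumes "(\<lambda>i. (cmod (f i))\<^sup>2) summable_on UNIV" "(\<lambda>i. (cmod (g i))\<^sup>2) summable_on UNIV"
  shows "(\<lambda>i. f i * cnj (g i)) summable_on UNIV"
proof (rule abs_summable_summable, rule summable_on_comparison_test)
  show "(\<lambda>i. (cmod (f i))\<^sup>2 + (cmod (g i))\<^sup>2) summable_on UNIV"
    by (intro summable_on_add assms)
  fix i
  have "cmod (f i) * cmod (g i) \<le> (cmod (f i))\<^sup>2 + (cmod (g i))\<^sup>2"
  proof -
    have "0 \<le> cmod (f i) * cmod (g i)" by simp
    then show ?thesis using sum_squares_bound[of "cmod (f i)" "cmod (g i)"] by linarith
  qed
  then show "norm (f i * cnj (g i)) \<le> (cmod (f i))\<^sup>2 + (cmod (g i))\<^sup>2"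
    by (simp add: norm_mult)
qed auto

instantiation ell2 :: (type) real_vector
begin
lift_definition zero_ell2 :: "'a ell2" is "\<lambda>_. 0" by simp
lift_definition plus_ell2 :: "'a ell2 \<Rightarrow> 'a ell2 \<Rightarrow> 'a ell2" is "\<lambda>f g i. f i + g i"
  by (rule ell2_add_closed)
lift_definition uminus_ell2 :: "'a ell2 \<Rightarrow> 'a ell2" is "\<lambda>f i. - f i" by simp
lift_definition minus_ell2 :: "'a ell2 \<Rightarrow> 'a ell2 \<Rightarrow> 'a ell2" is "\<lambda>f g i. f i - g i"
  using ell2_add_closed[of _ "\<lambda>i. - _ i"] by fastforce
lift_definition scaleR_ell2 :: "real \<Rightarrow> 'a ell2 \<Rightarrow> 'a ell2" is "\<lambda>r f i. complex_of_real r * f i"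
  by (rule ell2_scale_closed)
instance
  by (standard; transfer; auto simp: algebra_simps fun_eq_iff)
end

instantiation ell2 :: (type) real_inner
begin
definition "inner_ell2 x y = Re (\<Sum>\<^sub>\<infinity>i. Rep_ell2 x i * cnj (Rep_ell2 y i))" for x y :: "'a ell2"
definition "norm_ell2 x = sqrt (inner x x)" for x :: "'a ell2"
definition "dist_ell2 x y = norm (x - y)" for x y :: "'a ell2"
definition "sgn_ell2 x = x /\<^sub>R norm x" for x :: "'a ell2"
definition [code del]: "uniformity = (INF e\<in>{0 <..}. principal {(x :: 'a ell2, y). dist x y < e})"
definition [code del]: "open U = (\<forall>x\<in>U. \<forall>\<^sub>F (x', y) in uniformity. x' = x \<longrightarrow> y \<in> U)" for U :: "'a ell2 set"

lemma ell2_summable: "(\<lambda>i. Rep_ell2 x i * cnj (Rep_ell2 y i)) summable_on UNIV"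
  by (rule ell2_mult_summable) (use Rep_ell2 in auto)

lemma ell2_sq_summable: "(\<lambda>i. (cmod (Rep_ell2 x i))\<^sup>2) summable_on UNIV"
  using Rep_ell2 by auto

lemma inner_ell2_self: "inner x x = (\<Sum>\<^sub>\<infinity>i. (cmod (Rep_ell2 x i))\<^sup>2)" for x :: "'a ell2"
  unfolding inner_ell2_def infsum_Re[OF ell2_summable, symmetric]
  by (simp flip: complex_norm_square of_real_power)

instance
proof
  fix x y z :: "'a ell2" and r :: real
  show "dist x y = norm (x - y)" by (simp add: dist_ell2_def)
  show "sgn x = x /\<^sub>R norm x" by (simp add: sgn_ell2_def)
  show "uniformity = (INF e\<in>{0 <..}. principal {(x :: 'a ell2, y). dist x y < e})"
    by (rule uniformity_ell2_def)
  show "open U = (\<forall>x\<in>U. \<forall>\<^sub>F (x', y) in uniformity. x' = x \<longrightarrow> y \<in> U)" for U :: "'a ell2 set"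
    by (rule open_ell2_def)
  show "norm x = sqrt (inner x x)" by (simp add: norm_ell2_def)
  show "inner x y = inner y x"
  proof -
    have "(\<Sum>\<^sub>\<infinity>i. Rep_ell2 x i * cnj (Rep_ell2 y i)) = (\<Sum>\<^sub>\<infinity>i. cnj (Rep_ell2 y i * cnj (Rep_ell2 x i)))"
      by (simp add: mult.commute)
    also have "\<dots> = cnj (\<Sum>\<^sub>\<infinity>i. Rep_ell2 y i * cnj (Rep_ell2 x i))"
      by (rule infsum_cnj)
    finally show ?thesis by (simp add: inner_ell2_def)
  qed
  show "inner (x + y) z = inner x z + inner y z"
    unfolding inner_ell2_def
    by (simp add: plus_ell2.rep_eq algebra_simps infsum_add[OF ell2_summable ell2_summable])
  show "inner (r *\<^sub>R x) y = r * inner x y"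
    unfolding inner_ell2_def
    by (simp add: scaleR_ell2.rep_eq mult.assoc infsum_cmult_right')
  show "0 \<le> inner x x"
    unfolding inner_ell2_self by (rule infsum_nonneg) auto
  show "inner x x = 0 \<longleftrightarrow> x = 0"
  proof
    assume "inner x x = 0"
    then have "(cmod (Rep_ell2 x i))\<^sup>2 = 0" for i
      unfolding inner_ell2_self by (intro nonneg_infsum_le_0D[OF _ ell2_sq_summable]) auto
    then show "x = 0"
      by (intro Rep_ell2_inject[THEN iffD1] ext) (simp add: zero_ell2.rep_eq)
  qed (simp add: inner_ell2_self zero_ell2.rep_eq)
qed
end

lemma ell2_sum_le: "finite F \<Longrightarrow> (\<Sum>i\<in>F. (cmod (Rep_ell2 x i))\<^sup>2) \<le> (norm x)\<^sup>2"
  unfolding power2_norm_eq_inner[of x] inner_ell2_self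
  by (rule finite_sum_le_infsum[OF ell2_sq_summable]) auto

instance ell2 :: (type) complete_space
proof
  fix X :: "nat \<Rightarrow> 'a ell2"
  assume X: "Cauchy X"
  have coord: "cmod (Rep_ell2 x i) \<le> norm x" for x :: "'a ell2" and i
    using ell2_sum_le[of "{i}" x] by (simp add: power2_le_iff_abs_le)
  have "Cauchy (\<lambda>n. Rep_ell2 (X n) i)" for i
  proof (rule metric_CauchyI)
    fix e :: real assume "e > 0"
    then obtain N where "\<forall>m\<ge>N. \<forall>n\<ge>N. dist (X m) (X n) < e"
      using X by (auto simp: Cauchy_def)
    moreover have "dist (Rep_ell2 (X m) i) (Rep_ell2 (X n) i) \<le> dist (X m) (X n)" for m n
      using coord[of "X m - X n" i] by (simp add: dist_norm minus_ell2.rep_eq)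
    ultimately have "\<forall>m\<ge>N. \<forall>n\<ge>N. dist (Rep_ell2 (X m) i) (Rep_ell2 (X n) i) < e"
      by (meson le_less_trans)
    then show "\<exists>N. \<forall>m\<ge>N. \<forall>n\<ge>N. dist (Rep_ell2 (X m) i) (Rep_ell2 (X n) i) < e" by blast
  qed
  then have "\<forall>i. \<exists>l. (\<lambda>n. Rep_ell2 (X n) i) \<longlonglongrightarrow> l"
    using Cauchy_convergent_iff convergent_def by blast
  then obtain g where g: "\<And>i. (\<lambda>n. Rep_ell2 (X n) i) \<longlonglongrightarrow> g i" by metis
  have fin: "(\<Sum>i\<in>F. (cmod (Rep_ell2 (X m) i - g i))\<^sup>2) \<le> e\<^sup>2"
    if F: "finite F" and N: "\<forall>m\<ge>N. \<forall>n\<ge>N. dist (X m) (X n) < e" and m: "m \<ge> N" for F m N e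
  proof (rule tendsto_upperbound)
    show "(\<lambda>n. \<Sum>i\<in>F. (cmod (Rep_ell2 (X m) i - Rep_ell2 (X n) i))\<^sup>2) \<longlonglongrightarrow>
        (\<Sum>i\<in>F. (cmod (Rep_ell2 (X m) i - g i))\<^sup>2)"
      by (intro tendsto_intros g)
    show "\<forall>\<^sub>F n in sequentially. (\<Sum>i\<in>F. (cmod (Rep_ell2 (X m) i - Rep_ell2 (X n) i))\<^sup>2) \<le> e\<^sup>2"
    proof (rule eventually_sequentiallyI)
      fix n assume "n \<ge> N"
      then have "norm (X m - X n) < e" using N m by (simp add: dist_norm)
      then have "(norm (X m - X n))\<^sup>2 \<le> e\<^sup>2" by (intro power_mono) auto
      then show "(\<Sum>i\<in>F. (cmod (Rep_ell2 (X m) i - Rep_ell2 (X n) i))\<^sup>2) \<le> e\<^sup>2"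
        using ell2_sum_le[OF F, of "X m - X n"] by (simp add: minus_ell2.rep_eq)
    qed
  qed auto
  have summ: "(\<lambda>i. (cmod (Rep_ell2 (X m) i - g i))\<^sup>2) summable_on UNIV"
    if "\<forall>m\<ge>N. \<forall>n\<ge>N. dist (X m) (X n) < e" "m \<ge> N" for m N e
    by (rule nonneg_bdd_above_summable_on) (use fin[OF _ that] in \<open>auto intro!: bdd_aboveI2\<close>)
  obtain N1 where N1: "\<forall>m\<ge>N1. \<forall>n\<ge>N1. dist (X m) (X n) < 1"
    using metric_CauchyD[OF X, of 1] by auto
  have "(\<lambda>i. (cmod (g i))\<^sup>2) summable_on UNIV"
    using ell2_add_closed[OF ell2_sq_summable[of "X N1"] ell2_scale_closed[OF summ[OF N1 order_refl], of "-1"]]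
    by simp
  then have G: "Rep_ell2 (Abs_ell2 g) = g" by (simp add: Abs_ell2_inverse)
  have "X \<longlonglongrightarrow> Abs_ell2 g"
  proof (rule metric_LIMSEQ_I)
    fix r :: real assume "r > 0"
    then obtain N where N: "\<forall>m\<ge>N. \<forall>n\<ge>N. dist (X m) (X n) < r / 2"
      using metric_CauchyD[OF X, of "r / 2"] by auto
    have "dist (X m) (Abs_ell2 g) < r" if "m \<ge> N" for m
    proof -
      have "(norm (X m - Abs_ell2 g))\<^sup>2 = (\<Sum>\<^sub>\<infinity>i. (cmod (Rep_ell2 (X m) i - g i))\<^sup>2)"
        unfolding power2_norm_eq_inner[of "X m - Abs_ell2 g"] inner_ell2_self by (simp add: minus_ell2.rep_eq G)
      also have "\<dots> \<le> (r / 2)\<^sup>2"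
        by (rule infsum_le_finite_sums[OF summ[OF N that]]) (use fin[OF _ N that] in auto)
      finally have "norm (X m - Abs_ell2 g) \<le> r / 2"
        using \<open>r > 0\<close> by (simp add: power2_le_iff_abs_le)
      then show ?thesis using \<open>r > 0\<close> by (simp add: dist_norm)
    qed
    then show "\<exists>no. \<forall>n\<ge>no. dist (X n) (Abs_ell2 g) < r" by blast
  qed
  then show "convergent X" by (auto simp: convergent_def)
qed

instantiation ell2 :: (type) chilbert
begin
lift_definition scaleC_ell2 :: "complex \<Rightarrow> 'a ell2 \<Rightarrow> 'a ell2" is "\<lambda>c f i. c * f i"
  by (rule ell2_scale_closed)
definition "cinner_ell2 x y = (\<Sum>\<^sub>\<infinity>i. Rep_ell2 x i * cnj (Rep_ell2 y i))" for x y :: "'a ell2"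
instance
proof
  fix x y z :: "'a ell2" and r :: real and a b :: complex
  show "a *\<^sub>C (x + y) = a *\<^sub>C x + a *\<^sub>C y" by transfer (auto simp: algebra_simps)
  show "(a + b) *\<^sub>C x = a *\<^sub>C x + b *\<^sub>C x" by transfer (auto simp: algebra_simps)
  show "a *\<^sub>C b *\<^sub>C x = (a * b) *\<^sub>C x" by transfer (auto simp: algebra_simps)
  show "complex_of_real r *\<^sub>C x = r *\<^sub>R x" by transfer auto
  show "cinner x y = cnj (cinner y x)"
    by (simp add: cinner_ell2_def mult.commute flip: infsum_cnj)
  show "cinner (x + y) z = cinner x z + cinner y z"
    unfolding cinner_ell2_def
    by (simp add: plus_ell2.rep_eq algebra_simps infsum_add[OF ell2_summable ell2_summable])
  show "cinner (a *\<^sub>C x) y = a * cinner x y"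
    unfolding cinner_ell2_def
    by (simp add: scaleC_ell2.rep_eq mult.assoc infsum_cmult_right')
  show "Re (cinner x y) = inner x y" by (simp add: cinner_ell2_def inner_ell2_def)
qed
end

section \<open>Bounded operators and positive kernels\<close>

definition bounded_clinear :: "('a::chilbert \<Rightarrow> 'b::chilbert) \<Rightarrow> bool" where
  "bounded_clinear T \<longleftrightarrow> bounded_linear T \<and> (\<forall>c x. T (c *\<^sub>C x) = c *\<^sub>C T x)"

definition cadjoint :: "('a::chilbert \<Rightarrow> 'b::chilbert) \<Rightarrow> 'b \<Rightarrow> 'a" where
  "cadjoint T = (THE S. \<forall>x y. cinner (T x) y = cinner x (S y))"

definition unitary_op :: "('a::chilbert \<Rightarrow> 'b::chilbert) \<Rightarrow> bool" where
  "unitary_op U \<longleftrightarrow> bounded_clinear U \<and> cadjoint U \<circ> U = id \<and> U \<circ> cadjoint U = id"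

definition orthogonal_projection :: "('a::chilbert \<Rightarrow> 'a) \<Rightarrow> bool" where
  "orthogonal_projection P \<longleftrightarrow> bounded_clinear P \<and> P \<circ> P = P \<and> cadjoint P = P"

text \<open>Positivity of an operator valued kernel, the vectors ranging over a closed subspace \<open>S\<close>
  of the ambient Hilbert space.\<close>

definition positive_kernel_on :: "'h::chilbert set \<Rightarrow> ('x \<Rightarrow> 'x \<Rightarrow> 'h \<Rightarrow> 'h) \<Rightarrow> bool" where
  "positive_kernel_on S k \<longleftrightarrow>
     (\<forall>n. \<forall>x :: nat \<Rightarrow> 'x. \<forall>h :: nat \<Rightarrow> 'h. (\<forall>i<n. h i \<in> S) \<longrightarrow>
        (\<Sum>i<n. \<Sum>j<n. cinner (k (x i) (x j) (h j)) (h i)) \<in> \<real>\<^sub>\<ge>\<^sub>0)"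

abbreviation positive_kernel :: "('x \<Rightarrow> 'x \<Rightarrow> 'h::chilbert \<Rightarrow> 'h) \<Rightarrow> bool" where
  "positive_kernel \<equiv> positive_kernel_on UNIV"


section \<open>Hilbert space tensor products\<close>

text \<open>A bilinear map preserving inner products in this sense embeds the algebraic tensor product
  isometrically. The Hilbert space tensor product is the closed span of its range, and all such
  maps give the same space up to a unitary matching elementary tensors. One exists with values in
  $\ell^2$ of an index type that is large enough to contain pairs of basis vectors.\<close>

definition elementary_tensor :: "('a::chilbert \<Rightarrow> 'b::chilbert \<Rightarrow> 'c::chilbert) \<Rightarrow> bool" where
  "elementary_tensor t \<longleftrightarrow>
     (\<forall>a. bounded_clinear (t a)) \<and> (\<forall>b. bounded_clinear (\<lambda>a. t a b)) \<and>
     (\<forall>a b c d. cinner (t a b) (t c d) = cinner a c * cinner b d)"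

lemma cinner_add_right: "cinner x (y + z) = cinner x y + cinner x (z :: 'a::chilbert)"
  by (metis cinner_add_left cinner_commute complex_cnj_add)
lemma cinner_scaleC_right: "cinner x (a *\<^sub>C y) = cnj a * cinner x (y :: 'a::chilbert)"
  by (metis cinner_scaleC_left cinner_commute complex_cnj_mult)
lemma scaleC_zero_left [simp]: "0 *\<^sub>C x = (0 :: 'a::chilbert)"
  using scaleC_of_real[of 0 x] by simp
lemma scaleC_minus_one: "(-1) *\<^sub>C x = - (x :: 'a::chilbert)"
  using scaleC_of_real[of "-1" x] by simp
lemma cinner_zero_left [simp]: "cinner 0 (y :: 'a::chilbert) = 0"
  using cinner_scaleC_left[of 0 0 y] by simp
lemma cinner_minus_left: "cinner (- x) (y :: 'a::chilbert) = - cinner x y"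
  using cinner_scaleC_left[of "-1" x y] by (simp add: scaleC_minus_one)
lemma cinner_diff_left: "cinner (x - y) (z :: 'a::chilbert) = cinner x z - cinner y z"
  using cinner_add_left[of x "- y" z] by (simp add: cinner_minus_left)
lemma cinner_scaleR_left: "cinner (r *\<^sub>R x) (y :: 'a::chilbert) = r *\<^sub>R cinner x y"
  by (metis scaleC_of_real cinner_scaleC_left scaleR_conv_of_real)
lemma cinner_self: "cinner x (x :: 'a::chilbert) = complex_of_real ((norm x)\<^sup>2)"
proof -
  have "Im (cinner x x) = 0" using cinner_commute[of x x] by (simp add: complex_eq_iff)
  moreover have "Re (cinner x x) = (norm x)\<^sup>2" by (simp add: Re_cinner power2_norm_eq_inner)
  ultimately show ?thesis by (simp add: complex_eq_iff)
qed
lemma norm_scaleC: "norm (a *\<^sub>C (x :: 'a::chilbert)) = cmod a * norm x"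
proof -
  have "complex_of_real ((norm (a *\<^sub>C x))\<^sup>2) = complex_of_real ((cmod a * norm x)\<^sup>2)"
    unfolding power_mult_distrib of_real_mult cinner_self[of x, symmetric] cinner_self[of "a *\<^sub>C x", symmetric]
      cinner_scaleC_left cinner_scaleC_right complex_norm_square
    by (simp add: mult.assoc)
  then have "(norm (a *\<^sub>C x))\<^sup>2 = (cmod a * norm x)\<^sup>2" by (simp only: of_real_eq_iff)
  then show ?thesis by (simp add: power2_eq_iff_nonneg)
qed
lemma cinner_Cauchy_Schwarz: "cmod (cinner x y) \<le> norm x * norm (y :: 'a::chilbert)"
proof (cases "cinner x y = 0")
  case False
  define c where "c = cnj (cinner x y) / cmod (cinner x y)"
  have c: "cmod c = 1" using False by (simp add: c_def norm_divide)
  have "cinner (c *\<^sub>C x) y = complex_of_real (cmod (cinner x y))"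
    using False unfolding cinner_scaleC_left c_def
    by (simp add: field_simps power2_eq_square flip: complex_norm_square)
  then have "cmod (cinner x y) = inner (c *\<^sub>C x) y" by (simp flip: Re_cinner)
  also have "\<dots> \<le> norm (c *\<^sub>C x) * norm y" by (rule norm_cauchy_schwarz)
  finally show ?thesis by (simp add: norm_scaleC c)
qed simp
lemma bounded_linear_cinner_left: "bounded_linear (\<lambda>x. cinner x (y :: 'a::chilbert))"
  by (rule bounded_linear_intro[where K = "norm y"])
    (simp_all add: cinner_add_left cinner_scaleR_left cinner_Cauchy_Schwarz)

definition orthonormal :: "'a::chilbert set \<Rightarrow> bool" where
  "orthonormal B \<longleftrightarrow> (\<forall>u\<in>B. \<forall>v\<in>B. cinner u v = (if u = v then 1 else 0))"

lemma maximal_orthonormal: "\<exists>B :: 'a::chilbert set. orthonormal B \<and> (\<forall>x. (\<forall>u\<in>B. cinner x u = 0) \<longrightarrow> x = 0)"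
proof -
  have "\<exists>M\<in>Collect (orthonormal :: 'a set \<Rightarrow> bool). \<forall>X\<in>Collect orthonormal. M \<subseteq> X \<longrightarrow> X = M"
  proof (rule subset_Zorn')
    fix C :: "'a set set" assume C: "subset.chain (Collect orthonormal) C"
    show "\<Union> C \<in> Collect orthonormal"
      unfolding mem_Collect_eq orthonormal_def
    proof (intro ballI)
      fix u v assume "u \<in> \<Union> C" "v \<in> \<Union> C"
      then obtain D where "D \<in> C" "u \<in> D" "v \<in> D"
        using C unfolding subset_chain_def by blast
      moreover have "orthonormal D" using C \<open>D \<in> C\<close> unfolding subset_chain_def by blast
      ultimately show "cinner u v = (if u = v then 1 else 0)" by (auto simp: orthonormal_def)
    qed
  qed
  then obtain B :: "'a set" where B: "orthonormal B" and max: "\<And>X. orthonormal X \<Longrightarrow> B \<subseteq> X \<Longrightarrow> X = B"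
    by auto
  have "x = 0" if x: "\<forall>u\<in>B. cinner x u = 0" for x
  proof (rule ccontr)
    assume "x \<noteq> 0"
    define y where "y = complex_of_real (inverse (norm x)) *\<^sub>C x"
    have "norm y = 1" using \<open>x \<noteq> 0\<close> by (simp add: y_def norm_scaleC norm_inverse del: of_real_inverse)
    then have yy: "cinner y y = 1" by (simp add: cinner_self)
    have "cinner y u = 0" "cinner u y = 0" if "u \<in> B" for u
      using x that by (simp_all add: y_def cinner_scaleC_left cinner_scaleC_right cinner_commute[of u x])
    then have "orthonormal (insert y B)" using B yy by (auto simp: orthonormal_def)
    then have "insert y B = B" by (rule max) auto
    then have "y \<in> B" by blast
    then have "cinner y y = 0" using \<open>\<And>u. u \<in> B \<Longrightarrow> cinner y u = 0\<close> by blast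
    then show False using yy by simp
  qed
  then show ?thesis using B by blast
qed

lemma cinner_sum_left: "cinner (sum f F) y = (\<Sum>u\<in>F. cinner (f u) (y :: 'a::chilbert))"
  by (induction F rule: infinite_finite_induct) (auto simp: cinner_add_left)

lemma cinner_sum_orthonormal:
  assumes "orthonormal (B :: 'a::chilbert set)" "finite F" "F \<subseteq> B" "v \<in> B"
  shows "cinner (\<Sum>u\<in>F. c u *\<^sub>C u) v = (if v \<in> F then c v else 0)"
proof -
  have "cinner (\<Sum>u\<in>F. c u *\<^sub>C u) v = (\<Sum>u\<in>F. if u = v then c u else 0)"
    unfolding cinner_sum_left using assms
    by (intro sum.cong) (auto simp: orthonormal_def cinner_scaleC_left subset_iff)
  then show ?thesis using assms(2) by simp
qed

lemma norm_sum_orthonormal: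
  assumes "orthonormal (B :: 'a::chilbert set)" "finite F" "F \<subseteq> B"
  shows "(norm (\<Sum>u\<in>F. c u *\<^sub>C u))\<^sup>2 = (\<Sum>u\<in>F. (cmod (c u))\<^sup>2)"
proof -
  let ?s = "\<Sum>u\<in>F. c u *\<^sub>C u"
  have "cinner ?s ?s = (\<Sum>u\<in>F. c u * cnj (cinner ?s u))"
    by (subst cinner_sum_left) (simp add: cinner_scaleC_left flip: cinner_commute)
  also have "\<dots> = (\<Sum>u\<in>F. c u * cnj (c u))"
    by (intro sum.cong refl) (use assms in \<open>simp add: cinner_sum_orthonormal[OF assms] subset_iff\<close>)
  also have "\<dots> = complex_of_real (\<Sum>u\<in>F. (cmod (c u))\<^sup>2)"
    by (simp flip: complex_norm_square)
  finally show ?thesis unfolding cinner_self by (simp only: of_real_eq_iff)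
qed

lemma Bessel_finite:
  assumes "orthonormal (B :: 'a::chilbert set)" "finite F" "F \<subseteq> B"
  shows "(\<Sum>u\<in>F. (cmod (cinner a u))\<^sup>2) \<le> (norm a)\<^sup>2"
proof -
  let ?s = "\<Sum>u\<in>F. cinner a u *\<^sub>C u"
  have "cinner ?s a = (\<Sum>u\<in>F. cinner a u * cnj (cinner a u))"
    by (simp add: cinner_sum_left cinner_scaleC_left flip: cinner_commute)
  also have "\<dots> = complex_of_real (\<Sum>u\<in>F. (cmod (cinner a u))\<^sup>2)"
    by (simp flip: complex_norm_square)
  finally have 1: "inner ?s a = (\<Sum>u\<in>F. (cmod (cinner a u))\<^sup>2)" by (simp flip: Re_cinner)
  have "0 \<le> (norm (a - ?s))\<^sup>2" by simp
  also have "\<dots> = (norm a)\<^sup>2 - 2 * inner ?s a + (norm ?s)\<^sup>2"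
    by (simp add: power2_norm_eq_inner inner_diff_left inner_diff_right inner_commute)
  finally show ?thesis using 1 norm_sum_orthonormal[OF assms, of "cinner a"] by simp
qed

lemma orthonormal_summable:
  assumes B: "orthonormal (B :: 'a::chilbert set)" and c: "(\<lambda>u. (cmod (c u))\<^sup>2) summable_on B"
  shows "(\<lambda>u. c u *\<^sub>C u) summable_on B"
proof -
  let ?S = "\<Sum>\<^sub>\<infinity>u\<in>B. (cmod (c u))\<^sup>2"
  have "cauchy_filter (filtermap (sum (\<lambda>u. c u *\<^sub>C u)) (finite_subsets_at_top B))"
  proof (subst cauchy_filter_metric_filtermap, intro allI impI)
    fix e :: real assume e: "e > 0"
    have "((\<lambda>u. (cmod (c u))\<^sup>2) has_sum ?S) B" using c by simp
    then have "\<forall>\<^sub>F F in finite_subsets_at_top B. dist (\<Sum>u\<in>F. (cmod (c u))\<^sup>2) ?S < (e/2)\<^sup>2"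
      unfolding has_sum_def using e by (intro tendstoD) auto
    then obtain F0 where F0: "finite F0" "F0 \<subseteq> B" "dist (\<Sum>u\<in>F0. (cmod (c u))\<^sup>2) ?S < (e/2)\<^sup>2"
      unfolding eventually_finite_subsets_at_top by blast
    let ?P = "\<lambda>F. finite F \<and> F0 \<subseteq> F \<and> F \<subseteq> B"
    have near: "dist (\<Sum>u\<in>F. c u *\<^sub>C u) (\<Sum>u\<in>F0. c u *\<^sub>C u) < e / 2" if F: "?P F" for F
    proof -
      have "(\<Sum>u\<in>F. c u *\<^sub>C u) - (\<Sum>u\<in>F0. c u *\<^sub>C u) = (\<Sum>u\<in>F - F0. c u *\<^sub>C u)"
        using F by (simp add: sum_diff)
      then have "(dist (\<Sum>u\<in>F. c u *\<^sub>C u) (\<Sum>u\<in>F0. c u *\<^sub>C u))\<^sup>2 = (\<Sum>u\<in>F - F0. (cmod (c u))\<^sup>2)"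
        using norm_sum_orthonormal[OF B, of "F - F0" c] F by (auto simp: dist_norm)
      also have "\<dots> = (\<Sum>u\<in>F. (cmod (c u))\<^sup>2) - (\<Sum>u\<in>F0. (cmod (c u))\<^sup>2)"
        using F by (simp add: sum_diff)
      also have "\<dots> \<le> ?S - (\<Sum>u\<in>F0. (cmod (c u))\<^sup>2)"
        using finite_sum_le_infsum[OF c, of F] F by simp
      also have "\<dots> < (e/2)\<^sup>2" using F0(3) by (simp add: dist_real_def)
      finally show ?thesis using e by (intro power_less_imp_less_base[of _ 2 "e / 2"]) auto
    qed
    have "eventually ?P (finite_subsets_at_top B)"
      unfolding eventually_finite_subsets_at_top using F0 by blast
    moreover have "\<forall>F F'. ?P F \<and> ?P F' \<longrightarrow> dist (\<Sum>u\<in>F. c u *\<^sub>C u) (\<Sum>u\<in>F'. c u *\<^sub>C u) < e"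
      using near by (meson dist_triangle_half_l)
    ultimately show "\<exists>P. eventually P (finite_subsets_at_top B) \<and>
        (\<forall>F F'. P F \<and> P F' \<longrightarrow> dist (\<Sum>u\<in>F. c u *\<^sub>C u) (\<Sum>u\<in>F'. c u *\<^sub>C u) < e)"
      by (intro exI[of _ ?P] conjI)
  qed
  moreover have "complete (UNIV :: 'a set)"
    by (meson Cauchy_convergent UNIV_I complete_def convergent_def)
  ultimately obtain L where "(sum (\<lambda>u. c u *\<^sub>C u) \<longlongrightarrow> L) (finite_subsets_at_top B)"
    using complete_uniform[where S = "UNIV :: 'a set"] by (force simp: filterlim_def)
  then show ?thesis using summable_on_def has_sum_def by blast
qed

lemma Parseval:
  assumes B: "orthonormal (B :: 'a::chilbert set)" and max: "\<forall>x. (\<forall>u\<in>B. cinner x u = 0) \<longrightarrow> x = 0"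
  shows "((\<lambda>u. cinner a u * cnj (cinner d u)) has_sum cinner a d) B"
proof -
  have sq: "(\<lambda>u. (cmod (cinner a u))\<^sup>2) summable_on B"
    by (rule nonneg_bdd_above_summable_on) (auto intro!: bdd_aboveI2 Bessel_finite[OF B])
  then obtain s where s: "((\<lambda>u. cinner a u *\<^sub>C u) has_sum s) B"
    using orthonormal_summable[OF B] unfolding summable_on_def by blast
  have inn: "((\<lambda>u. cinner a u * cinner u y) has_sum cinner s y) B" for y
    using has_sum_bounded_linear[OF bounded_linear_cinner_left s, of y] by (simp add: cinner_scaleC_left)
  have "cinner (a - s) v = 0" if v: "v \<in> B" for v
  proof -
    have "((\<lambda>u. cinner a u * cinner u v) has_sum cinner a v) B"
      using has_sum_finite_neutralI[of "{v}" B "\<lambda>u. cinner a u * cinner u v"] v B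
      by (auto simp: orthonormal_def)
    then have "cinner s v = cinner a v" using inn[of v] by (rule has_sum_unique[rotated])
    then show ?thesis by (simp add: cinner_diff_left)
  qed
  then have "s = a" using max by (metis eq_iff_diff_eq_0)
  then show ?thesis using inn[of d] by (simp flip: cinner_commute)
qed

lemma bounded_clinear_isometricI:
  assumes "\<And>x y. T (x + y) = T x + T y" "\<And>c x. T (c *\<^sub>C x) = c *\<^sub>C T x" "\<And>x. norm (T x) \<le> norm x * K"
  shows "bounded_clinear T"
  unfolding bounded_clinear_def
proof (intro conjI allI)
  show "bounded_linear T"
    by (rule bounded_linear_intro[OF assms(1) _ assms(3)]) (simp add: assms(2) flip: scaleC_of_real)
qed (rule assms(2))

lemma has_sum_Times_complex:
  fixes f :: "'a \<Rightarrow> complex" and g :: "'b \<Rightarrow> complex"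
  assumes f: "(f has_sum x) A" and g: "(g has_sum y) B"
  shows "((\<lambda>(u, v). f u * g v) has_sum x * y) (A \<times> B)"
proof (rule has_sum_SigmaI[where g = "\<lambda>u. f u * y"])
  have fs: "(\<lambda>u. norm (f u)) summable_on A" and gs: "(\<lambda>v. norm (g v)) summable_on B"
    using f g summable_on_iff_abs_summable_on_complex summable_on_def by blast+
  have "(\<lambda>p. norm ((\<lambda>(u, v). f u * g v) p)) summable_on A \<times> B"
    by (subst Infinite_Sum.abs_summable_on_Sigma_iff)
      (auto simp: norm_mult abs_mult infsum_cmult_right' intro!: summable_on_cmult_right summable_on_cmult_left fs gs)
  then show "(\<lambda>(u, v). f u * g v) summable_on A \<times> B" by (rule abs_summable_summable)
qed (auto intro!: has_sum_cmult_right has_sum_cmult_left f g)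

lemma elementary_tensor_exists: "\<exists>t :: 'a::chilbert \<Rightarrow> 'b::chilbert \<Rightarrow> ('a \<times> 'b) ell2. elementary_tensor t"
proof -
  obtain A :: "'a set" where A: "orthonormal A" "\<forall>x. (\<forall>u\<in>A. cinner x u = 0) \<longrightarrow> x = 0"
    using maximal_orthonormal by blast
  obtain B :: "'b set" where B: "orthonormal B" "\<forall>x. (\<forall>u\<in>B. cinner x u = 0) \<longrightarrow> x = 0"
    using maximal_orthonormal by blast
  define f where "f a b = (\<lambda>(u, v). if u \<in> A \<and> v \<in> B then cinner a u * cinner b v else 0)" for a :: 'a and b :: 'b
  have prod: "((\<lambda>p. f a b p * cnj (f c d p)) has_sum cinner a c * cinner b d) UNIV" for a b c d
  proof -
    have "((\<lambda>(u, v). (cinner a u * cnj (cinner c u)) * (cinner b v * cnj (cinner d v)))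
        has_sum cinner a c * cinner b d) (A \<times> B)"
      by (intro has_sum_Times_complex Parseval A B)
    also have "?this \<longleftrightarrow> ((\<lambda>p. f a b p * cnj (f c d p)) has_sum cinner a c * cinner b d) UNIV"
      by (rule has_sum_cong_neutral) (auto simp: f_def split: if_splits)
    finally show ?thesis .
  qed
  have sq: "(\<lambda>p. (cmod (f a b p))\<^sup>2) summable_on UNIV" for a b
  proof -
    have "(\<lambda>p. Re (f a b p * cnj (f a b p))) summable_on UNIV"
      using prod[of a b a b] by (intro summable_on_Re) (auto simp: summable_on_def)
    then show ?thesis by (simp flip: complex_norm_square of_real_power)
  qed
  define t where "t a b = Abs_ell2 (f a b)" for a b
  have Rep: "Rep_ell2 (t a b) = f a b" for a b
    unfolding t_def by (rule Abs_ell2_inverse) (simp add: sq)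
  have inn: "cinner (t a b) (t c d) = cinner a c * cinner b d" for a b c d
    unfolding cinner_ell2_def Rep using prod by (rule infsumI)
  have nrm: "norm (t a b) = norm a * norm b" for a b
  proof -
    have "complex_of_real ((norm (t a b))\<^sup>2) = complex_of_real ((norm a * norm b)\<^sup>2)"
      by (simp only: cinner_self[symmetric] inn power_mult_distrib of_real_mult)
    then have "(norm (t a b))\<^sup>2 = (norm a * norm b)\<^sup>2" by (simp only: of_real_eq_iff)
    then show ?thesis by (simp add: power2_eq_iff_nonneg)
  qed
  note rep = Rep plus_ell2.rep_eq scaleC_ell2.rep_eq f_def cinner_add_left cinner_scaleC_left
  have add: "t a (b + c) = t a b + t a c" "t (a + d) b = t a b + t d b" for a b c d
    by (rule Rep_ell2_inject[THEN iffD1]; auto simp: rep fun_eq_iff ring_distribs)+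
  have scale: "t a (z *\<^sub>C b) = z *\<^sub>C t a b" "t (z *\<^sub>C a) b = z *\<^sub>C t a b" for a b z
    by (rule Rep_ell2_inject[THEN iffD1]; auto simp: rep fun_eq_iff)+
  have "bounded_clinear (t a)" for a
    by (rule bounded_clinear_isometricI[where K = "norm a"]) (simp_all add: add scale nrm)
  moreover have "bounded_clinear (\<lambda>a. t a b)" for b
    by (rule bounded_clinear_isometricI[where K = "norm b"]) (simp_all add: add scale nrm)
  ultimately have "elementary_tensor t" using inn by (simp add: elementary_tensor_def)
  then show ?thesis by blast
qed

definition htensor :: "'a::chilbert \<Rightarrow> 'b::chilbert \<Rightarrow> ('a \<times> 'b) ell2"  (infixr "\<otimes>\<^sub>h" 70) where
  "htensor = (SOME t. elementary_tensor t)"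

lemma elementary_tensor_htensor: "elementary_tensor htensor"
  unfolding htensor_def using elementary_tensor_exists by (rule someI_ex)

definition tensor_space :: "('a::chilbert \<times> 'b::chilbert) ell2 set" where
  "tensor_space = closure (span (range (\<lambda>(a, b). a \<otimes>\<^sub>h b)))"

text \<open>\<open>op_tensor A B\<close> is determined on \<^const>\<open>tensor_space\<close> only, which is where it is used.\<close>

definition op_tensor :: "('a::chilbert \<Rightarrow> 'a) \<Rightarrow> ('b::chilbert \<Rightarrow> 'b) \<Rightarrow>
    ('a \<times> 'b) ell2 \<Rightarrow> ('a \<times> 'b) ell2" where
  "op_tensor A B = (SOME T. bounded_clinear T \<and> (\<forall>a b. T (a \<otimes>\<^sub>h b) = A a \<otimes>\<^sub>h B b))"


section \<open>Test functions, preorderings and the algebras they define\<close>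

text \<open>The set \<open>X\<close> is the type \<open>'x\<close>; the test functions are indexed by a finite type \<open>'i\<close>,
  and tuples in $\mathbb N^d$ are functions \<open>'i \<Rightarrow> nat\<close>, with the pointwise order.\<close>

definition test_functions :: "('i::finite \<Rightarrow> 'x \<Rightarrow> complex) \<Rightarrow> bool" where
  "test_functions \<psi> \<longleftrightarrow>
     (\<forall>x. (MAX i. cmod (\<psi> i x)) < 1) \<and> (\<forall>x y. x \<noteq> y \<longrightarrow> (\<exists>i. \<psi> i x \<noteq> \<psi> i y))"

definition preordering_set :: "('i::finite \<Rightarrow> nat) set \<Rightarrow> bool" where
  "preordering_set \<Lambda> \<longleftrightarrow> finite \<Lambda> \<and> (\<forall>i. \<exists>l\<in>\<Lambda>. (\<lambda>j. if j = i then 1 else 0) \<le> l)"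

definition adm_kernels :: "('i::finite \<Rightarrow> 'x \<Rightarrow> complex) \<Rightarrow> ('i \<Rightarrow> nat) set \<Rightarrow>
    ('x \<Rightarrow> 'x \<Rightarrow> 'h::chilbert \<Rightarrow> 'h) set" where
  "adm_kernels \<psi> \<Lambda> = {k. (\<forall>x y. bounded_clinear (k x y)) \<and> positive_kernel k \<and>
     (\<forall>l\<in>\<Lambda>. positive_kernel
        (\<lambda>x y h. (\<Prod>i\<in>UNIV. (1 - \<psi> i x * cnj (\<psi> i y)) ^ l i) *\<^sub>C k x y h))}"

definition Hinf_bound :: "('i::finite \<Rightarrow> 'x \<Rightarrow> complex) \<Rightarrow> ('i \<Rightarrow> nat) set \<Rightarrow>
    ('x \<Rightarrow> 'h::chilbert \<Rightarrow> 'h) \<Rightarrow> real \<Rightarrow> bool" where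
  "Hinf_bound \<psi> \<Lambda> \<phi> c \<longleftrightarrow> 0 \<le> c \<and>
     (\<forall>k :: 'x \<Rightarrow> 'x \<Rightarrow> 'h \<Rightarrow> 'h. k \<in> adm_kernels \<psi> \<Lambda> \<longrightarrow>
        positive_kernel_on tensor_space
          (\<lambda>x y. op_tensor (\<lambda>h. c\<^sup>2 *\<^sub>R h - \<phi> x (cadjoint (\<phi> y) h)) (k x y)))"

definition Hinf :: "('i::finite \<Rightarrow> 'x \<Rightarrow> complex) \<Rightarrow> ('i \<Rightarrow> nat) set \<Rightarrow>
    ('x \<Rightarrow> 'h::chilbert \<Rightarrow> 'h) set" where
  "Hinf \<psi> \<Lambda> = {\<phi>. (\<forall>x. bounded_clinear (\<phi> x)) \<and> (\<exists>c. Hinf_bound \<psi> \<Lambda> \<phi> c)}"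

definition Hinf_norm :: "('i::finite \<Rightarrow> 'x \<Rightarrow> complex) \<Rightarrow> ('i \<Rightarrow> nat) set \<Rightarrow>
    ('x \<Rightarrow> 'h::chilbert \<Rightarrow> 'h) \<Rightarrow> real" where
  "Hinf_norm \<psi> \<Lambda> \<phi> = (LEAST c. Hinf_bound \<psi> \<Lambda> \<phi> c)"

definition Hinf_unit_ball :: "('i::finite \<Rightarrow> 'x \<Rightarrow> complex) \<Rightarrow> ('i \<Rightarrow> nat) set \<Rightarrow>
    ('x \<Rightarrow> 'h::chilbert \<Rightarrow> 'h) set" where
  "Hinf_unit_ball \<psi> \<Lambda> = {\<phi> \<in> Hinf \<psi> \<Lambda>. Hinf_norm \<psi> \<Lambda> \<phi> \<le> 1}"


subsection \<open>The scalar algebra and its continuous part\<close>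

text \<open>For one-dimensional coefficients a scalar is identified with the operator of multiplication
  by it.\<close>

definition mult_op :: "('x \<Rightarrow> complex) \<Rightarrow> 'x \<Rightarrow> complex \<Rightarrow> complex" where
  "mult_op f x z = f x * z"

definition Hinf_scalar :: "('i::finite \<Rightarrow> 'x \<Rightarrow> complex) \<Rightarrow> ('i \<Rightarrow> nat) set \<Rightarrow> ('x \<Rightarrow> complex) set" where
  "Hinf_scalar \<psi> \<Lambda> = {f. mult_op f \<in> Hinf \<psi> \<Lambda>}"

definition functionals :: "('i::finite \<Rightarrow> 'x \<Rightarrow> complex) \<Rightarrow> ('i \<Rightarrow> nat) set \<Rightarrow>
    (('x \<Rightarrow> complex) \<Rightarrow> complex) set" where
  "functionals \<psi> \<Lambda> = {L \<in> extensional (Hinf_scalar \<psi> \<Lambda>).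
     (\<forall>f\<in>Hinf_scalar \<psi> \<Lambda>. \<forall>g\<in>Hinf_scalar \<psi> \<Lambda>. L (\<lambda>x. f x + g x) = L f + L g) \<and>
     (\<forall>f\<in>Hinf_scalar \<psi> \<Lambda>. \<forall>c. L (\<lambda>x. c * f x) = c * L f) \<and>
     (\<exists>C. \<forall>f\<in>Hinf_scalar \<psi> \<Lambda>. cmod (L f) \<le> C * Hinf_norm \<psi> \<Lambda> (mult_op f))}"

text \<open>Two functionals are identified when their difference vanishes on the test functions.\<close>

definition functional_rel :: "('i::finite \<Rightarrow> 'x \<Rightarrow> complex) \<Rightarrow> ('i \<Rightarrow> nat) set \<Rightarrow>
    (('x \<Rightarrow> complex) \<Rightarrow> complex) rel" where
  "functional_rel \<psi> \<Lambda> = {(L, M). L \<in> functionals \<psi> \<Lambda> \<and> M \<in> functionals \<psi> \<Lambda> \<and> (\<forall>i. L (\<psi> i) - M (\<psi> i) = 0)}"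

text \<open>The quotient carries the weakest topology making all maps $[L] \mapsto L(\psi_i)$ continuous,
  that is, the pullback of the product topology along the joint evaluation.\<close>

definition quotient_top :: "('i::finite \<Rightarrow> 'x \<Rightarrow> complex) \<Rightarrow> ('i \<Rightarrow> nat) set \<Rightarrow>
    (('x \<Rightarrow> complex) \<Rightarrow> complex) set topology" where
  "quotient_top \<psi> \<Lambda> = pullback_topology (functionals \<psi> \<Lambda> // functional_rel \<psi> \<Lambda>)
     (\<lambda>q i. the_elem ((\<lambda>L. L (\<psi> i)) ` q)) euclidean"

definition point_class :: "('i::finite \<Rightarrow> 'x \<Rightarrow> complex) \<Rightarrow> ('i \<Rightarrow> nat) set \<Rightarrow> 'x \<Rightarrow>
    (('x \<Rightarrow> complex) \<Rightarrow> complex) set" where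
  "point_class \<psi> \<Lambda> x = functional_rel \<psi> \<Lambda> `` {restrict (\<lambda>f. f x) (Hinf_scalar \<psi> \<Lambda>)}"

definition Xbar :: "('i::finite \<Rightarrow> 'x \<Rightarrow> complex) \<Rightarrow> ('i \<Rightarrow> nat) set \<Rightarrow>
    (('x \<Rightarrow> complex) \<Rightarrow> complex) set set" where
  "Xbar \<psi> \<Lambda> = quotient_top \<psi> \<Lambda> closure_of range (point_class \<psi> \<Lambda>)"

definition A_algebra :: "('i::finite \<Rightarrow> 'x \<Rightarrow> complex) \<Rightarrow> ('i \<Rightarrow> nat) set \<Rightarrow> ('x \<Rightarrow> complex) set" where
  "A_algebra \<psi> \<Lambda> = {f \<in> Hinf_scalar \<psi> \<Lambda>.
     \<exists>F. continuous_map (subtopology (quotient_top \<psi> \<Lambda>) (Xbar \<psi> \<Lambda>)) euclidean F \<and>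
         (\<forall>x. F (point_class \<psi> \<Lambda> x) = f x)}"


section \<open>Auxiliary test functions\<close>

text \<open>The $|\lambda|$ factors: the pair $(i, j)$ is the $j$-th copy of $\psi_i$.\<close>

definition slots :: "('i::finite \<Rightarrow> nat) \<Rightarrow> ('i \<times> nat) set" where
  "slots l = {(i, j). j < l i}"

definition nlam :: "('i::finite \<Rightarrow> nat) \<Rightarrow> nat" where
  "nlam l = 2 ^ ((\<Sum>i\<in>UNIV. l i) - 1)"

text \<open>The fixed orders: \<open>ev l\<close> and \<open>od l\<close> list the subsets of even and of odd cardinality, the
  first even one being empty.\<close>

definition subset_orders :: "('i::finite \<Rightarrow> nat) set \<Rightarrow> (('i \<Rightarrow> nat) \<Rightarrow> nat \<Rightarrow> ('i \<times> nat) set) \<Rightarrow>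
    (('i \<Rightarrow> nat) \<Rightarrow> nat \<Rightarrow> ('i \<times> nat) set) \<Rightarrow> bool" where
  "subset_orders \<Lambda> ev od \<longleftrightarrow> (\<forall>l\<in>\<Lambda>. l \<noteq> (\<lambda>_. 0) \<longrightarrow>
     bij_betw (ev l) {..<nlam l} {S. S \<subseteq> slots l \<and> even (card S)} \<and> ev l 0 = {} \<and>
     bij_betw (od l) {..<nlam l} {S. S \<subseteq> slots l \<and> odd (card S)})"

text \<open>With \<open>S = ev l\<close> and \<open>S = od l\<close> this is $\psi_\lambda^+$ and $\psi_\lambda^-$.\<close>

definition psi_row :: "('i::finite \<Rightarrow> 'x \<Rightarrow> complex) \<Rightarrow> (nat \<Rightarrow> ('i \<times> nat) set) \<Rightarrow> nat \<Rightarrow> 'x \<Rightarrow> complex mat" where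
  "psi_row \<psi> S n x = Matrix.mat 1 n (\<lambda>(_, j). \<Prod>s\<in>S j. \<psi> (fst s) x)"

definition sigma :: "('i::finite \<Rightarrow> 'x \<Rightarrow> complex) \<Rightarrow> (('i \<Rightarrow> nat) \<Rightarrow> nat \<Rightarrow> ('i \<times> nat) set) \<Rightarrow>
    (('i \<Rightarrow> nat) \<Rightarrow> nat \<Rightarrow> ('i \<times> nat) set) \<Rightarrow> ('i \<Rightarrow> nat) \<Rightarrow> 'x \<Rightarrow> complex mat" where
  "sigma \<psi> ev od l x =
     (let p = psi_row \<psi> (ev l) (nlam l) x; m = psi_row \<psi> (od l) (nlam l) x
      in inverse ((p * mat_adjoint p) $$ (0, 0)) \<cdot>\<^sub>m (mat_adjoint p * m))"


section \<open>The algebra of matrix functions on the preordering\<close>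

type_synonym 'i matfun = "('i \<Rightarrow> nat) \<Rightarrow> complex mat"

text \<open>A matrix function on the nonzero elements of \<open>\<Lambda>\<close> is extended by the empty matrix, which is
  preserved by all the pointwise operations.\<close>

definition on_nonzero :: "('i \<Rightarrow> nat) set \<Rightarrow> 'i matfun \<Rightarrow> 'i matfun" where
  "on_nonzero \<Lambda> f = (\<lambda>l. if l \<in> \<Lambda> \<and> l \<noteq> (\<lambda>_. 0) then f l else 0\<^sub>m 0 0)"

definition matfuns :: "('i::finite \<Rightarrow> nat) set \<Rightarrow> 'i matfun set" where
  "matfuns \<Lambda> = {f. (\<forall>l\<in>\<Lambda>. l \<noteq> (\<lambda>_. 0) \<longrightarrow> f l \<in> carrier_mat (nlam l) (nlam l)) \<and> f = on_nonzero \<Lambda> f}"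

definition E_fun :: "('i::finite \<Rightarrow> nat) set \<Rightarrow> ('i \<Rightarrow> 'x \<Rightarrow> complex) \<Rightarrow>
    (('i \<Rightarrow> nat) \<Rightarrow> nat \<Rightarrow> ('i \<times> nat) set) \<Rightarrow> (('i \<Rightarrow> nat) \<Rightarrow> nat \<Rightarrow> ('i \<times> nat) set) \<Rightarrow> 'x \<Rightarrow> 'i matfun" where
  "E_fun \<Lambda> \<psi> ev od x = on_nonzero \<Lambda> (\<lambda>l. sigma \<psi> ev od l x)"

text \<open>$E^+(x) E^+(y)^* - E^-(x) E^-(y)^*$, scalars being identified with multiples of the identity
  matrix.\<close>

definition E_diff :: "('i::finite \<Rightarrow> nat) set \<Rightarrow> ('i \<Rightarrow> 'x \<Rightarrow> complex) \<Rightarrow>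
    (('i \<Rightarrow> nat) \<Rightarrow> nat \<Rightarrow> ('i \<times> nat) set) \<Rightarrow> (('i \<Rightarrow> nat) \<Rightarrow> nat \<Rightarrow> ('i \<times> nat) set) \<Rightarrow> 'x \<Rightarrow> 'x \<Rightarrow> 'i matfun" where
  "E_diff \<Lambda> \<psi> ev od x y = on_nonzero \<Lambda> (\<lambda>l.
     let p = psi_row \<psi> (ev l) (nlam l); m = psi_row \<psi> (od l) (nlam l)
     in (p x * mat_adjoint (p y) - m x * mat_adjoint (m y)) $$ (0, 0) \<cdot>\<^sub>m 1\<^sub>m (nlam l))"

definition mf_one :: "('i::finite \<Rightarrow> nat) set \<Rightarrow> 'i matfun" where
  "mf_one \<Lambda> = on_nonzero \<Lambda> (\<lambda>l. 1\<^sub>m (nlam l))"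

definition mf_add :: "'i matfun \<Rightarrow> 'i matfun \<Rightarrow> 'i matfun" where
  "mf_add f g = (\<lambda>l. f l + g l)"

definition mf_scale :: "complex \<Rightarrow> 'i matfun \<Rightarrow> 'i matfun" where
  "mf_scale c f = (\<lambda>l. c \<cdot>\<^sub>m f l)"

definition mf_mult :: "'i matfun \<Rightarrow> 'i matfun \<Rightarrow> 'i matfun" where
  "mf_mult f g = (\<lambda>l. f l * g l)"

definition mf_star :: "'i matfun \<Rightarrow> 'i matfun" where
  "mf_star f = (\<lambda>l. mat_adjoint (f l))"

text \<open>The unital $C^*$-algebra generated by the functions $E_x$. The functions \<^const>\<open>E_diff\<close>
  have to be elements of the algebra; the clause \<open>diff\<close> is redundant when they already belong to the
  algebra generated by the $E_x$ alone. That can fail: if \<open>l\<close> consists of three copies of a single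
  test function, then $\sigma_\lambda(x)$ and $\sigma_\lambda(x)^*$ have a null vector independent of
  \<open>x\<close>, so scalar valued functions in the algebra generated by the $E_x$ agree at any two such \<open>l\<close>.\<close>

inductive_set Cb :: "('i::finite \<Rightarrow> nat) set \<Rightarrow> ('i \<Rightarrow> 'x \<Rightarrow> complex) \<Rightarrow>
    (('i \<Rightarrow> nat) \<Rightarrow> nat \<Rightarrow> ('i \<times> nat) set) \<Rightarrow> (('i \<Rightarrow> nat) \<Rightarrow> nat \<Rightarrow> ('i \<times> nat) set) \<Rightarrow> 'i matfun set"
  for \<Lambda> \<psi> ev od where
  gen: "E_fun \<Lambda> \<psi> ev od x \<in> Cb \<Lambda> \<psi> ev od"
| diff: "E_diff \<Lambda> \<psi> ev od x y \<in> Cb \<Lambda> \<psi> ev od"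
| one: "mf_one \<Lambda> \<in> Cb \<Lambda> \<psi> ev od"
| add: "f \<in> Cb \<Lambda> \<psi> ev od \<Longrightarrow> g \<in> Cb \<Lambda> \<psi> ev od \<Longrightarrow> mf_add f g \<in> Cb \<Lambda> \<psi> ev od"
| scale: "f \<in> Cb \<Lambda> \<psi> ev od \<Longrightarrow> mf_scale c f \<in> Cb \<Lambda> \<psi> ev od"
| mult: "f \<in> Cb \<Lambda> \<psi> ev od \<Longrightarrow> g \<in> Cb \<Lambda> \<psi> ev od \<Longrightarrow> mf_mult f g \<in> Cb \<Lambda> \<psi> ev od"
| star: "f \<in> Cb \<Lambda> \<psi> ev od \<Longrightarrow> mf_star f \<in> Cb \<Lambda> \<psi> ev od"
| limit: "(\<And>n. s n \<in> Cb \<Lambda> \<psi> ev od) \<Longrightarrow> f \<in> matfuns \<Lambda> \<Longrightarrow>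
    (\<And>l i j. l \<in> \<Lambda> \<Longrightarrow> l \<noteq> (\<lambda>_. 0) \<Longrightarrow> i < nlam l \<Longrightarrow> j < nlam l \<Longrightarrow>
       (\<lambda>n. s n l $$ (i, j)) \<longlonglongrightarrow> f l $$ (i, j)) \<Longrightarrow> f \<in> Cb \<Lambda> \<psi> ev od"

text \<open>Boundedness of $\Gamma(x,y)$ as a linear map is automatic, its domain being finite
  dimensional.\<close>

definition cp_kernels :: "'i matfun set \<Rightarrow> ('x \<Rightarrow> 'x \<Rightarrow> 'i matfun \<Rightarrow> 'h::chilbert \<Rightarrow> 'h) set" where
  "cp_kernels \<A> = {\<Gamma>.
     (\<forall>x y. \<forall>a\<in>\<A>. bounded_clinear (\<Gamma> x y a)) \<and>
     (\<forall>x y h. \<forall>a\<in>\<A>. \<forall>b\<in>\<A>. \<Gamma> x y (mf_add a b) h = \<Gamma> x y a h + \<Gamma> x y b h) \<and>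
     (\<forall>x y h. \<forall>a\<in>\<A>. \<forall>c. \<Gamma> x y (mf_scale c a) h = c *\<^sub>C \<Gamma> x y a h) \<and>
     (\<forall>n. \<forall>x :: nat \<Rightarrow> 'x. \<forall>a :: nat \<Rightarrow> 'i matfun. \<forall>h :: nat \<Rightarrow> 'h. (\<forall>i<n. a i \<in> \<A>) \<longrightarrow>
        (\<Sum>i<n. \<Sum>j<n. cinner (\<Gamma> (x i) (x j) (mf_mult (a i) (mf_star (a j))) (h j)) (h i)) \<in> \<real>\<^sub>\<ge>\<^sub>0)}"


section \<open>Colligations and transfer functions\<close>

definition unital_star_rep :: "('i::finite \<Rightarrow> nat) set \<Rightarrow> 'i matfun set \<Rightarrow> ('i matfun \<Rightarrow> 'e::chilbert \<Rightarrow> 'e) \<Rightarrow> bool" where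
  "unital_star_rep \<Lambda> \<A> \<rho> \<longleftrightarrow>
     (\<forall>a\<in>\<A>. bounded_clinear (\<rho> a)) \<and> \<rho> (mf_one \<Lambda>) = id \<and>
     (\<forall>a\<in>\<A>. \<forall>b\<in>\<A>. \<rho> (mf_add a b) = (\<lambda>u. \<rho> a u + \<rho> b u)) \<and>
     (\<forall>a\<in>\<A>. \<forall>c. \<rho> (mf_scale c a) = (\<lambda>u. c *\<^sub>C \<rho> a u)) \<and>
     (\<forall>a\<in>\<A>. \<forall>b\<in>\<A>. \<rho> (mf_mult a b) = \<rho> a \<circ> \<rho> b) \<and>
     (\<forall>a\<in>\<A>. \<rho> (mf_star a) = cadjoint (\<rho> a))"

text \<open>$\rho(f) = \sum_\lambda P_\lambda \otimes f(\lambda)$ on $\bigoplus_\lambda \mathrm{ran}\, P_\lambda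
  \otimes \mathbb C^{n_\lambda}$. The unitary \<open>V\<close> identifies the representation space with this sum: the
  component of \<open>u\<close> in $\mathrm{ran}\, P_\lambda \otimes \mathbb C^{n_\lambda}$ is
  $\sum_j$ \<open>V u l j\<close> $\otimes\, e_j$.\<close>

definition diagonal_form :: "('i::finite \<Rightarrow> nat) set \<Rightarrow> 'i matfun set \<Rightarrow> ('i matfun \<Rightarrow> 'e::chilbert \<Rightarrow> 'e) \<Rightarrow> bool" where
  "diagonal_form \<Lambda> \<A> \<rho> \<longleftrightarrow> (\<exists>(P :: ('i \<Rightarrow> nat) \<Rightarrow> 'e \<Rightarrow> 'e) (V :: 'e \<Rightarrow> ('i \<Rightarrow> nat) \<Rightarrow> nat \<Rightarrow> 'e).
     let \<Lambda>' = \<Lambda> - {\<lambda>_. 0} in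
     (\<forall>l\<in>\<Lambda>'. orthogonal_projection (P l)) \<and>
     (\<forall>l\<in>\<Lambda>'. \<forall>m\<in>\<Lambda>'. l \<noteq> m \<longrightarrow> (\<forall>u v. cinner (P l u) (P m v) = 0)) \<and>
     bij_betw V UNIV {w. \<forall>l j. if l \<in> \<Lambda>' \<and> j < nlam l then w l j \<in> range (P l) else w l j = 0} \<and>
     (\<forall>u v l j. V (u + v) l j = V u l j + V v l j) \<and>
     (\<forall>c u l j. V (c *\<^sub>C u) l j = c *\<^sub>C V u l j) \<and>
     (\<forall>u v. cinner u v = (\<Sum>l\<in>\<Lambda>'. \<Sum>j<nlam l. cinner (V u l j) (V v l j))) \<and>
     (\<forall>f\<in>\<A>. \<forall>u. \<forall>l\<in>\<Lambda>'. \<forall>i<nlam l. V (\<rho> f u) l i = (\<Sum>j<nlam l. f l $$ (i, j) *\<^sub>C V u l j)))"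

text \<open>The colligation is $(U, \mathcal E, \rho)$ with $\mathcal E$ the type \<open>'e\<close> and
  $\mathcal H$ the type \<open>'h\<close>. For the algebra of all matrix functions every unital
  $*$-representation has the diagonal form; it is demanded because \<^const>\<open>Cb\<close> may be smaller.\<close>

definition unitary_colligation :: "('i::finite \<Rightarrow> nat) set \<Rightarrow> 'i matfun set \<Rightarrow>
    ('e::chilbert \<times> 'h::chilbert \<Rightarrow> 'e \<times> 'h) \<Rightarrow> ('i matfun \<Rightarrow> 'e \<Rightarrow> 'e) \<Rightarrow> bool" where
  "unitary_colligation \<Lambda> \<A> U \<rho> \<longleftrightarrow> unitary_op U \<and> unital_star_rep \<Lambda> \<A> \<rho> \<and> diagonal_form \<Lambda> \<A> \<rho>"

text \<open>Here \<open>S x\<close> is $\rho(E_x) = \sum_\lambda P_\lambda \otimes \sigma_\lambda(x)$. As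
  $\|S(x)\| < 1$ and $A$ is a contraction, $1 - A S(x)$ is bijective.\<close>

definition transfer_function :: "('e::chilbert \<times> 'h::chilbert \<Rightarrow> 'e \<times> 'h) \<Rightarrow> ('x \<Rightarrow> 'e \<Rightarrow> 'e) \<Rightarrow> 'x \<Rightarrow> 'h \<Rightarrow> 'h" where
  "transfer_function U S x h =
     (let A = (\<lambda>u. fst (U (u, 0))); B = (\<lambda>h. fst (U (0, h)));
          C = (\<lambda>u. snd (U (u, 0))); D = (\<lambda>h. snd (U (0, h)))
      in D h + C (S x (inv_into UNIV (\<lambda>u. u - A (S x u)) (B h))))"

text \<open>HOL cannot quantify over the type of the state space, so it is taken to be $\ell^2$ of an
  index type of cardinality $\max(|X|, |\mathcal H|, \aleph_0)$. That is no restriction: the dimension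
  needed is at most this cardinal, and a colligation can be enlarged by a direct summand on which
  \<open>U\<close> is the identity.\<close>

definition has_transfer_representation :: "('i::finite \<Rightarrow> nat) set \<Rightarrow> ('i \<Rightarrow> 'x \<Rightarrow> complex) \<Rightarrow>
    (('i \<Rightarrow> nat) \<Rightarrow> nat \<Rightarrow> ('i \<times> nat) set) \<Rightarrow> (('i \<Rightarrow> nat) \<Rightarrow> nat \<Rightarrow> ('i \<times> nat) set) \<Rightarrow>
    ('x \<Rightarrow> 'h::chilbert \<Rightarrow> 'h) \<Rightarrow> bool" where
  "has_transfer_representation \<Lambda> \<psi> ev od \<phi> \<longleftrightarrow>
     (\<exists>(U :: ('x \<times> 'h \<times> nat) ell2 \<times> 'h \<Rightarrow> ('x \<times> 'h \<times> nat) ell2 \<times> 'h) \<rho>.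
        unitary_colligation \<Lambda> (Cb \<Lambda> \<psi> ev od) U \<rho> \<and>
        \<phi> = transfer_function U (\<lambda>x. \<rho> (E_fun \<Lambda> \<psi> ev od x)))"

end

theory Submission
  imports Defs
begin

text \<open>Condition (AD) says no more than that \<open>1 - \<phi>(x) \<phi>(y)\<^sup>*\<close> is a sum over the nonzero \<open>\<lambda>\<close>
  of positive kernels \<open>k\<^sub>\<lambda>(x, y)\<close> multiplied by \<open>\<Prod>i. (1 - \<psi>\<^sub>i(x) \<psi>\<^sub>i(y)\<^sup>*)\<^bsup>\<lambda> i\<^esup>\<close>. Such a decomposition
  tensored with an admissible kernel is positive by the Schur product theorem, which gives (SC).
  Conversely, over a finite set of points the kernels of this form are a convex cone. A functional
  separating \<open>1 - \<phi> \<phi>\<^sup>*\<close> from its closure is itself an admissible kernel, extended by zero to all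
  points, and contradicts (SC). As the diagonals of the \<open>k\<^sub>\<lambda>\<close> are bounded in advance, the finite
  decompositions have a limit by Tychonoff's theorem. Regrouping the terms of the decomposition with
  \<open>\<psi>\<^sub>\<lambda>\<^sup>+\<close> and those with \<open>\<psi>\<^sub>\<lambda>\<^sup>-\<close> makes the map from the latter to the former isometric, and a unitary
  extension of it is the adjoint of the colligation.\<close>

section \<open>Hilbert space preliminaries\<close>

text \<open>Operators are replaced throughout by scalar kernels on pairs \<open>(x, h)\<close>.
  There one notion of positivity covers points, vectors and tensors, Schur products are entrywise,
  and finitely many pairs span a finite dimensional space of matrices; linearity in \<open>h\<close>
  is recovered afterwards. Over finitely many pairs the decomposition is only approximate; the
  tolerance is sent to zero together with the exhaustion by finite sets. The separating functional
  is tested against the nonzero \<open>\<lambda>\<close>, whereas an admissible kernel must itself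
  be positive: dividing by one defect, that is, multiplying by Szego kernels, supplies this. For the
  transfer function the obstacle is the prescribed state space
  \<open>('x \<times> 'h \<times> nat) ell2\<close>. An isometry between subspaces extends to a
  unitary only if the orthogonal complements have equal dimension; the \<open>nat\<close> coordinate
  therefore provides both the multiplicities \<open>n\<^sub>\<lambda>\<close> and spare room,
  orthogonal to all vectors in play, for a Halmos dilation.\<close>

lemma scaleC_zero_right [simp]: "a *\<^sub>C (0 :: 'a::chilbert) = 0"
  using scaleC_add_right[of a 0 0] by simp
lemma scaleC_one [simp]: "1 *\<^sub>C (x :: 'a::chilbert) = x"
  using scaleC_of_real[of 1 x] by simp
lemma scaleC_minus_right: "a *\<^sub>C (- x) = - (a *\<^sub>C (x :: 'a::chilbert))"
  by (metis mult.commute scaleC_minus_one scaleC_scaleC)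
lemma scaleC_diff_right: "a *\<^sub>C (x - y) = a *\<^sub>C x - a *\<^sub>C (y :: 'a::chilbert)"
  using scaleC_add_right[of a x "- y"] by (simp add: scaleC_minus_right)
lemma scaleC_sum_right: "a *\<^sub>C (\<Sum>i\<in>F. f i) = (\<Sum>i\<in>F. a *\<^sub>C (f i :: 'a::chilbert))"
  by (induction F rule: infinite_finite_induct) (auto simp: scaleC_add_right)
lemma scaleC_sum_left: "(\<Sum>i\<in>F. f i) *\<^sub>C (x :: 'a::chilbert) = (\<Sum>i\<in>F. f i *\<^sub>C x)"
  by (induction F rule: infinite_finite_induct) (auto simp: scaleC_add_left)
lemma scaleC_minus_left: "(- a) *\<^sub>C x = - (a *\<^sub>C (x :: 'a::chilbert))"
  using scaleC_scaleC[of "-1" a x] by (simp add: scaleC_minus_one)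
lemma scaleC_scaleR: "a *\<^sub>C (r *\<^sub>R x) = r *\<^sub>R (a *\<^sub>C (x :: 'a::chilbert))"
  by (metis mult.commute scaleC_of_real scaleC_scaleC)

lemma cinner_zero_right [simp]: "cinner (y :: 'a::chilbert) 0 = 0"
  using cinner_scaleC_right[of y 0 0] by simp
lemma cinner_minus_right: "cinner x (- y) = - cinner x (y :: 'a::chilbert)"
  using cinner_scaleC_right[of x "-1" y] by (simp add: scaleC_minus_one)
lemma cinner_diff_right: "cinner x (y - z) = cinner x y - cinner x (z :: 'a::chilbert)"
  using cinner_add_right[of x y "- z"] by (simp add: cinner_minus_right)
lemma cinner_sum_right: "cinner x (sum f F) = (\<Sum>u\<in>F. cinner (x :: 'a::chilbert) (f u))"
  by (induction F rule: infinite_finite_induct) (auto simp: cinner_add_right)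
lemma cinner_scaleR_right: "cinner x (r *\<^sub>R y) = r *\<^sub>R cinner x (y :: 'a::chilbert)"
  by (metis cinner_scaleC_right complex_cnj_complex_of_real scaleC_of_real scaleR_conv_of_real)

lemmas cinner_left_simps = cinner_add_left cinner_diff_left cinner_minus_left cinner_scaleC_left cinner_sum_left
lemmas cinner_right_simps = cinner_add_right cinner_diff_right cinner_minus_right cinner_scaleC_right cinner_sum_right

lemma cinner_eq_zero_iff [simp]: "cinner x x = 0 \<longleftrightarrow> x = (0 :: 'a::chilbert)"
  by (simp add: cinner_self)

lemma cinner_eqI:
  assumes "\<And>z. cinner x z = cinner y (z :: 'a::chilbert)"
  shows "x = y"
proof -
  have "cinner (x - y) (x - y) = 0" using assms[of "x - y"] by (simp add: cinner_diff_left)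
  then show ?thesis by simp
qed

lemma cinner_eqI_right:
  assumes "\<And>z. cinner z x = cinner (z :: 'a::chilbert) y"
  shows "x = y"
  by (rule cinner_eqI) (metis assms cinner_commute)

lemma bounded_bilinear_cinner: "bounded_bilinear (cinner :: 'a::chilbert \<Rightarrow> 'a \<Rightarrow> complex)"
  by standard
    (auto simp: cinner_add_left cinner_add_right cinner_scaleR_left cinner_scaleR_right
      intro!: exI[of _ 1] cinner_Cauchy_Schwarz)

lemma bounded_bilinear_scaleC: "bounded_bilinear (scaleC :: complex \<Rightarrow> 'a::chilbert \<Rightarrow> 'a)"
proof (standard, goal_cases)
  case (3 r a b)
  show ?case by (metis scaleC_of_real scaleC_scaleC scaleR_conv_of_real)
qed (auto simp: scaleC_add_left scaleC_add_right scaleC_scaleR norm_scaleC intro!: exI[of _ 1])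

lemmas tendsto_cinner [tendsto_intros] = bounded_bilinear.tendsto[OF bounded_bilinear_cinner]
lemmas tendsto_scaleC [tendsto_intros] = bounded_bilinear.tendsto[OF bounded_bilinear_scaleC]
lemmas continuous_on_cinner [continuous_intros] = bounded_bilinear.continuous_on[OF bounded_bilinear_cinner]

section \<open>Bounded complex linear maps\<close>

lemma bounded_clinear_add: "bounded_clinear T \<Longrightarrow> T (x + y) = T x + T y"
  by (simp add: bounded_clinear_def linear_simps)
lemma bounded_clinear_scaleC: "bounded_clinear T \<Longrightarrow> T (c *\<^sub>C x) = c *\<^sub>C T x"
  by (simp add: bounded_clinear_def)
lemma bounded_clinear_scaleR: "bounded_clinear T \<Longrightarrow> T (r *\<^sub>R x) = r *\<^sub>R T x"
  by (simp add: bounded_clinear_def linear_simps)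
lemma bounded_clinear_zero: "bounded_clinear T \<Longrightarrow> T 0 = 0"
  by (simp add: bounded_clinear_def linear_simps)
lemma bounded_clinear_diff: "bounded_clinear T \<Longrightarrow> T (x - y) = T x - T y"
  by (simp add: bounded_clinear_def linear_simps)
lemma bounded_clinear_minus: "bounded_clinear T \<Longrightarrow> T (- x) = - T x"
  by (simp add: bounded_clinear_def linear_simps)
lemma bounded_clinear_sum: "bounded_clinear T \<Longrightarrow> T (sum f F) = (\<Sum>i\<in>F. T (f i))"
  by (induction F rule: infinite_finite_induct) (auto simp: bounded_clinear_zero bounded_clinear_add)
lemmas bounded_clinear_simps = bounded_clinear_add bounded_clinear_scaleC bounded_clinear_scaleR
  bounded_clinear_zero bounded_clinear_diff bounded_clinear_minus bounded_clinear_sum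

lemma bounded_clinear_continuous_on: "bounded_clinear T \<Longrightarrow> continuous_on A T"
  by (simp add: bounded_clinear_def linear_continuous_on)

lemma bounded_clinear_bound:
  assumes "bounded_clinear T"
  obtains K where "0 \<le> K" "\<And>x. norm (T x) \<le> K * norm x"
  using assms bounded_linear.nonneg_bounded[of T] by (auto simp: bounded_clinear_def mult.commute)

lemma bounded_clinear_id: "bounded_clinear (\<lambda>x. x)"
  by (simp add: bounded_clinear_def bounded_linear_ident)
lemma bounded_clinear_compose:
  "bounded_clinear S \<Longrightarrow> bounded_clinear T \<Longrightarrow> bounded_clinear (\<lambda>x. S (T x))"
  by (simp add: bounded_clinear_def bounded_linear_compose)
lemma bounded_clinear_plus:
  "bounded_clinear S \<Longrightarrow> bounded_clinear T \<Longrightarrow> bounded_clinear (\<lambda>x. S x + T x)"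
  by (simp add: bounded_clinear_def bounded_linear_add scaleC_add_right)
lemma bounded_clinear_sub:
  "bounded_clinear S \<Longrightarrow> bounded_clinear T \<Longrightarrow> bounded_clinear (\<lambda>x. S x - T x)"
  by (simp add: bounded_clinear_def bounded_linear_sub scaleC_diff_right)
lemma bounded_clinear_const_scaleC: "bounded_clinear (\<lambda>x :: 'a::chilbert. c *\<^sub>C x)"
  by (rule bounded_clinear_isometricI[where K = "cmod c"])
    (simp_all add: scaleC_add_right scaleC_scaleC norm_scaleC mult.commute)
lemma bounded_clinear_cmul: "bounded_clinear T \<Longrightarrow> bounded_clinear (\<lambda>x. c *\<^sub>C T x)"
  by (rule bounded_clinear_compose[OF bounded_clinear_const_scaleC])
lemma bounded_clinear_rmul:
  assumes "bounded_clinear T" shows "bounded_clinear (\<lambda>x. r *\<^sub>R T x)"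
  using bounded_clinear_cmul[OF assms, of "complex_of_real r"] by (simp add: scaleC_of_real)
lemma bounded_clinear_null: "bounded_clinear (\<lambda>x. 0)"
  by (simp add: bounded_clinear_def)
lemma bounded_clinear_sums:
  "(\<And>i. i \<in> F \<Longrightarrow> bounded_clinear (T i)) \<Longrightarrow> bounded_clinear (\<lambda>x. \<Sum>i\<in>F. T i x)"
  by (induction F rule: infinite_finite_induct) (auto simp: bounded_clinear_null bounded_clinear_plus)
lemma bounded_clinear_cinner_scaleC: "bounded_clinear (\<lambda>u. cinner u a *\<^sub>C b)"
  by (rule bounded_clinear_isometricI[where K = "norm a * norm b"])
    (auto simp: cinner_add_left scaleC_add_left cinner_scaleC_left scaleC_scaleC norm_scaleC
      cinner_Cauchy_Schwarz mult_right_mono simp flip: mult.assoc)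
lemma bounded_clinear_fst: "bounded_clinear fst"
  by (simp add: bounded_clinear_def bounded_linear_fst scaleC_prod_def)
lemma bounded_clinear_snd: "bounded_clinear snd"
  by (simp add: bounded_clinear_def bounded_linear_snd scaleC_prod_def)
lemma bounded_clinear_Pair:
  "bounded_clinear S \<Longrightarrow> bounded_clinear T \<Longrightarrow> bounded_clinear (\<lambda>x. (S x, T x))"
  by (simp add: bounded_clinear_def bounded_linear_Pair scaleC_prod_def)

lemmas bounded_clinear_intros = bounded_clinear_id bounded_clinear_plus bounded_clinear_sub bounded_clinear_cmul
  bounded_clinear_rmul bounded_clinear_null bounded_clinear_sums bounded_clinear_Pair

lemma cadjointI:
  assumes "\<And>x y. cinner (T x) y = cinner x (S y)"
  shows "cadjoint T = S"
  unfolding cadjoint_def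
proof (rule the_equality)
  show "\<forall>x y. cinner (T x) y = cinner x (S y)" using assms by blast
  fix S' assume "\<forall>x y. cinner (T x) y = cinner x (S' y)"
  then show "S' = S" using assms by (metis cinner_eqI_right ext)
qed


subsection \<open>Orthogonal projections\<close>

text \<open>A minimizing sequence is Cauchy: the midpoint of two of its members stays in the convex
  set, so the parallelogram law bounds their distance by how far both are from minimizing.\<close>

lemma closest_point_complete:
  fixes S :: "'a::{real_inner, complete_space} set"
  assumes "convex S" "closed S" "S \<noteq> {}"
  shows "\<exists>m\<in>S. \<forall>y\<in>S. dist a m \<le> dist a y"
proof -
  define d where "d = infdist a S"
  have d: "0 \<le> d" "\<And>y. y \<in> S \<Longrightarrow> d \<le> dist a y" by (auto simp: d_def infdist_le infdist_nonneg)
  have "\<exists>y\<in>S. (dist a y)\<^sup>2 < d\<^sup>2 + 1 / Suc n" for n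
  proof -
    have "sqrt (d\<^sup>2 + 1 / Suc n) > d" by (rule real_less_rsqrt) auto
    then obtain y where "y \<in> S" "dist a y < sqrt (d\<^sup>2 + 1 / Suc n)"
      using assms(3) cInf_lessD[of "(\<lambda>y. dist a y) ` S"] by (auto simp: d_def infdist_def)
    moreover from this have "(dist a y)\<^sup>2 < (sqrt (d\<^sup>2 + 1 / Suc n))\<^sup>2"
      by (intro power_strict_mono) auto
    moreover have "(sqrt (d\<^sup>2 + 1 / Suc n))\<^sup>2 = d\<^sup>2 + 1 / Suc n" by (rule real_sqrt_pow2) auto
    ultimately show ?thesis by auto
  qed
  then obtain y where y: "\<And>n. y n \<in> S" "\<And>n. (dist a (y n))\<^sup>2 < d\<^sup>2 + 1 / Suc n" by metis
  have near: "(dist (y m) (y n))\<^sup>2 \<le> 2 / Suc m + 2 / Suc n" for m n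
  proof -
    have "(1/2) *\<^sub>R y m + (1/2) *\<^sub>R y n \<in> S"
      using assms(1) y(1) by (auto simp: convex_def)
    then have "d \<le> dist a ((1/2) *\<^sub>R y m + (1/2) *\<^sub>R y n)" by (rule d(2))
    then have "d\<^sup>2 \<le> (dist a ((1/2) *\<^sub>R y m + (1/2) *\<^sub>R y n))\<^sup>2" by (rule power_mono[OF _ d(1)])
    moreover have "(dist (y m) (y n))\<^sup>2 + 4 * (dist a ((1/2) *\<^sub>R y m + (1/2) *\<^sub>R y n))\<^sup>2
        = 2 * (dist a (y m))\<^sup>2 + 2 * (dist a (y n))\<^sup>2"
      unfolding dist_norm power2_norm_eq_inner
      by (simp add: inner_diff_left inner_diff_right inner_add_left inner_add_right inner_commute algebra_simps)
    ultimately show ?thesis using y(2)[of m] y(2)[of n] by simp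
  qed
  have "Cauchy y"
  proof (rule metric_CauchyI)
    fix e :: real assume e: "e > 0"
    obtain N where N: "4 / e\<^sup>2 < real N" using reals_Archimedean2 by blast
    have "dist (y m) (y n) < e" if "m \<ge> N" "n \<ge> N" for m n
    proof -
      have "0 < 4 / e\<^sup>2" using e by simp
      then have N0: "real N > 0" using N by linarith
      have "(dist (y m) (y n))\<^sup>2 \<le> 2 / Suc m + 2 / Suc n" by (rule near)
      also have "\<dots> \<le> 2 / N + 2 / N" using that N0 by (intro add_mono divide_left_mono) auto
      also have "\<dots> < e\<^sup>2" using N N0 e by (simp add: field_simps)
      finally show ?thesis using e by (intro power_less_imp_less_base[of _ 2 e]) auto
    qed
    then show "\<exists>M. \<forall>m\<ge>M. \<forall>n\<ge>M. dist (y m) (y n) < e" by blast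
  qed
  then obtain m where m: "y \<longlonglongrightarrow> m" using Cauchy_convergent convergent_def by blast
  have "m \<in> S" using closed_sequentially[OF assms(2) _ m] y(1) by blast
  moreover have "dist a m \<le> dist a z" if "z \<in> S" for z
  proof -
    have "(\<lambda>n. (dist a (y n))\<^sup>2) \<longlonglongrightarrow> (dist a m)\<^sup>2" by (intro tendsto_intros m)
    moreover have "(\<lambda>n. d\<^sup>2 + 1 / Suc n) \<longlonglongrightarrow> d\<^sup>2 + 0"
      by (intro tendsto_intros LIMSEQ_Suc[OF lim_1_over_n])
    ultimately have "(dist a m)\<^sup>2 \<le> d\<^sup>2 + 0"
      by (rule LIMSEQ_le) (use y(2) less_imp_le in blast)
    then have "dist a m \<le> d" using d(1) by (simp add: power2_le_iff_abs_le)
    then show ?thesis using d(2)[OF that] by linarith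
  qed
  ultimately show ?thesis by blast
qed

definition csubspace :: "'a::chilbert set \<Rightarrow> bool" where
  "csubspace S \<longleftrightarrow> 0 \<in> S \<and> (\<forall>x\<in>S. \<forall>y\<in>S. x + y \<in> S) \<and> (\<forall>c. \<forall>x\<in>S. c *\<^sub>C x \<in> S)"

lemma csubspace_diff: "csubspace S \<Longrightarrow> x \<in> S \<Longrightarrow> y \<in> S \<Longrightarrow> x - y \<in> S"
  by (metis csubspace_def diff_conv_add_uminus scaleC_minus_one)

lemma csubspace_convex: "csubspace S \<Longrightarrow> convex S"
  by (auto simp: csubspace_def convex_def simp flip: scaleC_of_real)

lemma csubspace_closure:
  assumes S: "csubspace S" shows "csubspace (closure S)"
  unfolding csubspace_def
proof (intro conjI ballI allI)
  show "0 \<in> closure S" using S closure_subset by (auto simp: csubspace_def)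
next
  fix x y assume "x \<in> closure S" "y \<in> closure S"
  then obtain a b where "\<And>n. a n \<in> S" "\<And>n. b n \<in> S" "a \<longlonglongrightarrow> x" "b \<longlonglongrightarrow> y"
    unfolding closure_sequential by metis
  then have "\<And>n. a n + b n \<in> S" "(\<lambda>n. a n + b n) \<longlonglongrightarrow> x + y"
    using S by (auto simp: csubspace_def intro!: tendsto_intros)
  then show "x + y \<in> closure S" unfolding closure_sequential by meson
next
  fix c x assume "x \<in> closure S"
  then obtain a where "\<And>n. a n \<in> S" "a \<longlonglongrightarrow> x"
    unfolding closure_sequential by metis
  then have "\<And>n. c *\<^sub>C a n \<in> S" "(\<lambda>n. c *\<^sub>C a n) \<longlonglongrightarrow> c *\<^sub>C x"
    using S by (auto simp: csubspace_def intro!: tendsto_intros)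
  then show "c *\<^sub>C x \<in> closure S" unfolding closure_sequential by meson
qed

text \<open>The variational inequality at the closest point, applied to \<open>z\<close> and
  \<open>- z\<close>, makes the real inner product vanish on \<open>N\<close>; complex orthogonality
  follows because \<open>N\<close> also contains \<open>\<i> *\<^sub>C z\<close>.\<close>

lemma orthogonal_decomposition:
  assumes N: "csubspace N" "closed N"
  shows "\<exists>m\<in>N. \<forall>y\<in>N. cinner (x - m) y = 0"
proof -
  have "N \<noteq> {}" using N by (auto simp: csubspace_def)
  then obtain m where m: "m \<in> N" "\<forall>y\<in>N. dist x m \<le> dist x y"
    using closest_point_complete[OF csubspace_convex[OF N(1)] N(2)] by blast
  have le: "inner (x - m) z \<le> 0" if "z \<in> N" for z
    using any_closest_point_dot[OF csubspace_convex[OF N(1)] N(2) m(1), of "m + z" x] m that N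
    by (auto simp: csubspace_def)
  have "inner (x - m) z = 0" if "z \<in> N" for z
    using le[OF that] le[of "- z"] that N(1) by (metis antisym csubspace_def inner_minus_right neg_le_0_iff_le scaleC_minus_one)
  then have Re0: "Re (cinner (x - m) z) = 0" if "z \<in> N" for z using that by (simp add: Re_cinner)
  have "cinner (x - m) z = 0" if "z \<in> N" for z
  proof -
    have "Re (cinner (x - m) (\<i> *\<^sub>C z)) = 0" using Re0 N that by (auto simp: csubspace_def)
    then show ?thesis using Re0[OF that] by (simp add: cinner_scaleC_right complex_eq_iff)
  qed
  then show ?thesis using m by blast
qed

text \<open>Linearity and boundedness come from self-adjointness. The last clause characterizes
  \<open>Q x\<close> as the only point of \<open>N\<close> with orthogonal residual and serves to
  verify a guess for a projection.\<close>

lemma projection_exists: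
  assumes N: "csubspace N" "closed N"
  obtains Q where "bounded_clinear Q" "\<And>x. Q x \<in> N" "\<And>x. x \<in> N \<Longrightarrow> Q x = x"
    "\<And>x y. cinner (Q x) y = cinner x (Q y)" "\<And>x y. y \<in> N \<Longrightarrow> cinner (x - Q x) y = 0"
    "\<And>x m. m \<in> N \<Longrightarrow> (\<And>y. y \<in> N \<Longrightarrow> cinner (x - m) y = 0) \<Longrightarrow> Q x = m"
proof -
  obtain Q where Q: "\<And>x. Q x \<in> N" "\<And>x y. y \<in> N \<Longrightarrow> cinner (x - Q x) y = 0"
    using orthogonal_decomposition[OF N] by metis
  have uniq: "Q x = m" if "m \<in> N" "\<And>y. y \<in> N \<Longrightarrow> cinner (x - m) y = 0" for x m
  proof -
    have "Q x - m \<in> N" using Q(1) that(1) N(1) by (rule csubspace_diff[rotated])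
    then have "cinner ((x - m) - (x - Q x)) (Q x - m) = 0"
      using that(2) Q(2) by (subst cinner_diff_left) auto
    then show ?thesis by simp
  qed
  have ip: "cinner x y = cinner (Q x) y" if "y \<in> N" for x y
    using Q(2)[OF that, of x] by (simp add: cinner_diff_left)
  have sa: "cinner (Q x) y = cinner x (Q y)" for x y
    by (metis ip Q(1) cinner_commute)
  have "bounded_clinear Q"
  proof (rule bounded_clinear_isometricI[where K = 1])
    show "Q (x + y) = Q x + Q y" for x y
      by (rule cinner_eqI) (simp add: sa cinner_add_left)
    show "Q (c *\<^sub>C x) = c *\<^sub>C Q x" for c x
      by (rule cinner_eqI) (simp add: sa cinner_scaleC_left)
    show "norm (Q x) \<le> norm x * 1" for x
    proof -
      have "complex_of_real ((norm (Q x))\<^sup>2) = cinner (Q x) x"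
        unfolding cinner_self[symmetric] using sa[of x "Q x"] uniq[OF Q(1), of "Q x" x]
        by (metis Q(1) cinner_commute ip sa)
      then have "(norm (Q x))\<^sup>2 = cmod (cinner (Q x) x)"
        by (metis norm_of_real abs_power2)
      also have "\<dots> \<le> norm (Q x) * norm x" by (rule cinner_Cauchy_Schwarz)
      finally show ?thesis by (cases "Q x = 0") (auto simp: power2_eq_square)
    qed
  qed
  moreover have "Q x = x" if "x \<in> N" for x using that by (intro uniq) auto
  ultimately show thesis using that Q sa uniq by blast
qed


subsection \<open>Linear combinations and the moment problem\<close>

text \<open>Combinations are indexed by a family and not by a set of vectors, since \<open>v\<close>
  may repeat values while other data, such as the moments below, are attached to the
  indices.\<close>

definition lcomb :: "('p \<Rightarrow> 'a::chilbert) \<Rightarrow> 'p set \<Rightarrow> 'a set" where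
  "lcomb v S = {\<Sum>p\<in>F. c p *\<^sub>C v p |F c. finite F \<and> F \<subseteq> S}"

lemma lcomb_incl: "p \<in> S \<Longrightarrow> v p \<in> lcomb v S"
  unfolding lcomb_def by (rule CollectI, rule exI[of _ "{p}"], rule exI[of _ "\<lambda>_. 1"]) auto

lemma csubspace_lcomb: "csubspace (lcomb v S)"
  unfolding csubspace_def
proof (intro conjI ballI allI)
  show "0 \<in> lcomb v S" unfolding lcomb_def by (rule CollectI, rule exI[of _ "{}"]) auto
next
  fix x y assume "x \<in> lcomb v S" "y \<in> lcomb v S"
  then obtain F G c d where F: "finite F" "F \<subseteq> S" "x = (\<Sum>p\<in>F. c p *\<^sub>C v p)"
    and G: "finite G" "G \<subseteq> S" "y = (\<Sum>p\<in>G. d p *\<^sub>C v p)" unfolding lcomb_def by blast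
  have "x = (\<Sum>p\<in>F \<union> G. (if p \<in> F then c p else 0) *\<^sub>C v p)"
    unfolding F(3) using F G by (intro sum.mono_neutral_cong_left) auto
  moreover have "y = (\<Sum>p\<in>F \<union> G. (if p \<in> G then d p else 0) *\<^sub>C v p)"
    unfolding G(3) using F G by (intro sum.mono_neutral_cong_left) auto
  ultimately have "x + y = (\<Sum>p\<in>F \<union> G. ((if p \<in> F then c p else 0) + (if p \<in> G then d p else 0)) *\<^sub>C v p)"
    by (simp add: sum.distrib scaleC_add_left)
  moreover have "finite (F \<union> G)" "F \<union> G \<subseteq> S" using F G by auto
  ultimately show "x + y \<in> lcomb v S"
    unfolding lcomb_def by (intro CollectI exI[of _ "F \<union> G"] exI conjI)
next
  fix a x assume "x \<in> lcomb v S"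
  then obtain F c where F: "finite F" "F \<subseteq> S" "x = (\<Sum>p\<in>F. c p *\<^sub>C v p)" unfolding lcomb_def by blast
  then have "a *\<^sub>C x = (\<Sum>p\<in>F. (a * c p) *\<^sub>C v p)" by (simp add: scaleC_sum_right scaleC_scaleC)
  then show "a *\<^sub>C x \<in> lcomb v S"
    unfolding lcomb_def by (intro CollectI exI[of _ F] exI conjI F)
qed

lemma closure_lcomb_induct:
  assumes "x \<in> closure (lcomb v S)" "csubspace N" "closed N" "\<And>p. p \<in> S \<Longrightarrow> v p \<in> N"
  shows "x \<in> N"
proof -
  have "(\<Sum>p\<in>F. c p *\<^sub>C v p) \<in> N" if "finite F" "F \<subseteq> S" for F c
    using that assms(2,4) by (induction F) (auto simp: csubspace_def)
  then have "lcomb v S \<subseteq> N" by (auto simp: lcomb_def)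
  then show ?thesis using assms(1,3) closure_minimal by blast
qed

lemma csubspace_orthogonal: "csubspace {x. cinner x y = 0}" "closed {x. cinner x (y :: 'a::chilbert) = 0}"
  by (auto simp: csubspace_def cinner_left_simps intro!: closed_Collect_eq continuous_intros)

text \<open>The bound says that the closed span of the pairs \<open>(v p, m p)\<close> is the graph
  of a bounded functional. Its representing vector is read off from the projection of
  \<open>(0, 1)\<close> onto this graph.\<close>

lemma Riesz_moment:
  fixes v :: "'p \<Rightarrow> 'a::chilbert" and m :: "'p \<Rightarrow> complex"
  assumes K: "0 \<le> K"
    and bd: "\<And>F c. finite F \<Longrightarrow> F \<subseteq> S \<Longrightarrow> cmod (\<Sum>p\<in>F. c p * m p) \<le> K * norm (\<Sum>p\<in>F. c p *\<^sub>C v p)"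
  obtains w where "w \<in> closure (lcomb v S)" "\<And>p. p \<in> S \<Longrightarrow> cinner (v p) w = m p" "norm w \<le> K"
proof -
  define u where "u p = (v p, m p)" for p
  define N where "N = closure (lcomb u S)"
  have N: "csubspace N" "closed N" by (auto simp: N_def csubspace_closure csubspace_lcomb)
  have sum_u: "(\<Sum>p\<in>F. c p *\<^sub>C u p) = (\<Sum>p\<in>F. c p *\<^sub>C v p, \<Sum>p\<in>F. c p * m p)" for F c
    by (induction F rule: infinite_finite_induct) (auto simp: u_def scaleC_prod_def scaleC_complex_def zero_prod_def)
  have le: "cmod (snd x) \<le> K * norm (fst x)" if "x \<in> N" for x
  proof -
    have "lcomb u S \<subseteq> {x. cmod (snd x) \<le> K * norm (fst x)}"
      using bd by (auto simp: lcomb_def sum_u)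
    moreover have "closed {x :: 'a \<times> complex. cmod (snd x) \<le> K * norm (fst x)}"
      by (intro closed_Collect_le continuous_intros)
    ultimately show ?thesis using closure_minimal that unfolding N_def by blast
  qed
  have fst_N: "fst x \<in> closure (lcomb v S)" if "x \<in> N" for x
  proof -
    have "x \<in> {x. fst x \<in> closure (lcomb v S)}"
    proof (rule closure_lcomb_induct[of x u S])
      have "csubspace (closure (lcomb v S))" by (simp add: csubspace_closure csubspace_lcomb)
      then show "csubspace {x :: 'a \<times> complex. fst x \<in> closure (lcomb v S)}"
        by (auto simp: csubspace_def scaleC_prod_def)
      have "{x :: 'a \<times> complex. fst x \<in> closure (lcomb v S)} = fst -` closure (lcomb v S)" by auto
      then show "closed {x :: 'a \<times> complex. fst x \<in> closure (lcomb v S)}"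
        by (simp add: closed_vimage_fst)
      show "u p \<in> {x. fst x \<in> closure (lcomb v S)}" if "p \<in> S" for p
        using lcomb_incl[OF that, of v] closure_subset by (auto simp: u_def)
    qed (use that in \<open>simp add: N_def\<close>)
    then show ?thesis by simp
  qed
  obtain n where n: "n \<in> N" "\<And>y. y \<in> N \<Longrightarrow> cinner ((0, 1) - n) y = 0"
    using orthogonal_decomposition[OF N] by metis
  obtain a z where az: "n = (a, z)" by force
  have orth: "(1 - z) * cnj (snd y) = cinner a (fst y)" if "y \<in> N" for y
    using n(2)[OF that] by (simp add: az cinner_prod_def cinner_complex_def cinner_minus_left)
  \<comment> \<open>Otherwise \<open>a = 0\<close>, so \<open>(0, 1)\<close> itself lies on the
    graph, against the bound.\<close>
  have z1: "1 - z \<noteq> 0"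
  proof
    assume "1 - z = 0"
    then have "cinner a a = 0" using orth[OF n(1)] by (simp add: az)
    then show False using le[OF n(1)] \<open>1 - z = 0\<close> by (simp add: az)
  qed
  define w where "w = inverse (1 - z) *\<^sub>C a"
  have eq: "snd y = cinner (fst y) w" if "y \<in> N" for y
  proof -
    have "cnj (snd y) = cinner w (fst y)"
      using orth[OF that] z1 by (simp add: w_def cinner_scaleC_left field_simps)
    then show ?thesis by (metis cinner_commute complex_cnj_cnj)
  qed
  \<comment> \<open>This multiple of \<open>n\<close> is the graph point over \<open>w\<close>: the
    bound at it gives the norm of \<open>w\<close>, and its first component places \<open>w\<close>
    in the closed span.\<close>
  have wN: "inverse (1 - z) *\<^sub>C n \<in> N" using N n(1) by (auto simp: csubspace_def)
  have "cinner w w = snd (inverse (1 - z) *\<^sub>C n)"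
    using eq[OF wN] by (simp add: az scaleC_prod_def w_def)
  then have "(norm w)\<^sup>2 = cmod (snd (inverse (1 - z) *\<^sub>C n))"
    by (metis abs_power2 cinner_self norm_of_real)
  also have "\<dots> \<le> K * norm w" using le[OF wN] by (simp add: az scaleC_prod_def w_def)
  finally have "norm w \<le> K"
    using K by (cases "w = 0") (auto simp: power2_eq_square)
  moreover have "w \<in> closure (lcomb v S)"
    using fst_N[OF wN] by (simp add: w_def az scaleC_prod_def)
  moreover have "cinner (v p) w = m p" if "p \<in> S" for p
  proof -
    have "u p \<in> N" using lcomb_incl[OF that, of u] closure_subset by (auto simp: N_def)
    then show ?thesis using eq[of "u p"] by (simp add: u_def)
  qed
  ultimately show thesis using that by blast
qed

text \<open>For fixed \<open>y\<close> the moments \<open>cinner (T p) y\<close> of the identity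
  family are represented by a vector, the value of the adjoint at \<open>y\<close>. This gives the
  definite description its meaning.\<close>

lemma cadjoint_exists:
  fixes T :: "'a::chilbert \<Rightarrow> 'b::chilbert"
  assumes T: "bounded_clinear T"
  shows "bounded_clinear (cadjoint T) \<and> (\<forall>x y. cinner (T x) y = cinner x (cadjoint T y))"
proof -
  obtain K where K: "0 \<le> K" "\<And>x. norm (T x) \<le> K * norm x" using bounded_clinear_bound[OF T] by blast
  have "\<exists>w. (\<forall>x. cinner x w = cinner (T x) y) \<and> norm w \<le> K * norm y" for y
  proof -
    have "cmod (\<Sum>p\<in>F. c p * cinner (T p) y) \<le> K * norm y * norm (\<Sum>p\<in>F. c p *\<^sub>C p)" for F c
    proof -
      have "(\<Sum>p\<in>F. c p * cinner (T p) y) = cinner (T (\<Sum>p\<in>F. c p *\<^sub>C p)) y"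
        by (simp add: bounded_clinear_simps[OF T] cinner_left_simps)
      also have "cmod \<dots> \<le> norm (T (\<Sum>p\<in>F. c p *\<^sub>C p)) * norm y" by (rule cinner_Cauchy_Schwarz)
      also have "\<dots> \<le> K * norm (\<Sum>p\<in>F. c p *\<^sub>C p) * norm y" by (intro mult_right_mono K) auto
      finally show ?thesis by (simp add: mult_ac)
    qed
    then show ?thesis
      using Riesz_moment[of "K * norm y" UNIV "\<lambda>p. cinner (T p) y" "\<lambda>p. p"] K by (metis UNIV_I mult_nonneg_nonneg norm_ge_zero)
  qed
  then obtain S where S: "\<And>x y. cinner x (S y) = cinner (T x) y" "\<And>y. norm (S y) \<le> K * norm y" by metis
  have "bounded_clinear S"
  proof (rule bounded_clinear_isometricI[where K = K])
    show "S (x + y) = S x + S y" for x y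
      by (rule cinner_eqI_right) (simp add: S cinner_add_right)
    show "S (c *\<^sub>C x) = c *\<^sub>C S x" for c x
      by (rule cinner_eqI_right) (simp add: S cinner_scaleC_right)
    show "norm (S x) \<le> norm x * K" for x using S(2)[of x] by (simp add: mult.commute)
  qed
  moreover have "cadjoint T = S" by (rule cadjointI) (simp add: S)
  ultimately show ?thesis using S by simp
qed

lemmas bounded_clinear_cadjoint = cadjoint_exists[THEN conjunct1]
lemma cinner_cadjoint: "bounded_clinear T \<Longrightarrow> cinner x (cadjoint T y) = cinner (T x) y"
  using cadjoint_exists by metis
lemma cinner_cadjoint_left: "bounded_clinear T \<Longrightarrow> cinner (cadjoint T y) x = cinner y (T x)"
  by (metis cinner_cadjoint cinner_commute)

text \<open>With \<open>Q\<close> the projection onto the closure of the span of all \<open>(\<alpha> p, \<beta> p)\<close>, the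
  partial isometry mapping each \<open>\<alpha> p\<close> to \<open>\<beta> p\<close> is twice the off-diagonal block of \<open>Q\<close>.\<close>

lemma partial_isometry_exists:
  fixes \<alpha> \<beta> :: "'p \<Rightarrow> 'a::chilbert"
  assumes gram: "\<And>p q. cinner (\<alpha> p) (\<alpha> q) = cinner (\<beta> p) (\<beta> q)"
  obtains V Vs where "bounded_clinear V" "bounded_clinear Vs" "\<And>x y. cinner (V x) y = cinner x (Vs y)"
    "\<And>p. V (\<alpha> p) = \<beta> p" "\<And>p. Vs (\<beta> p) = \<alpha> p"
    "\<And>x. V (Vs (V x)) = V x" "\<And>x. Vs (V (Vs x)) = Vs x"
    "\<And>y. (\<And>p. cinner (\<alpha> p) y = 0) \<Longrightarrow> V y = 0" "\<And>y. (\<And>p. cinner (\<beta> p) y = 0) \<Longrightarrow> Vs y = 0"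
proof -
  define g where "g p = (\<alpha> p, \<beta> p)" for p
  define N where "N = closure (lcomb g UNIV)"
  have N: "csubspace N" "closed N" by (auto simp: N_def csubspace_closure csubspace_lcomb)
  have gN: "g p \<in> N" for p using lcomb_incl[of p UNIV g] closure_subset by (auto simp: N_def)
  have cl: "closed {x :: 'a \<times> 'a. cinner (fst x) a = cinner (snd x) b}" for a b
    by (intro closed_Collect_eq continuous_intros)
  have cs: "csubspace {x :: 'a \<times> 'a. cinner (fst x) a = cinner (snd x) b}" for a b
    by (auto simp: csubspace_def scaleC_prod_def cinner_left_simps)
  have 1: "cinner (fst x) (\<alpha> p) = cinner (snd x) (\<beta> p)" if "x \<in> N" for x p
    using closure_lcomb_induct[OF that[unfolded N_def] cs cl, of "\<alpha> p" "\<beta> p"] by (auto simp: g_def gram)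
  have 2: "cinner (fst x) (fst y) = cinner (snd x) (snd y)" if "x \<in> N" "y \<in> N" for x y
  proof -
    have "cinner (fst y) (fst x) = cinner (snd y) (snd x)"
      using closure_lcomb_induct[OF that(2)[unfolded N_def] cs cl, of "fst x" "snd x"] 1[OF that(1)]
      by (auto simp: g_def) (metis cinner_commute)
    then show ?thesis by (metis cinner_commute)
  qed
  obtain Q where Q: "bounded_clinear Q" "\<And>x. Q x \<in> N" "\<And>x y. cinner (Q x) y = cinner x (Q y)"
    and Qeq: "\<And>x m. m \<in> N \<Longrightarrow> (\<And>y. y \<in> N \<Longrightarrow> cinner (x - m) y = 0) \<Longrightarrow> Q x = m"
    using projection_exists[OF N] by metis
  define V where "V k = 2 *\<^sub>R snd (Q (k, 0))" for k
  define Vs where "Vs k = 2 *\<^sub>R fst (Q (0, k))" for k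
  have bV: "bounded_clinear V" unfolding V_def
    by (intro bounded_clinear_intros bounded_clinear_compose[OF bounded_clinear_snd]
        bounded_clinear_compose[OF Q(1)])
  have bVs: "bounded_clinear Vs" unfolding Vs_def
    by (intro bounded_clinear_intros bounded_clinear_compose[OF bounded_clinear_fst]
        bounded_clinear_compose[OF Q(1)])
  have adj: "cinner (V x) y = cinner x (Vs y)" for x y
    using Q(3)[of "(x, 0)" "(0, y)"]
    by (simp add: V_def Vs_def cinner_prod_def cinner_scaleR_left cinner_scaleR_right)
  have half: "(1/2) *\<^sub>R x \<in> N" if "x \<in> N" for x
    using N(1) that by (auto simp: csubspace_def simp flip: scaleC_of_real)
  \<comment> \<open>All pairs in \<open>N\<close> have matching inner products in both components,
    so \<open>(a, 0) - (a, b) / 2 = (a, - b) / 2\<close> is orthogonal to \<open>N\<close>. Hence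
    the factor \<open>2\<close> in \<open>V\<close> and \<open>Vs\<close>.\<close>
  have Va: "V a = b" "Vs b = a" if "(a, b) \<in> N" for a b
  proof -
    have "Q (a, 0) = (1/2) *\<^sub>R (a, b)"
    proof (rule Qeq[OF half[OF that]])
      fix y assume "y \<in> N"
      have "a - (1/2) *\<^sub>R a = (1/2) *\<^sub>R a" by (simp add: algebra_simps flip: scaleR_add_left)
      then show "cinner ((a, 0) - (1/2) *\<^sub>R (a, b)) y = 0"
        using 2[OF that \<open>y \<in> N\<close>] by (simp add: cinner_prod_def cinner_scaleR_left cinner_minus_left)
    qed
    then show "V a = b" by (simp add: V_def)
    have "Q (0, b) = (1/2) *\<^sub>R (a, b)"
    proof (rule Qeq[OF half[OF that]])
      fix y assume "y \<in> N"
      have "b - (1/2) *\<^sub>R b = (1/2) *\<^sub>R b" by (simp add: algebra_simps flip: scaleR_add_left)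
      then show "cinner ((0, b) - (1/2) *\<^sub>R (a, b)) y = 0"
        using 2[OF that \<open>y \<in> N\<close>] by (simp add: cinner_prod_def cinner_scaleR_left cinner_minus_left)
    qed
    then show "Vs b = a" by (simp add: Vs_def)
  qed
  have VVsV: "V (Vs (V x)) = V x" for x
  proof -
    obtain a b where ab: "Q (x, 0) = (a, b)" by force
    then have "(a, b) \<in> N" using Q(2) by metis
    then show ?thesis using ab Va[of a b] by (simp add: V_def[of x] bounded_clinear_simps[OF bV] bounded_clinear_simps[OF bVs])
  qed
  have VsVVs: "Vs (V (Vs x)) = Vs x" for x
  proof -
    obtain a b where ab: "Q (0, x) = (a, b)" by force
    then have "(a, b) \<in> N" using Q(2) by metis
    then show ?thesis using ab Va[of a b] by (simp add: Vs_def[of x] bounded_clinear_simps[OF bV] bounded_clinear_simps[OF bVs])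
  qed
  have z1: "V y = 0" if y: "\<And>p. cinner (\<alpha> p) y = 0" for y
  proof -
    have "cinner (fst x) y = 0" if "x \<in> N" for x
      using closure_lcomb_induct[OF that[unfolded N_def] cs cl, of y 0] y by (auto simp: g_def)
    then have "cinner (V y) z = 0" for z
      using Q(2)[of "(0, z)"] unfolding adj by (simp add: Vs_def cinner_scaleR_right) (metis cinner_commute complex_cnj_zero)
    then show ?thesis by (metis cinner_eq_zero_iff)
  qed
  have z2: "Vs y = 0" if y: "\<And>p. cinner (\<beta> p) y = 0" for y
  proof -
    have "0 = cinner (snd x) y" if "x \<in> N" for x
      using closure_lcomb_induct[OF that[unfolded N_def] cs cl, of 0 y] y by (auto simp: g_def)
    then have "cinner z (Vs y) = 0" for z
      using Q(2)[of "(z, 0)"] unfolding adj[symmetric] by (simp add: V_def cinner_scaleR_left)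
    then show ?thesis by (metis cinner_eq_zero_iff)
  qed
  show thesis
    using that[OF bV bVs adj _ _ VVsV VsVVs z1 z2] Va[of "\<alpha> _" "\<beta> _"] gN by (simp add: g_def)
qed

section \<open>Positive semidefinite scalar kernels\<close>

text \<open>The index type is arbitrary, so that pairs \<open>(x, h)\<close> and triples
  \<open>(x, a, b)\<close> are covered as well. The conjugation is placed so that the Gram kernel
  \<open>cinner (v q) (v p)\<close> is the model case.\<close>

definition psd :: "('p \<Rightarrow> 'p \<Rightarrow> complex) \<Rightarrow> bool" where
  "psd K \<longleftrightarrow> (\<forall>F c. finite F \<longrightarrow> (\<Sum>p\<in>F. \<Sum>q\<in>F. cnj (c p) * c q * K p q) \<in> \<real>\<^sub>\<ge>\<^sub>0)"

lemma sum_swap_pairs: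
  "(\<Sum>a\<in>A. \<Sum>b\<in>B. \<Sum>p\<in>C. \<Sum>q\<in>D p. f a b p q) = (\<Sum>p\<in>C. \<Sum>q\<in>D p. \<Sum>a\<in>A. \<Sum>b\<in>B. f a b p q :: complex)"
proof -
  have "(\<Sum>a\<in>A. \<Sum>b\<in>B. \<Sum>p\<in>C. \<Sum>q\<in>D p. f a b p q) = (\<Sum>p\<in>C. \<Sum>a\<in>A. \<Sum>b\<in>B. \<Sum>q\<in>D p. f a b p q)"
    by (subst sum.swap[of _ A C], intro sum.cong refl sum.swap)
  also have "\<dots> = (\<Sum>p\<in>C. \<Sum>q\<in>D p. \<Sum>a\<in>A. \<Sum>b\<in>B. f a b p q)"
    by (intro sum.cong refl, subst sum.swap[of _ A], intro sum.cong refl sum.swap)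
  finally show ?thesis .
qed

text \<open>The points \<open>x i\<close> may coincide; coefficients over the same point are added
  up to reach the sum over distinct points of the definition.\<close>

lemma psdD:
  assumes "psd K" "finite A"
  shows "(\<Sum>i\<in>A. \<Sum>j\<in>A. cnj (c i) * c j * K (x i) (x j)) \<in> \<real>\<^sub>\<ge>\<^sub>0"
proof -
  define d where "d p = (\<Sum>i\<in>{i\<in>A. x i = p}. c i)" for p
  have "(\<Sum>i\<in>A. \<Sum>j\<in>A. cnj (c i) * c j * K (x i) (x j))
      = (\<Sum>p\<in>x ` A. \<Sum>i\<in>{i\<in>A. x i = p}. \<Sum>q\<in>x ` A. \<Sum>j\<in>{j\<in>A. x j = q}. cnj (c i) * c j * K (x i) (x j))"
    by (subst sum.image_gen[OF assms(2), of _ x], intro sum.cong refl, subst sum.image_gen[OF assms(2), of _ x]) simp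
  also have "\<dots> = (\<Sum>p\<in>x ` A. \<Sum>q\<in>x ` A. \<Sum>i\<in>{i\<in>A. x i = p}. \<Sum>j\<in>{j\<in>A. x j = q}. cnj (c i) * c j * K p q)"
    by (intro sum.cong refl, subst sum.swap, intro sum.cong refl) auto
  also have "\<dots> = (\<Sum>p\<in>x ` A. \<Sum>q\<in>x ` A. cnj (d p) * d q * K p q)"
  proof -
    have "cnj (d p) * d q = (\<Sum>i\<in>{i\<in>A. x i = p}. \<Sum>j\<in>{j\<in>A. x j = q}. cnj (c i) * c j)" for p q
      by (simp only: d_def cnj_sum sum_product)
    then show ?thesis by (simp only: sum_distrib_right)
  qed
  also have "\<dots> \<in> \<real>\<^sub>\<ge>\<^sub>0" using assms by (auto simp: psd_def)
  finally show ?thesis .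
qed

lemma psd_compose: "psd K \<Longrightarrow> psd (\<lambda>p q. K (f p) (f q))"
  unfolding psd_def[of "\<lambda>p q. K (f p) (f q)"] using psdD by blast

lemma psd_diag: "psd K \<Longrightarrow> K p p \<in> \<real>\<^sub>\<ge>\<^sub>0"
  using psdD[of K "{()}" "\<lambda>_. 1" "\<lambda>_. p"] by simp

lemma psd_diag_Re: "psd K \<Longrightarrow> 0 \<le> Re (K p p)" "psd K \<Longrightarrow> K p p = complex_of_real (Re (K p p))"
  using psd_diag[of K p] by (auto simp: nonneg_Reals_def)

text \<open>Polarization: the forms at two points with coefficients \<open>1, 1\<close> and
  \<open>1, \<i>\<close> have vanishing imaginary part.\<close>

lemma psd_hermitian:
  assumes "psd K" shows "K q p = cnj (K p q)"
proof -
  define x where "x = (\<lambda>b. if b then q else p)"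
  have 1: "K p p + K p q + K q p + K q q \<in> \<real>\<^sub>\<ge>\<^sub>0"
    using psdD[OF assms, of "UNIV :: bool set" "\<lambda>_. 1" x] by (simp add: UNIV_bool x_def algebra_simps)
  have 2: "K p p + \<i> * K p q - \<i> * K q p + K q q \<in> \<real>\<^sub>\<ge>\<^sub>0"
    using psdD[OF assms, of "UNIV :: bool set" "\<lambda>b. if b then \<i> else 1" x] by (simp add: UNIV_bool x_def algebra_simps)
  show ?thesis
    using 1 2 psd_diag[OF assms, of p] psd_diag[OF assms, of q]
    by (auto simp: complex_nonneg_Reals_iff complex_eq_iff)
qed

text \<open>The discriminant criterion. Along \<open>z = - t b\<close> the form is a real quadratic
  in \<open>t\<close> with minimum at \<open>t = 1 / A\<close>; if \<open>A = 0\<close>, a large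
  \<open>t\<close> forces \<open>b = 0\<close>.\<close>

lemma quadratic_nonneg_bound:
  assumes "0 \<le> A" "\<And>z. 0 \<le> A * (cmod z)\<^sup>2 + 2 * Re (cnj z * b) + C"
  shows "(cmod b)\<^sup>2 \<le> A * C"
proof -
  have t: "0 \<le> A * t\<^sup>2 * (cmod b)\<^sup>2 - 2 * t * (cmod b)\<^sup>2 + C" for t
  proof -
    have "cnj b * b = complex_of_real ((cmod b)\<^sup>2)"
      using complex_norm_square[of b] by (simp add: mult.commute)
    then have "Re (cnj (complex_of_real (- t) * b) * b) = - t * (cmod b)\<^sup>2"
      by (simp add: mult.assoc)
    moreover have "(cmod (complex_of_real (- t) * b))\<^sup>2 = t\<^sup>2 * (cmod b)\<^sup>2"
      by (simp add: norm_mult power_mult_distrib)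
    ultimately have "0 \<le> A * (t\<^sup>2 * (cmod b)\<^sup>2) + 2 * (- t * (cmod b)\<^sup>2) + C"
      using assms(2)[of "complex_of_real (- t) * b"] by simp
    then show ?thesis by (simp add: algebra_simps)
  qed
  show ?thesis
  proof (cases "A = 0")
    case True
    have "cmod b = 0"
    proof (rule ccontr)
      assume "cmod b \<noteq> 0"
      then show False using t[of "(C + 1) / (2 * (cmod b)\<^sup>2)"] True by (simp add: field_simps)
    qed
    then show ?thesis using True by simp
  next
    case False
    then have "A * (1 / A)\<^sup>2 = 1 / A" by (simp add: power2_eq_square)
    then show ?thesis using t[of "1 / A"] False assms(1) by (simp add: field_simps)
  qed
qed

text \<open>Testing the kernel on the \<open>x i\<close> and on the extra point \<open>p\<close>
  with a free coefficient \<open>z\<close> gives a nonnegative quadratic in \<open>z\<close>. The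
  extra index is \<open>None\<close>, so that \<open>p\<close> may also occur among the
  \<open>x i\<close>.\<close>

lemma psd_Cauchy_Schwarz:
  assumes K: "psd K" and F: "finite F"
  shows "(cmod (\<Sum>i\<in>F. c i * K p (x i)))\<^sup>2 \<le> Re (K p p) * Re (\<Sum>i\<in>F. \<Sum>j\<in>F. cnj (c i) * c j * K (x i) (x j))"
proof (rule quadratic_nonneg_bound)
  show "0 \<le> Re (K p p)" using psd_diag_Re[OF K] by blast
  fix z
  define A where "A = insert None (Some ` F)"
  define d where "d i = (case i of None \<Rightarrow> z | Some i \<Rightarrow> c i)" for i
  define y where "y i = (case i of None \<Rightarrow> p | Some i \<Rightarrow> x i)" for i
  let ?b = "\<Sum>i\<in>F. c i * K p (x i)"
  let ?C = "\<Sum>i\<in>F. \<Sum>j\<in>F. cnj (c i) * c j * K (x i) (x j)"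
  have sumA: "sum f A = f None + (\<Sum>i\<in>F. f (Some i))" for f :: "_ \<Rightarrow> complex"
    unfolding A_def using F by (subst sum.insert) (auto simp: sum.reindex)
  have "(\<Sum>i\<in>A. \<Sum>j\<in>A. cnj (d i) * d j * K (y i) (y j)) =
      cnj z * z * K p p + cnj z * ?b + (\<Sum>i\<in>F. cnj (c i) * z * K (x i) p) + ?C"
    unfolding sumA by (simp add: d_def y_def sum.distrib sum_distrib_left mult.assoc)
  also have "(\<Sum>i\<in>F. cnj (c i) * z * K (x i) p) = cnj (cnj z * ?b)"
    by (simp add: sum_distrib_left psd_hermitian[OF K, of _ p] mult_ac)
  also have "cnj z * z * K p p = complex_of_real ((cmod z)\<^sup>2 * Re (K p p))"
    by (subst psd_diag_Re(2)[OF K]) (simp add: complex_norm_square mult_ac flip: of_real_power)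
  finally have "complex_of_real ((cmod z)\<^sup>2 * Re (K p p)) + cnj z * ?b + cnj (cnj z * ?b) + ?C \<in> \<real>\<^sub>\<ge>\<^sub>0"
    using psdD[OF K, of A d y] F by (simp add: A_def)
  then have "0 \<le> Re (complex_of_real ((cmod z)\<^sup>2 * Re (K p p)) + cnj z * ?b + cnj (cnj z * ?b) + ?C)"
    by (simp only: complex_nonneg_Reals_iff)
  also have "\<dots> = Re (K p p) * (cmod z)\<^sup>2 + 2 * Re (cnj z * ?b) + Re ?C"
    unfolding plus_complex.simps complex_cnj(1) Re_complex_of_real cnj.simps by (simp add: mult.commute)
  finally show "0 \<le> Re (K p p) * (cmod z)\<^sup>2 + 2 * Re (cnj z * ?b) + Re ?C" .
qed

lemma psd_entry_bound: "psd K \<Longrightarrow> (cmod (K p q))\<^sup>2 \<le> Re (K p p) * Re (K q q)"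
  using psd_Cauchy_Schwarz[of K "{()}" "\<lambda>_. 1" p "\<lambda>_. q"] by simp

section \<open>Gram vectors of a positive semidefinite kernel\<close>

definition ket :: "'i \<Rightarrow> 'i ell2" where
  "ket i = Abs_ell2 (\<lambda>j. if j = i then 1 else 0)"

lemma Rep_ket: "Rep_ell2 (ket i) = (\<lambda>j. if j = i then 1 else 0)"
  unfolding ket_def
proof (rule Abs_ell2_inverse, rule CollectI)
  show "(\<lambda>j. (cmod (if j = i then 1 else 0))\<^sup>2) summable_on UNIV"
  proof -
    have "(\<lambda>j. (cmod (if j = i then 1 else 0))\<^sup>2) summable_on {i}" by simp
    then show ?thesis by (rule summable_on_cong_neutral[THEN iffD1, rotated 3]) auto
  qed
qed

lemma cinner_ket: "cinner u (ket i) = Rep_ell2 u i"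
proof -
  have "cinner u (ket i) = (\<Sum>\<^sub>\<infinity>j\<in>{i}. Rep_ell2 u j)"
    unfolding cinner_ell2_def Rep_ket by (rule infsum_cong_neutral) auto
  then show ?thesis by simp
qed

lemma cinner_ket_self: "cinner (ket i) (ket i) = 1"
  by (simp add: cinner_ket Rep_ket)

text \<open>A Cholesky factorization: by Zorn's lemma a partial factorization whose vectors are
  supported on its domain extends to all points.\<close>

lemma Kolmogorov_factorization:
  fixes K :: "'p \<Rightarrow> 'p \<Rightarrow> complex"
  assumes K: "psd K"
  obtains v :: "'p \<Rightarrow> 'p ell2" where "\<And>p q. cinner (v q) (v p) = K p q"
proof -
  \<comment> \<open>Relations make inclusion the order for Zorn's lemma; the Gram condition makes
    them single valued. The support condition keeps coordinate \<open>p\<close> unoccupied until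
    \<open>p\<close> enters the domain.\<close>
  define A :: "('p \<times> 'p ell2) set set" where
    "A = {r. (\<forall>s a t b. (s, a) \<in> r \<longrightarrow> (t, b) \<in> r \<longrightarrow> cinner b a = K s t) \<and>
             (\<forall>s a i. (s, a) \<in> r \<longrightarrow> i \<notin> Domain r \<longrightarrow> Rep_ell2 a i = 0)}"
  have gramA: "cinner b a = K s t" if "r \<in> A" "(s, a) \<in> r" "(t, b) \<in> r" for r s a t b
    using that by (simp add: A_def)
  have suppA: "Rep_ell2 a i = 0" if "r \<in> A" "(s, a) \<in> r" "i \<notin> Domain r" for r s a i
    using that unfolding A_def by simp
  have "\<exists>M\<in>A. \<forall>X\<in>A. M \<subseteq> X \<longrightarrow> X = M"
  proof (rule subset_Zorn')
    fix C assume C: "subset.chain A C"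
    then have CA: "\<And>r. r \<in> C \<Longrightarrow> r \<in> A" and
      tot: "\<And>r r'. r \<in> C \<Longrightarrow> r' \<in> C \<Longrightarrow> r \<subseteq> r' \<or> r' \<subseteq> r"
      by (auto simp: subset_chain_def)
    have 1: "cinner b a = K s t" if sa: "(s, a) \<in> \<Union> C" and tb: "(t, b) \<in> \<Union> C" for s a t b
    proof -
      obtain r r' where r: "r \<in> C" "(s, a) \<in> r" "r' \<in> C" "(t, b) \<in> r'"
        using sa tb by auto
      from tot[OF r(1,3)] show ?thesis
        using gramA[OF CA[OF r(1)] r(2), of t b] gramA[OF CA[OF r(3)] _ r(4), of s a] r by auto
    qed
    have 2: "Rep_ell2 a i = 0" if sa: "(s, a) \<in> \<Union> C" and i: "i \<notin> Domain (\<Union> C)" for s a i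
    proof -
      obtain r where r: "r \<in> C" "(s, a) \<in> r" using sa by auto
      moreover have "i \<notin> Domain r" using i r(1) by auto
      ultimately show ?thesis using suppA[OF CA] by metis
    qed
    show "\<Union> C \<in> A" unfolding A_def using 1 2 by simp
  qed
  then obtain M where M: "M \<in> A" and max: "\<And>X. X \<in> A \<Longrightarrow> M \<subseteq> X \<Longrightarrow> X = M" by auto
  note gram = gramA[OF M] and supp = suppA[OF M]
  have "p \<in> Domain M" for p
  proof (rule ccontr)
    assume p: "p \<notin> Domain M"
    let ?R = "sqrt (Re (K p p))"
    have bd: "cmod (\<Sum>x\<in>F. c x * K p (fst x)) \<le> ?R * norm (\<Sum>x\<in>F. c x *\<^sub>C snd x)"
      if F: "finite F" "F \<subseteq> M" for F c
    proof -
      have "cinner (\<Sum>x\<in>F. c x *\<^sub>C snd x) (\<Sum>x\<in>F. c x *\<^sub>C snd x)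
          = (\<Sum>y\<in>F. \<Sum>x\<in>F. cnj (c y) * c x * cinner (snd x) (snd y))"
        by (simp add: cinner_left_simps cinner_right_simps sum_distrib_left mult_ac)
      also have "\<dots> = (\<Sum>y\<in>F. \<Sum>x\<in>F. cnj (c y) * c x * K (fst y) (fst x))"
      proof (intro sum.cong refl)
        fix x y assume "x \<in> F" "y \<in> F"
        then show "cnj (c y) * c x * cinner (snd x) (snd y) = cnj (c y) * c x * K (fst y) (fst x)"
          using gram[of "fst y" "snd y" "fst x" "snd x"] F(2) by auto
      qed
      finally have "(norm (\<Sum>x\<in>F. c x *\<^sub>C snd x))\<^sup>2 = Re (\<Sum>y\<in>F. \<Sum>x\<in>F. cnj (c y) * c x * K (fst y) (fst x))"
        unfolding cinner_self by (metis Re_complex_of_real)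
      then have "(cmod (\<Sum>x\<in>F. c x * K p (fst x)))\<^sup>2 \<le> (?R * norm (\<Sum>x\<in>F. c x *\<^sub>C snd x))\<^sup>2"
        using psd_Cauchy_Schwarz[OF K F(1), of c p fst] psd_diag_Re(1)[OF K] by (simp add: power_mult_distrib)
      then show ?thesis by (rule power2_le_imp_le) (simp add: psd_diag_Re(1)[OF K])
    qed
    obtain w where w: "w \<in> closure (lcomb snd M)" "\<And>x. x \<in> M \<Longrightarrow> cinner (snd x) w = K p (fst x)" "norm w \<le> ?R"
      using Riesz_moment[OF _ bd] psd_diag_Re(1)[OF K] by (metis real_sqrt_ge_zero)
    have w0: "Rep_ell2 w i = 0" if "i \<notin> Domain M" for i
      using closure_lcomb_induct[OF w(1) csubspace_orthogonal, of "ket i"] supp that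
      by (auto simp: cinner_ket)
    have nw: "(norm w)\<^sup>2 \<le> Re (K p p)"
      using power_mono[OF w(3), of 2] psd_diag_Re(1)[OF K] by simp
    \<comment> \<open>The Cholesky diagonal entry. \<open>w\<close> is the part of the new vector
      determined by the earlier ones; \<open>ket p\<close> is orthogonal to it and to all of them,
      and carries the missing length.\<close>
    define r where "r = sqrt (Re (K p p) - (norm w)\<^sup>2)"
    define a where "a = w + complex_of_real r *\<^sub>C ket p"
    have kw: "cinner w (ket p) = 0" "cinner (ket p) w = 0"
      using w0[OF p] cinner_commute[of "ket p" w] by (simp_all add: cinner_ket)
    have aa: "cinner a a = K p p"
    proof -
      have "cinner a a = complex_of_real ((norm w)\<^sup>2 + r\<^sup>2)"
        unfolding a_def by (simp add: cinner_left_simps cinner_right_simps cinner_ket_self kw cinner_self[of w] power2_eq_square)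
      also have "(norm w)\<^sup>2 + r\<^sup>2 = Re (K p p)" using nw by (simp add: r_def)
      finally show ?thesis using psd_diag_Re(2)[OF K] by simp
    qed
    have ba: "cinner b a = K p t" "cinner a b = K t p" if "(t, b) \<in> M" for t b
    proof -
      show "cinner b a = K p t"
        using w(2)[OF that] supp[OF that p] by (simp add: a_def cinner_add_right cinner_scaleC_right cinner_ket)
      then show "cinner a b = K t p" by (metis cinner_commute psd_hermitian[OF K])
    qed
    have a0: "Rep_ell2 a i = 0" if "i \<notin> Domain M" "i \<noteq> p" for i
      using w0[OF that(1)] that(2) by (simp add: a_def plus_ell2.rep_eq scaleC_ell2.rep_eq Rep_ket)
    have "insert (p, a) M \<in> A"
      unfolding A_def using gram supp aa ba a0 by auto
    then have "insert (p, a) M = M" by (rule max) auto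
    then show False using p by blast
  qed
  then have "\<exists>a. (p, a) \<in> M" for p by auto
  then obtain v where v: "\<And>p. (p, v p) \<in> M" by metis
  show thesis by (rule that[of v]) (rule gram[OF v v])
qed

section \<open>Operations preserving positive semidefiniteness\<close>

lemma psd_gram: "psd (\<lambda>p q. cinner (v q) (v p :: 'a::chilbert))"
  unfolding psd_def
proof (intro allI impI)
  fix F :: "'b set" and c :: "'b \<Rightarrow> complex" assume "finite F"
  have "(\<Sum>p\<in>F. \<Sum>q\<in>F. cnj (c p) * c q * cinner (v q) (v p)) = cinner (\<Sum>q\<in>F. c q *\<^sub>C v q) (\<Sum>p\<in>F. c p *\<^sub>C v p)"
    by (simp add: cinner_left_simps cinner_right_simps sum_distrib_left mult_ac)
  then show "(\<Sum>p\<in>F. \<Sum>q\<in>F. cnj (c p) * c q * cinner (v q) (v p)) \<in> \<real>\<^sub>\<ge>\<^sub>0"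
    by (simp add: cinner_self)
qed

lemma psd_LIMSEQ:
  fixes L :: "'p \<Rightarrow> 'p \<Rightarrow> complex"
  assumes "\<And>n. psd (K n)" "\<And>p q. (\<lambda>n. K n p q) \<longlonglongrightarrow> L p q"
  shows "psd L"
  unfolding psd_def
proof (intro allI impI)
  fix F :: "'p set" and c assume "finite F"
  have "(\<lambda>n. \<Sum>p\<in>F. \<Sum>q\<in>F. cnj (c p) * c q * K n p q) \<longlonglongrightarrow> (\<Sum>p\<in>F. \<Sum>q\<in>F. cnj (c p) * c q * L p q)"
    by (intro tendsto_intros assms)
  then show "(\<Sum>p\<in>F. \<Sum>q\<in>F. cnj (c p) * c q * L p q) \<in> \<real>\<^sub>\<ge>\<^sub>0"
    using closed_sequentially[OF closed_nonneg_Reals_complex] assms(1) \<open>finite F\<close> by (fastforce simp: psd_def)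
qed

lemma sum_nonneg_Reals: "(\<And>i. i \<in> A \<Longrightarrow> f i \<in> \<real>\<^sub>\<ge>\<^sub>0) \<Longrightarrow> (\<Sum>i\<in>A. f i :: complex) \<in> \<real>\<^sub>\<ge>\<^sub>0"
  by (induction A rule: infinite_finite_induct) auto

lemma psd_sum:
  fixes K :: "'i \<Rightarrow> 'p \<Rightarrow> 'p \<Rightarrow> complex"
  assumes "\<And>i. i \<in> A \<Longrightarrow> psd (K i)"
  shows "psd (\<lambda>p q. \<Sum>i\<in>A. K i p q)"
  unfolding psd_def
proof (intro allI impI)
  fix F :: "'p set" and c assume F: "finite F"
  have "(\<Sum>p\<in>F. \<Sum>q\<in>F. cnj (c p) * c q * (\<Sum>i\<in>A. K i p q)) = (\<Sum>i\<in>A. \<Sum>p\<in>F. \<Sum>q\<in>F. cnj (c p) * c q * K i p q)"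
    by (simp add: sum_distrib_left sum.swap[of _ A])
  also have "\<dots> \<in> \<real>\<^sub>\<ge>\<^sub>0" by (rule sum_nonneg_Reals) (use assms F in \<open>auto simp: psd_def\<close>)
  finally show "(\<Sum>p\<in>F. \<Sum>q\<in>F. cnj (c p) * c q * (\<Sum>i\<in>A. K i p q)) \<in> \<real>\<^sub>\<ge>\<^sub>0" .
qed

lemma psd_add: "psd K \<Longrightarrow> psd L \<Longrightarrow> psd (\<lambda>p q. K p q + L p q)"
  using psd_sum[of "UNIV :: bool set" "\<lambda>b. if b then K else L"] by (simp add: UNIV_bool add.commute)

lemma psd_congruence:
  fixes K :: "'p \<Rightarrow> 'p \<Rightarrow> complex"
  assumes "psd K" shows "psd (\<lambda>p q. f p * cnj (f q) * K p q)"
  unfolding psd_def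
proof (intro allI impI)
  fix F :: "'p set" and c assume F: "finite F"
  show "(\<Sum>p\<in>F. \<Sum>q\<in>F. cnj (c p) * c q * (f p * cnj (f q) * K p q)) \<in> \<real>\<^sub>\<ge>\<^sub>0"
    using psdD[OF assms F, of "\<lambda>p. c p * cnj (f p)" "\<lambda>p. p"] by (simp add: mult_ac)
qed

lemma psd_scale: "psd K \<Longrightarrow> 0 \<le> r \<Longrightarrow> psd (\<lambda>p q. complex_of_real r * K p q)"
  using psd_congruence[of K "\<lambda>_. complex_of_real (sqrt r)"] by (simp flip: of_real_mult)

lemma psd_zero: "psd (\<lambda>_ _. 0)"
  by (simp add: psd_def)

lemma psd_restrict:
  assumes "psd K" shows "psd (\<lambda>p q. if p \<in> G \<and> q \<in> G then K p q else 0)"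
  using psd_congruence[OF assms, of "\<lambda>p. if p \<in> G then 1 else 0"]
  by (rule arg_cong[of _ _ psd, THEN iffD1, rotated]) (auto simp: fun_eq_iff)

lemma has_sum_finite_sum:
  fixes f :: "'i \<Rightarrow> 'p \<Rightarrow> complex"
  assumes "\<And>i. i \<in> F \<Longrightarrow> (f i has_sum s i) A"
  shows "((\<lambda>x. \<Sum>i\<in>F. f i x) has_sum (\<Sum>i\<in>F. s i)) A"
  using assms by (induction F rule: infinite_finite_induct) (auto intro: has_sum_add)

text \<open>The coordinates of Gram vectors of \<open>K\<close> write \<open>K\<close> as a
  convergent sum of rank one kernels. Each of these times \<open>L\<close> is a congruence of
  \<open>L\<close>, and nonnegativity survives the limit.\<close>

lemma psd_Schur_product:
  fixes K :: "'p \<Rightarrow> 'p \<Rightarrow> complex"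
  assumes "psd K" "psd L"
  shows "psd (\<lambda>p q. K p q * L p q)"
  unfolding psd_def
proof (intro allI impI)
  fix F :: "'p set" and c assume F: "finite F"
  obtain v :: "'p \<Rightarrow> 'p ell2" where v: "\<And>p q. cinner (v q) (v p) = K p q"
    using Kolmogorov_factorization[OF assms(1)] by metis
  have "((\<lambda>i. Rep_ell2 (v q) i * cnj (Rep_ell2 (v p) i)) has_sum K p q) UNIV" for p q
    using has_sum_infsum[OF ell2_summable, of "v q" "v p"] v[of q p] by (simp add: cinner_ell2_def)
  then have "((\<lambda>i. \<Sum>p\<in>F. \<Sum>q\<in>F. cnj (c p) * c q * (Rep_ell2 (v q) i * cnj (Rep_ell2 (v p) i) * L p q))
      has_sum (\<Sum>p\<in>F. \<Sum>q\<in>F. cnj (c p) * c q * (K p q * L p q))) UNIV"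
    by (intro has_sum_finite_sum has_sum_cmult_right has_sum_cmult_left F)
  moreover have "(\<Sum>p\<in>F. \<Sum>q\<in>F. cnj (c p) * c q * (Rep_ell2 (v q) i * cnj (Rep_ell2 (v p) i) * L p q)) \<in> \<real>\<^sub>\<ge>\<^sub>0" for i
    using psdD[OF assms(2) F, of "\<lambda>p. c p * Rep_ell2 (v p) i" "\<lambda>p. p"] by (simp add: mult_ac)
  ultimately show "(\<Sum>p\<in>F. \<Sum>q\<in>F. cnj (c p) * c q * (K p q * L p q)) \<in> \<real>\<^sub>\<ge>\<^sub>0"
    unfolding has_sum_def
    by (elim Lim_in_closed_set[OF closed_nonneg_Reals_complex, rotated 2])
      (auto intro: sum_nonneg_Reals)
qed

text \<open>The geometric series expands the Szego kernel \<open>1 / (1 - z p * cnj (z q))\<close>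
  into rank one kernels, so the quotient is a limit of sums of congruences of
  \<open>K\<close>.\<close>

lemma psd_Szego:
  assumes K: "psd K" and z: "\<And>p. cmod (z p) < 1"
  shows "psd (\<lambda>p q. K p q / (1 - z p * cnj (z q)))"
proof (rule psd_LIMSEQ)
  show "psd (\<lambda>p q. \<Sum>m<n. z p ^ m * cnj (z q ^ m) * K p q)" for n
    by (intro psd_sum psd_congruence K)
  fix p q
  have "cmod (z p * cnj (z q)) < 1"
    using mult_strict_mono'[OF z z, of p q] by (simp add: norm_mult)
  then have "(\<lambda>m. (z p * cnj (z q)) ^ m) sums (1 / (1 - z p * cnj (z q)))" by (rule geometric_sums)
  then have "(\<lambda>n. (\<Sum>m<n. (z p * cnj (z q)) ^ m) * K p q) \<longlonglongrightarrow> 1 / (1 - z p * cnj (z q)) * K p q"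
    unfolding sums_def by (intro tendsto_intros)
  then show "(\<lambda>n. \<Sum>m<n. z p ^ m * cnj (z q ^ m) * K p q) \<longlonglongrightarrow> K p q / (1 - z p * cnj (z q))"
    by (simp add: sum_distrib_right power_mult_distrib)
qed

lemma psd_Szego_prod:
  assumes K: "psd K" and z: "\<And>i p. cmod (z i p) < 1" and A: "finite A"
  shows "psd (\<lambda>p q. K p q / (\<Prod>i\<in>A. (1 - z i p * cnj (z i q)) ^ l i))"
  using A
proof (induction A)
  case (insert i A)
  have "psd (\<lambda>p q. K p q / (\<Prod>i\<in>A. (1 - z i p * cnj (z i q)) ^ l i) / (1 - z i p * cnj (z i q)) ^ n)" for n
  proof (induction n)
    case (Suc n)
    show ?case using psd_Szego[OF Suc, of "z i"] z by (simp add: mult_ac)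
  qed (use insert.IH in simp)
  then show ?case using insert.hyps by (simp add: mult.commute)
qed (use K in simp)


section \<open>Operator valued kernels\<close>

lemma positive_kernel_onD:
  assumes k: "positive_kernel_on S k" and A: "finite A" "\<And>i. i \<in> A \<Longrightarrow> h i \<in> S"
  shows "(\<Sum>i\<in>A. \<Sum>j\<in>A. cinner (k (x i) (x j) (h j)) (h i)) \<in> \<real>\<^sub>\<ge>\<^sub>0"
proof -
  obtain b where b: "bij_betw b {..<card A} A"
    using ex_bij_betw_nat_finite[OF A(1)] by (auto simp: atLeast0LessThan)
  then have "(\<Sum>i\<in>A. \<Sum>j\<in>A. cinner (k (x i) (x j) (h j)) (h i)) =
      (\<Sum>i<card A. \<Sum>j<card A. cinner (k (x (b i)) (x (b j)) (h (b j))) (h (b i)))"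
    by (simp add: sum.reindex_bij_betw[OF b, symmetric])
  also have "\<dots> \<in> \<real>\<^sub>\<ge>\<^sub>0"
    using k[unfolded positive_kernel_on_def, rule_format, of "card A" "\<lambda>i. h (b i)" "\<lambda>i. x (b i)"]
      A(2) bij_betwE[OF b] by auto
  finally show ?thesis .
qed

text \<open>The bridge from operator valued to scalar kernels: scalar coefficients are absorbed into
  the vectors by linearity, and conversely are taken to be \<open>1\<close>.\<close>

lemma positive_kernel_iff_psd:
  assumes k: "\<And>x y. bounded_clinear (k x y)"
  shows "positive_kernel k \<longleftrightarrow> psd (\<lambda>p q. cinner (k (fst p) (fst q) (snd q)) (snd p))"
proof
  assume "positive_kernel k"
  show "psd (\<lambda>p q. cinner (k (fst p) (fst q) (snd q)) (snd p))"
    unfolding psd_def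
  proof (intro allI impI)
    fix F :: "('a \<times> 'b) set" and c assume F: "finite F"
    show "(\<Sum>p\<in>F. \<Sum>q\<in>F. cnj (c p) * c q * cinner (k (fst p) (fst q) (snd q)) (snd p)) \<in> \<real>\<^sub>\<ge>\<^sub>0"
      using positive_kernel_onD[OF \<open>positive_kernel k\<close> F, of "\<lambda>p. c p *\<^sub>C snd p" fst]
      by (simp add: bounded_clinear_simps[OF k] cinner_scaleC_left cinner_scaleC_right mult_ac)
  qed
next
  assume "psd (\<lambda>p q. cinner (k (fst p) (fst q) (snd q)) (snd p))"
  then show "positive_kernel k"
    unfolding positive_kernel_on_def
    using psdD[of "\<lambda>p q. cinner (k (fst p) (fst q) (snd q)) (snd p)" _ "\<lambda>_. 1" "\<lambda>i. (x i, h i)" for x h]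
    by fastforce
qed

section \<open>Tensor products of operators and the unit ball\<close>

lemma bounded_clinear_htensor_left: "bounded_clinear (\<lambda>a. a \<otimes>\<^sub>h b)"
  using elementary_tensor_htensor by (auto simp: elementary_tensor_def)
lemma cinner_htensor: "cinner (a \<otimes>\<^sub>h b) (c \<otimes>\<^sub>h d) = cinner a c * cinner b d"
  using elementary_tensor_htensor[unfolded elementary_tensor_def, THEN conjunct2, THEN conjunct2] by metis

lemma cinner_sum_sum:
  "cinner (\<Sum>q\<in>B. d q *\<^sub>C v q) (\<Sum>p\<in>A. c p *\<^sub>C u p)
    = (\<Sum>p\<in>A. \<Sum>q\<in>B. cnj (c p) * d q * cinner (v q) (u p :: 'a::chilbert))"
  unfolding cinner_sum_right cinner_sum_left
  by (simp add: cinner_scaleC_left cinner_scaleC_right mult.assoc)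

lemma closure_lcomb_eq_zero:
  assumes "x \<in> closure (lcomb v S)" "\<And>p. p \<in> S \<Longrightarrow> cinner (v p) x = 0"
  shows "x = 0"
  using closure_lcomb_induct[OF assms(1) csubspace_orthogonal, of x] assms(2) by auto

text \<open>This is the kernel of the positive operator
  \<open>K\<^sup>2 - A\<^sup>* A\<close>.\<close>

lemma psd_operator_bound:
  assumes A: "bounded_clinear A" "\<And>x. norm (A x) \<le> K * norm x"
  shows "psd (\<lambda>p q. complex_of_real (K\<^sup>2) * cinner q p - cinner (A q) (A p))"
  unfolding psd_def
proof (intro allI impI)
  fix F c assume F: "finite (F :: 'a set)"
  let ?s = "\<Sum>p\<in>F. c p *\<^sub>C p"
  have "(\<Sum>p\<in>F. \<Sum>q\<in>F. cnj (c p) * c q * (complex_of_real (K\<^sup>2) * cinner q p - cinner (A q) (A p)))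
      = complex_of_real (K\<^sup>2) * cinner ?s ?s - cinner (A ?s) (A ?s)"
    by (simp add: bounded_clinear_simps[OF A(1)] cinner_left_simps cinner_right_simps sum_distrib_left
        right_diff_distrib sum_subtractf mult_ac)
  also have "\<dots> = complex_of_real ((K * norm ?s)\<^sup>2 - (norm (A ?s))\<^sup>2)"
    by (simp add: cinner_self power_mult_distrib)
  also have "\<dots> \<in> \<real>\<^sub>\<ge>\<^sub>0" unfolding nonneg_Reals_of_real_iff using power_mono[OF A(2)[of ?s], of 2] by simp
  finally show "(\<Sum>p\<in>F. \<Sum>q\<in>F. cnj (c p) * c q * (complex_of_real (K\<^sup>2) * cinner q p - cinner (A q) (A p))) \<in> \<real>\<^sub>\<ge>\<^sub>0" .
qed

text \<open>\<open>K\<^sup>2 L\<^sup>2 - A\<^sup>* A \<otimes> B\<^sup>* B\<close> is the sum of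
  \<open>(K\<^sup>2 - A\<^sup>* A) \<otimes> L\<^sup>2\<close> and
  \<open>A\<^sup>* A \<otimes> (L\<^sup>2 - B\<^sup>* B)\<close>; on elementary tensors both
  summands are Schur products of positive kernels.\<close>

lemma norm_tensor_sum_bound:
  assumes A: "bounded_clinear A" "\<And>x. norm (A x) \<le> K * norm x"
    and B: "bounded_clinear B" "\<And>x. norm (B x) \<le> L * norm x" and "finite F" "0 \<le> K" "0 \<le> L"
  shows "norm (\<Sum>p\<in>F. c p *\<^sub>C (A (fst p) \<otimes>\<^sub>h B (snd p))) \<le> K * L * norm (\<Sum>p\<in>F. c p *\<^sub>C (fst p \<otimes>\<^sub>h snd p))"
proof (rule power2_le_imp_le)
  let ?s = "\<Sum>p\<in>F. c p *\<^sub>C (fst p \<otimes>\<^sub>h snd p)" and ?t = "\<Sum>p\<in>F. c p *\<^sub>C (A (fst p) \<otimes>\<^sub>h B (snd p))"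
  have "psd (\<lambda>p q. (complex_of_real (K\<^sup>2) * cinner (fst q) (fst p) - cinner (A (fst q)) (A (fst p)))
        * (complex_of_real (L\<^sup>2) * cinner (snd q) (snd p))
      + cinner (A (fst q)) (A (fst p)) * (complex_of_real (L\<^sup>2) * cinner (snd q) (snd p) - cinner (B (snd q)) (B (snd p))))"
    by (intro psd_add psd_Schur_product psd_compose[OF psd_operator_bound[OF A], of fst]
        psd_compose[OF psd_operator_bound[OF B], of snd] psd_scale psd_gram zero_le_power2)
  from psdD[OF this \<open>finite F\<close>, of c "\<lambda>p. p"]
  have "(\<Sum>p\<in>F. \<Sum>q\<in>F. cnj (c p) * c q * (complex_of_real ((K * L)\<^sup>2) * (cinner (fst q) (fst p) * cinner (snd q) (snd p))
      - cinner (A (fst q)) (A (fst p)) * cinner (B (snd q)) (B (snd p)))) \<in> \<real>\<^sub>\<ge>\<^sub>0"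
    by (simp add: algebra_simps)
  also have "(\<Sum>p\<in>F. \<Sum>q\<in>F. cnj (c p) * c q * (complex_of_real ((K * L)\<^sup>2) * (cinner (fst q) (fst p) * cinner (snd q) (snd p))
      - cinner (A (fst q)) (A (fst p)) * cinner (B (snd q)) (B (snd p))))
      = complex_of_real ((K * L)\<^sup>2) * cinner ?s ?s - cinner ?t ?t"
    by (simp add: cinner_left_simps cinner_right_simps cinner_htensor sum_distrib_left
        right_diff_distrib sum_subtractf mult_ac)
  also have "\<dots> = complex_of_real ((K * L * norm ?s)\<^sup>2 - (norm ?t)\<^sup>2)"
    by (simp add: cinner_self power_mult_distrib)
  finally show "(norm ?t)\<^sup>2 \<le> (K * L * norm ?s)\<^sup>2" unfolding nonneg_Reals_of_real_iff by simp
  show "0 \<le> K * L * norm ?s" using assms by simp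
qed

text \<open>The operator is built from its adjoint: for every \<open>y\<close> of the ambient space
  the moments against elementary tensors are prescribed by
  \<open>A\<^sup>* \<otimes> B\<^sup>*\<close> and represented by a vector of \<open>N\<close>.
  Vectors of \<open>N\<close> are determined by such moments, which yields linearity and the values
  on elementary tensors.\<close>

lemma op_tensor_exists:
  fixes A :: "'a::chilbert \<Rightarrow> 'a" and B :: "'b::chilbert \<Rightarrow> 'b"
  assumes A: "bounded_clinear A" and B: "bounded_clinear B"
  shows "\<exists>T. bounded_clinear T \<and> (\<forall>a b. T (a \<otimes>\<^sub>h b) = A a \<otimes>\<^sub>h B b)"
proof -
  let ?A = "cadjoint A" and ?B = "cadjoint B"
  obtain K where K: "0 \<le> K" "\<And>x. norm (?A x) \<le> K * norm x"
    using bounded_clinear_bound[OF bounded_clinear_cadjoint[OF A]] by blast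
  obtain L where L: "0 \<le> L" "\<And>x. norm (?B x) \<le> L * norm x"
    using bounded_clinear_bound[OF bounded_clinear_cadjoint[OF B]] by blast
  define v where "v p = fst p \<otimes>\<^sub>h snd p" for p :: "'a \<times> 'b"
  define N where "N = closure (lcomb v UNIV)"
  have "\<exists>w. w \<in> N \<and> (\<forall>p. cinner (v p) w = cinner (?A (fst p) \<otimes>\<^sub>h ?B (snd p)) y) \<and> norm w \<le> K * L * norm y" for y
  proof -
    have bd: "cmod (\<Sum>p\<in>F. c p * cinner (?A (fst p) \<otimes>\<^sub>h ?B (snd p)) y) \<le> K * L * norm y * norm (\<Sum>p\<in>F. c p *\<^sub>C v p)"
      if "finite F" "F \<subseteq> UNIV" for F c
    proof -
      let ?t = "\<Sum>p\<in>F. c p *\<^sub>C (?A (fst p) \<otimes>\<^sub>h ?B (snd p))"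
      have "(\<Sum>p\<in>F. c p * cinner (?A (fst p) \<otimes>\<^sub>h ?B (snd p)) y) = cinner ?t y"
        by (simp add: cinner_left_simps)
      also have "cmod \<dots> \<le> norm ?t * norm y" by (rule cinner_Cauchy_Schwarz)
      also have "\<dots> \<le> K * L * norm (\<Sum>p\<in>F. c p *\<^sub>C v p) * norm y" unfolding v_def
        by (intro mult_right_mono norm_tensor_sum_bound bounded_clinear_cadjoint A B K L that(1)) auto
      finally show ?thesis by (simp add: mult_ac)
    qed
    have "0 \<le> K * L * norm y" using K L by simp
    then show ?thesis
    proof (rule Riesz_moment[OF _ bd])
      fix w assume w: "w \<in> closure (lcomb v UNIV)" "norm w \<le> K * L * norm y"
        "\<And>p. p \<in> UNIV \<Longrightarrow> cinner (v p) w = cinner (?A (fst p) \<otimes>\<^sub>h ?B (snd p)) y"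
      show ?thesis by (rule exI[of _ w]) (simp add: N_def w)
    qed
  qed
  then obtain T where T: "\<And>y. T y \<in> N" "\<And>y p. cinner (v p) (T y) = cinner (?A (fst p) \<otimes>\<^sub>h ?B (snd p)) y"
    "\<And>y. norm (T y) \<le> K * L * norm y" by metis
  have N: "csubspace N" by (simp add: N_def csubspace_closure csubspace_lcomb)
  have eq: "x = y" if "x \<in> N" "y \<in> N" "\<And>p. cinner (v p) x = cinner (v p) y" for x y
  proof -
    have "x - y \<in> closure (lcomb v UNIV)" using csubspace_diff[OF N that(1,2)] by (simp add: N_def)
    then have "x - y = 0" by (rule closure_lcomb_eq_zero) (simp add: cinner_diff_right that(3))
    then show ?thesis by simp
  qed
  have "bounded_clinear T"
  proof (rule bounded_clinear_isometricI[where K = "K * L"])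
    show "T (x + y) = T x + T y" for x y
      by (rule eq) (use T(1) N in \<open>auto simp: csubspace_def T(2) cinner_add_right\<close>)
    show "T (c *\<^sub>C x) = c *\<^sub>C T x" for c x
      by (rule eq) (use T(1) N in \<open>auto simp: csubspace_def T(2) cinner_scaleC_right\<close>)
    show "norm (T x) \<le> norm x * (K * L)" for x using T(3)[of x] by (simp add: mult.commute)
  qed
  moreover have "T (a \<otimes>\<^sub>h b) = A a \<otimes>\<^sub>h B b" for a b
  proof (rule eq[OF T(1)])
    show "A a \<otimes>\<^sub>h B b \<in> N"
      using lcomb_incl[of "(A a, B b)" UNIV v] closure_subset by (auto simp: N_def v_def)
    show "cinner (v p) (T (a \<otimes>\<^sub>h b)) = cinner (v p) (A a \<otimes>\<^sub>h B b)" for p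
      by (simp add: T(2)) (simp add: v_def cinner_htensor cinner_cadjoint_left A B)
  qed
  ultimately show ?thesis by blast
qed

lemma
  assumes "bounded_clinear A" "bounded_clinear B"
  shows bounded_clinear_op_tensor: "bounded_clinear (op_tensor A B)"
    and op_tensor_htensor: "op_tensor A B (a \<otimes>\<^sub>h b) = A a \<otimes>\<^sub>h B b"
proof -
  have "bounded_clinear (op_tensor A B) \<and> (\<forall>a b. op_tensor A B (a \<otimes>\<^sub>h b) = A a \<otimes>\<^sub>h B b)"
    unfolding op_tensor_def by (rule someI_ex[OF op_tensor_exists[OF assms]])
  then show "bounded_clinear (op_tensor A B)" "op_tensor A B (a \<otimes>\<^sub>h b) = A a \<otimes>\<^sub>h B b" by auto
qed

lemma tensor_space_eqI:
  assumes "bounded_clinear S" "bounded_clinear T" "\<And>a b. S (a \<otimes>\<^sub>h b) = T (a \<otimes>\<^sub>h b)" "x \<in> tensor_space"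
  shows "S x = T x"
proof -
  have "Real_Vector_Spaces.subspace {x. S x = T x}"
    using assms(1,2) by (auto simp: real_vector.subspace_def bounded_clinear_simps)
  then have "span (range (\<lambda>(a, b). a \<otimes>\<^sub>h b)) \<subseteq> {x. S x = T x}"
    using assms(3) by (intro real_vector.span_minimal) auto
  moreover have "closed {x. S x = T x}"
    using assms(1,2) by (intro closed_Collect_eq bounded_clinear_continuous_on)
  ultimately show ?thesis using assms(4) closure_minimal unfolding tensor_space_def by blast
qed

lemma tensor_space_approx:
  fixes x :: "('a::chilbert \<times> 'b::chilbert) ell2"
  assumes "x \<in> tensor_space"
  obtains s where "s \<longlonglongrightarrow> x" "\<And>n. \<exists>F c. finite F \<and> s n = (\<Sum>p\<in>F. c p *\<^sub>C (fst p \<otimes>\<^sub>h snd p))"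
proof -
  let ?v = "\<lambda>p :: 'a \<times> 'b. fst p \<otimes>\<^sub>h snd p"
  have "Real_Vector_Spaces.subspace (lcomb ?v UNIV)"
    using csubspace_lcomb[of ?v UNIV] by (auto simp: csubspace_def real_vector.subspace_def simp flip: scaleC_of_real)
  moreover have "range (\<lambda>(a, b). a \<otimes>\<^sub>h b) \<subseteq> lcomb ?v UNIV"
    using lcomb_incl[of "(_, _)" UNIV ?v] by auto
  ultimately have "span (range (\<lambda>(a, b). a \<otimes>\<^sub>h b)) \<subseteq> lcomb ?v UNIV" by (rule real_vector.span_minimal[rotated])
  then have "x \<in> closure (lcomb ?v UNIV)" using assms closure_mono unfolding tensor_space_def by blast
  then obtain s where "\<And>n. s n \<in> lcomb ?v UNIV" "s \<longlonglongrightarrow> x" unfolding closure_sequential by blast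
  then show thesis unfolding lcomb_def by (intro that[of s]) blast+
qed

text \<open>By density only finite combinations of elementary tensors matter, and on these the form
  is that of a scalar kernel on triples \<open>(x, a, b)\<close>. Positivity of a tensor product
  thereby becomes a question about Schur products.\<close>

lemma positive_kernel_on_tensor_space:
  fixes G :: "'x \<Rightarrow> 'x \<Rightarrow> 'a::chilbert \<Rightarrow> 'a" and k :: "'x \<Rightarrow> 'x \<Rightarrow> 'b::chilbert \<Rightarrow> 'b"
  assumes G: "\<And>x y. bounded_clinear (G x y)" and k: "\<And>x y. bounded_clinear (k x y)"
    and psd: "psd (\<lambda>(x, a, b) (y, a', b'). cinner (G x y a') a * cinner (k x y b') b)"
  shows "positive_kernel_on tensor_space (\<lambda>x y. op_tensor (G x y) (k x y))"
  unfolding positive_kernel_on_def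
proof (intro allI impI)
  fix n :: nat and x :: "nat \<Rightarrow> 'x" and h :: "nat \<Rightarrow> ('a \<times> 'b) ell2"
  assume h: "\<forall>i<n. h i \<in> tensor_space"
  have "\<exists>s. s \<longlonglongrightarrow> h i \<and> (\<forall>m. \<exists>F c. finite F \<and> s m = (\<Sum>p\<in>F. c p *\<^sub>C (fst p \<otimes>\<^sub>h snd p)))"
    if "i < n" for i
  proof -
    have "h i \<in> tensor_space" using h that by simp
    then show ?thesis
    proof (rule tensor_space_approx)
      fix s assume "s \<longlonglongrightarrow> h i" "\<And>m. \<exists>F c. finite F \<and> s m = (\<Sum>p\<in>F. c p *\<^sub>C (fst p \<otimes>\<^sub>h snd p))"
      then show ?thesis by (intro exI[of _ s]) simp
    qed
  qed
  then have "\<forall>i\<in>{..<n}. \<exists>s. s \<longlonglongrightarrow> h i \<and> (\<forall>m. \<exists>F c. finite F \<and> s m = (\<Sum>p\<in>F. c p *\<^sub>C (fst p \<otimes>\<^sub>h snd p)))"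
    by simp
  from bchoice[OF this] obtain s where s': "\<forall>i\<in>{..<n}. s i \<longlonglongrightarrow> h i \<and>
      (\<forall>m. \<exists>F c. finite F \<and> s i m = (\<Sum>p\<in>F. c p *\<^sub>C (fst p \<otimes>\<^sub>h snd p)))" ..
  then have s: "\<And>i. i < n \<Longrightarrow> s i \<longlonglongrightarrow> h i"
    and fin: "\<And>i m. i < n \<Longrightarrow> \<exists>F c. finite F \<and> s i m = (\<Sum>p\<in>F. c p *\<^sub>C (fst p \<otimes>\<^sub>h snd p))" by simp_all
  note bT = bounded_clinear_op_tensor[OF G k]
  have "(\<Sum>i<n. \<Sum>j<n. cinner (op_tensor (G (x i) (x j)) (k (x i) (x j)) (s j m)) (s i m)) \<in> \<real>\<^sub>\<ge>\<^sub>0" for m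
  proof -
    obtain F c where F: "\<And>i. i < n \<Longrightarrow> finite (F i)"
      and sF: "\<And>i. i < n \<Longrightarrow> s i m = (\<Sum>p\<in>F i. c i p *\<^sub>C (fst p \<otimes>\<^sub>h snd p))"
    proof -
      have "\<forall>i\<in>{..<n}. \<exists>F c. finite F \<and> s i m = (\<Sum>p\<in>F. c p *\<^sub>C (fst p \<otimes>\<^sub>h snd p))" using fin by blast
      from bchoice[OF this] obtain F where
        "\<forall>i\<in>{..<n}. \<exists>c. finite (F i) \<and> s i m = (\<Sum>p\<in>F i. c p *\<^sub>C (fst p \<otimes>\<^sub>h snd p))" ..
      from bchoice[OF this] obtain c where
        "\<forall>i\<in>{..<n}. finite (F i) \<and> s i m = (\<Sum>p\<in>F i. c i p *\<^sub>C (fst p \<otimes>\<^sub>h snd p))" ..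
      then show thesis by (intro that[of F c]) simp_all
    qed
    define A where "A = (SIGMA i:{..<n}. F i)"
    define y where "y = (\<lambda>(i, p). (x i, fst p :: 'a, snd p :: 'b))"
    have "(\<Sum>i<n. \<Sum>j<n. cinner (op_tensor (G (x i) (x j)) (k (x i) (x j)) (s j m)) (s i m))
        = (\<Sum>i<n. \<Sum>j<n. \<Sum>p\<in>F i. \<Sum>q\<in>F j. cnj (c i p) * c j q *
            (cinner (G (x i) (x j) (fst q)) (fst p) * cinner (k (x i) (x j) (snd q)) (snd p)))"
    proof (intro sum.cong refl)
      fix i j assume "i \<in> {..<n}" "j \<in> {..<n}"
      then have ij: "i < n" "j < n" by auto
      show "cinner (op_tensor (G (x i) (x j)) (k (x i) (x j)) (s j m)) (s i m) = (\<Sum>p\<in>F i. \<Sum>q\<in>F j. cnj (c i p) * c j q *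
            (cinner (G (x i) (x j) (fst q)) (fst p) * cinner (k (x i) (x j) (snd q)) (snd p)))"
        by (simp only: sF[OF ij(1)] sF[OF ij(2)] bounded_clinear_sum[OF bT] bounded_clinear_scaleC[OF bT]
            op_tensor_htensor[OF G k] cinner_sum_sum cinner_htensor)
    qed
    also have "\<dots> = (\<Sum>i<n. \<Sum>p\<in>F i. \<Sum>j<n. \<Sum>q\<in>F j. cnj (c i p) * c j q *
            (cinner (G (x i) (x j) (fst q)) (fst p) * cinner (k (x i) (x j) (snd q)) (snd p)))"
      by (intro sum.cong refl sum.swap)
    also have "\<dots> = (\<Sum>r\<in>A. \<Sum>r'\<in>A. cnj (case_prod c r) * case_prod c r' *
        (\<lambda>(x, a, b) (y, a', b'). cinner (G x y a') a * cinner (k x y b') b) (y r) (y r'))"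
      unfolding A_def using F by (subst sum.Sigma, simp, simp, intro sum.cong refl)
        (auto simp: y_def sum.Sigma split_def)
    also have "\<dots> \<in> \<real>\<^sub>\<ge>\<^sub>0"
      by (rule psdD[OF psd]) (use F in \<open>auto simp: A_def\<close>)
    finally show ?thesis .
  qed
  moreover have "(\<lambda>m. \<Sum>i<n. \<Sum>j<n. cinner (op_tensor (G (x i) (x j)) (k (x i) (x j)) (s j m)) (s i m))
      \<longlonglongrightarrow> (\<Sum>i<n. \<Sum>j<n. cinner (op_tensor (G (x i) (x j)) (k (x i) (x j)) (h j)) (h i))"
    by (intro tendsto_intros s bounded_linear.tendsto[OF bT[unfolded bounded_clinear_def, THEN conjunct1]]) auto
  ultimately show "(\<Sum>i<n. \<Sum>j<n. cinner (op_tensor (G (x i) (x j)) (k (x i) (x j)) (h j)) (h i)) \<in> \<real>\<^sub>\<ge>\<^sub>0"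
    by (rule closed_sequentially[OF closed_nonneg_Reals_complex])
qed

text \<open>The norm is a \<open>LEAST\<close> element, so it has to be attained: the admissible
  constants form a closed set bounded below. This set is also closed upwards, because
  \<open>1 \<otimes> k\<close> is positive for admissible \<open>k\<close>, so a norm below
  \<open>1\<close> makes \<open>1\<close> itself admissible.\<close>

lemma Hinf_unit_ball_iff:
  fixes \<phi> :: "'x \<Rightarrow> 'h::chilbert \<Rightarrow> 'h"
  assumes \<phi>: "\<And>x. bounded_clinear (\<phi> x)"
  shows "\<phi> \<in> Hinf_unit_ball \<psi> \<Lambda> \<longleftrightarrow> Hinf_bound \<psi> \<Lambda> \<phi> 1"
proof -
  define Q where "Q G k n x h = (\<Sum>i<n. \<Sum>j<n. cinner (op_tensor (G (x i) (x j)) (k (x i) (x j)) (h j)) (h i))"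
    for G k :: "'x \<Rightarrow> 'x \<Rightarrow> 'h \<Rightarrow> 'h" and n :: nat and x h
  define A where "A = Q (\<lambda>_ _ h. h)"
  define B where "B = Q (\<lambda>x y h. \<phi> x (cadjoint (\<phi> y) h))"
  let ?adm = "\<lambda>k (n :: nat) (h :: nat \<Rightarrow> ('h \<times> 'h) ell2). (k :: 'x \<Rightarrow> 'x \<Rightarrow> 'h \<Rightarrow> 'h) \<in> adm_kernels \<psi> \<Lambda> \<and> (\<forall>i<n. h i \<in> tensor_space)"
  have b\<phi>: "bounded_clinear (\<lambda>h. \<phi> x (cadjoint (\<phi> y) h))" for x y
    by (intro bounded_clinear_compose[OF \<phi>] bounded_clinear_cadjoint \<phi>)
  have lin: "op_tensor (\<lambda>h. c\<^sup>2 *\<^sub>R h - \<phi> x (cadjoint (\<phi> y) h)) T u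
      = c\<^sup>2 *\<^sub>R op_tensor (\<lambda>h. h) T u - op_tensor (\<lambda>h. \<phi> x (cadjoint (\<phi> y) h)) T u"
    if T: "bounded_clinear T" and u: "u \<in> tensor_space" for c x y u and T :: "'h \<Rightarrow> 'h"
  proof (rule tensor_space_eqI[OF _ _ _ u])
    have 1: "bounded_clinear (\<lambda>h. c\<^sup>2 *\<^sub>R h - \<phi> x (cadjoint (\<phi> y) h))"
      by (intro bounded_clinear_intros b\<phi>)
    show "bounded_clinear (op_tensor (\<lambda>h. c\<^sup>2 *\<^sub>R h - \<phi> x (cadjoint (\<phi> y) h)) T)"
      by (rule bounded_clinear_op_tensor[OF 1 T])
    show "bounded_clinear (\<lambda>u. c\<^sup>2 *\<^sub>R op_tensor (\<lambda>h. h) T u - op_tensor (\<lambda>h. \<phi> x (cadjoint (\<phi> y) h)) T u)"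
      by (intro bounded_clinear_intros bounded_clinear_op_tensor T b\<phi>)
    fix a b
    show "op_tensor (\<lambda>h. c\<^sup>2 *\<^sub>R h - \<phi> x (cadjoint (\<phi> y) h)) T (a \<otimes>\<^sub>h b)
      = c\<^sup>2 *\<^sub>R op_tensor (\<lambda>h. h) T (a \<otimes>\<^sub>h b) - op_tensor (\<lambda>h. \<phi> x (cadjoint (\<phi> y) h)) T (a \<otimes>\<^sub>h b)"
      by (simp add: op_tensor_htensor[OF 1 T] op_tensor_htensor[OF bounded_clinear_id T] op_tensor_htensor[OF b\<phi> T]
          bounded_clinear_simps[OF bounded_clinear_htensor_left])
  qed
  \<comment> \<open>For fixed data the form is \<open>c\<^sup>2 A - B\<close> with \<open>A\<close>
    and \<open>B\<close> independent of \<open>c\<close>; closedness and monotonicity in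
    \<open>c\<close> are read off from this.\<close>
  have bound_iff: "Hinf_bound \<psi> \<Lambda> \<phi> c \<longleftrightarrow>
      0 \<le> c \<and> (\<forall>k n x h. ?adm k n h \<longrightarrow> complex_of_real (c\<^sup>2) * A k n x h - B k n x h \<in> \<real>\<^sub>\<ge>\<^sub>0)" for c
  proof -
    have "(\<Sum>i<n. \<Sum>j<n. cinner (op_tensor (\<lambda>h. c\<^sup>2 *\<^sub>R h - \<phi> (x i) (cadjoint (\<phi> (x j)) h)) (k (x i) (x j)) (h j)) (h i))
      = complex_of_real (c\<^sup>2) * A k n x h - B k n x h" if "?adm k n h" for k n x h
    proof -
      have bk: "bounded_clinear (k x y)" for x y using that by (auto simp: adm_kernels_def)
      have "(\<Sum>i<n. \<Sum>j<n. cinner (op_tensor (\<lambda>h. c\<^sup>2 *\<^sub>R h - \<phi> (x i) (cadjoint (\<phi> (x j)) h)) (k (x i) (x j)) (h j)) (h i))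
        = (\<Sum>i<n. \<Sum>j<n. complex_of_real (c\<^sup>2) * cinner (op_tensor (\<lambda>h. h) (k (x i) (x j)) (h j)) (h i)
            - cinner (op_tensor (\<lambda>h. \<phi> (x i) (cadjoint (\<phi> (x j)) h)) (k (x i) (x j)) (h j)) (h i))"
        using that by (intro sum.cong refl)
          (simp add: lin[OF bk] cinner_diff_left cinner_scaleR_left scaleR_conv_of_real)
      then show ?thesis by (simp add: A_def B_def Q_def sum_subtractf sum_distrib_left)
    qed
    then show ?thesis
      unfolding Hinf_bound_def positive_kernel_on_def by (intro conj_cong refl) auto
  qed
  have Apos: "A k n x h \<in> \<real>\<^sub>\<ge>\<^sub>0" if "?adm k n h" for k n x h
  proof -
    have k: "\<And>x y. bounded_clinear (k x y)" "positive_kernel k" using that by (auto simp: adm_kernels_def)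
    have "psd (\<lambda>(x, a, b) (y, a', b'). cinner a' a * cinner (k x y b') b)"
      using psd_Schur_product[OF psd_gram[of "\<lambda>r. fst (snd r)"]
          psd_compose[OF k(2)[unfolded positive_kernel_iff_psd[OF k(1)]], of "\<lambda>r. (fst r, snd (snd r))"]]
      by (simp add: split_def)
    then have "positive_kernel_on tensor_space (\<lambda>x y. op_tensor (\<lambda>h. h) (k x y))"
      by (intro positive_kernel_on_tensor_space bounded_clinear_id k)
    then show ?thesis
      using that unfolding positive_kernel_on_def A_def Q_def by blast
  qed
  let ?S = "{c. Hinf_bound \<psi> \<Lambda> \<phi> c}"
  have mono: "Hinf_bound \<psi> \<Lambda> \<phi> d" if "Hinf_bound \<psi> \<Lambda> \<phi> c" "c \<le> d" for c d
    unfolding bound_iff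
  proof (intro conjI allI impI)
    show "0 \<le> d" using that by (auto simp: bound_iff)
    fix k n x h assume adm: "?adm k n h"
    have c: "0 \<le> c" "complex_of_real (c\<^sup>2) * A k n x h - B k n x h \<in> \<real>\<^sub>\<ge>\<^sub>0"
      using that(1) adm by (auto simp: bound_iff)
    have "complex_of_real (d\<^sup>2 - c\<^sup>2) * A k n x h \<in> \<real>\<^sub>\<ge>\<^sub>0"
      using Apos[OF adm] power_mono[OF that(2) c(1), of 2]
      by (intro nonneg_Reals_mult_I) (simp_all only: nonneg_Reals_of_real_iff diff_ge_0_iff_ge)
    then have "complex_of_real (d\<^sup>2 - c\<^sup>2) * A k n x h + (complex_of_real (c\<^sup>2) * A k n x h - B k n x h) \<in> \<real>\<^sub>\<ge>\<^sub>0"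
      using c(2) by (rule nonneg_Reals_add_I)
    then show "complex_of_real (d\<^sup>2) * A k n x h - B k n x h \<in> \<real>\<^sub>\<ge>\<^sub>0" by (simp add: algebra_simps)
  qed
  have "closed ?S"
    unfolding closed_sequential_limits
  proof (intro allI impI, elim conjE)
    fix s l assume s: "\<forall>n. s n \<in> ?S" "s \<longlonglongrightarrow> l"
    have "complex_of_real (l\<^sup>2) * A k n x h - B k n x h \<in> \<real>\<^sub>\<ge>\<^sub>0" if "?adm k n h" for k n x h
    proof (rule closed_sequentially[OF closed_nonneg_Reals_complex])
      show "complex_of_real ((s m)\<^sup>2) * A k n x h - B k n x h \<in> \<real>\<^sub>\<ge>\<^sub>0" for m
        using s(1) that by (auto simp: bound_iff)
      show "(\<lambda>m. complex_of_real ((s m)\<^sup>2) * A k n x h - B k n x h) \<longlonglongrightarrow> complex_of_real (l\<^sup>2) * A k n x h - B k n x h"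
        by (intro tendsto_intros s)
    qed
    moreover have "0 \<le> l" using s by (intro LIMSEQ_le_const[OF s(2)]) (auto simp: bound_iff)
    ultimately show "l \<in> ?S" by (simp add: bound_iff)
  qed
  moreover have bdd: "bdd_below ?S" by (rule bdd_belowI[of _ 0]) (auto simp: bound_iff)
  ultimately have norm: "Hinf_bound \<psi> \<Lambda> \<phi> (Hinf_norm \<psi> \<Lambda> \<phi>)" "\<And>c. Hinf_bound \<psi> \<Lambda> \<phi> c \<Longrightarrow> Hinf_norm \<psi> \<Lambda> \<phi> \<le> c"
    if "Hinf_bound \<psi> \<Lambda> \<phi> c" for c
  proof -
    have Inf: "Inf ?S \<in> ?S" using \<open>closed ?S\<close> bdd that by (intro closed_contains_Inf) auto
    have "Hinf_norm \<psi> \<Lambda> \<phi> = Inf ?S"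
      unfolding Hinf_norm_def by (rule Least_equality) (use Inf bdd in \<open>auto intro: cInf_lower\<close>)
    then show "Hinf_bound \<psi> \<Lambda> \<phi> (Hinf_norm \<psi> \<Lambda> \<phi>)" "\<And>c. Hinf_bound \<psi> \<Lambda> \<phi> c \<Longrightarrow> Hinf_norm \<psi> \<Lambda> \<phi> \<le> c"
      using Inf bdd by (auto intro: cInf_lower)
  qed
  show ?thesis
    unfolding Hinf_unit_ball_def Hinf_def using \<phi> norm mono by blast
qed

section \<open>Separation from a cone of positive kernels\<close>

lemma hermitian_form_real:
  fixes H :: "'p \<Rightarrow> 'p \<Rightarrow> complex"
  assumes "\<And>p q. H q p = cnj (H p q)"
  shows "Im (\<Sum>p\<in>F. \<Sum>q\<in>F. cnj (c p) * c q * H p q) = 0"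
proof -
  have "cnj (\<Sum>p\<in>F. \<Sum>q\<in>F. cnj (c p) * c q * H p q) = (\<Sum>p\<in>F. \<Sum>q\<in>F. c p * cnj (c q) * H q p)"
    unfolding cnj_sum by (intro sum.cong refl) (subst assms, simp)
  also have "\<dots> = (\<Sum>q\<in>F. \<Sum>p\<in>F. c p * cnj (c q) * H q p)" by (rule sum.swap)
  also have "\<dots> = (\<Sum>p\<in>F. \<Sum>q\<in>F. cnj (c p) * c q * H p q)" by (simp add: mult_ac)
  finally have "cnj (\<Sum>p\<in>F. \<Sum>q\<in>F. cnj (c p) * c q * H p q) = (\<Sum>p\<in>F. \<Sum>q\<in>F. cnj (c p) * c q * H p q)" .
  moreover have "Im z = 0" if "cnj z = z" for z using that by (simp add: complex_eq_iff)
  ultimately show ?thesis by blast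
qed

text \<open>Matrices over \<open>G\<close> are placed in a Hilbert space whose real inner product is
  the real part of the Hilbert-Schmidt pairing, so that the closest point theorem can separate them
  from a cone.\<close>

definition matrix_ell2 :: "'p set \<Rightarrow> ('p \<Rightarrow> 'p \<Rightarrow> complex) \<Rightarrow> ('p \<times> 'p) ell2" where
  "matrix_ell2 G f = Abs_ell2 (\<lambda>(p, q). if p \<in> G \<and> q \<in> G then f p q else 0)"

lemma Rep_matrix_ell2:
  assumes "finite G"
  shows "Rep_ell2 (matrix_ell2 G f) = (\<lambda>(p, q). if p \<in> G \<and> q \<in> G then f p q else 0)"
  unfolding matrix_ell2_def
proof (rule Abs_ell2_inverse, rule CollectI)
  have "(\<lambda>i. (cmod (case i of (p, q) \<Rightarrow> f p q))\<^sup>2) summable_on G \<times> G"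
    using assms by simp
  then show "(\<lambda>i. (cmod (case i of (p, q) \<Rightarrow> if p \<in> G \<and> q \<in> G then f p q else 0))\<^sup>2) summable_on UNIV"
    by (rule summable_on_cong_neutral[THEN iffD1, rotated 3]) (auto split: if_splits)
qed

lemma inner_matrix_ell2:
  assumes "finite G"
  shows "inner r (matrix_ell2 G f) = Re (\<Sum>p\<in>G. \<Sum>q\<in>G. Rep_ell2 r (p, q) * cnj (f p q))"
proof -
  have "(\<Sum>\<^sub>\<infinity>i. Rep_ell2 r i * cnj (Rep_ell2 (matrix_ell2 G f) i))
      = (\<Sum>\<^sub>\<infinity>i\<in>G \<times> G. Rep_ell2 r i * cnj (case_prod f i))"
    by (rule infsum_cong_neutral) (auto simp: Rep_matrix_ell2[OF assms] split: if_splits)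
  also have "\<dots> = (\<Sum>p\<in>G. \<Sum>q\<in>G. Rep_ell2 r (p, q) * cnj (f p q))"
    using assms by (simp add: sum.cartesian_product split_def)
  finally show ?thesis by (simp add: inner_ell2_def)
qed

lemma ell2_coordinate_bound: "cmod (Rep_ell2 x i) \<le> norm x"
  using ell2_sum_le[of "{i}" x] by (simp add: power2_le_iff_abs_le)

lemma sum_sum_restrict:
  fixes f :: "'p \<Rightarrow> 'p \<Rightarrow> complex"
  assumes "finite G" "\<And>p q. p \<notin> F \<or> q \<notin> F \<Longrightarrow> f p q = 0"
  shows "(\<Sum>p\<in>G. \<Sum>q\<in>G. f p q) = (\<Sum>p\<in>F \<inter> G. \<Sum>q\<in>F \<inter> G. f p q)"
proof -
  have "(\<Sum>p\<in>F \<inter> G. \<Sum>q\<in>F \<inter> G. f p q)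
      = (\<Sum>p\<in>G. if p \<in> F then (\<Sum>q\<in>G. if q \<in> F then f p q else 0) else 0)"
    by (simp only: Int_commute[of F] sum.inter_restrict[OF assms(1)])
  also have "\<dots> = (\<Sum>p\<in>G. \<Sum>q\<in>G. f p q)"
  proof (intro sum.cong refl)
    fix p
    have "(if q \<in> F then f p q else 0) = f p q" for q using assms(2)[of p q] by auto
    then show "(if p \<in> F then \<Sum>q\<in>G. if q \<in> F then f p q else 0 else 0) = (\<Sum>q\<in>G. f p q)"
      using assms(2)[of p] by simp
  qed
  finally show ?thesis by simp
qed

text \<open>With \<open>m\<close> the point of the closed cone closest to \<open>M\<close>, the
  functional \<open>r = M - m\<close> is nonpositive on the cone and nonnegative at
  \<open>m\<close>. The hypothesis \<open>dual\<close> makes it nonpositive at \<open>M\<close>, so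
  \<open>inner r r = inner r M - inner r m\<close> vanishes and \<open>M\<close> lies in the
  closure. The approximants are finally cut down to \<open>G\<close>.\<close>

lemma psd_cone_approximation:
  fixes M :: "'p \<Rightarrow> 'p \<Rightarrow> complex" and D :: "'l \<Rightarrow> 'p \<Rightarrow> 'p \<Rightarrow> complex"
  assumes G: "finite G" and L: "finite L" and e: "e > 0"
    and M: "\<And>p q. M q p = cnj (M p q)" and D: "\<And>l p q. D l q p = cnj (D l p q)"
    and dual: "\<And>\<kappa>. (\<And>l. l \<in> L \<Longrightarrow> psd (\<lambda>p q. D l p q * \<kappa> p q)) \<Longrightarrow>
      (\<And>p q. \<not> (p \<in> G \<and> q \<in> G) \<Longrightarrow> \<kappa> p q = 0) \<Longrightarrow> 0 \<le> Re (\<Sum>p\<in>G. \<Sum>q\<in>G. M p q * \<kappa> p q)"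
  shows "\<exists>K. (\<forall>l. psd (K l)) \<and> (\<forall>l p q. \<not> (p \<in> G \<and> q \<in> G) \<longrightarrow> K l p q = 0) \<and>
      (\<forall>p\<in>G. \<forall>q\<in>G. cmod (M p q - (\<Sum>l\<in>L. D l p q * K l p q)) \<le> e)"
proof -
  let ?m = "matrix_ell2 G"
  define T where "T K = (\<lambda>p q. \<Sum>l\<in>L. D l p q * K l p q)" for K :: "'l \<Rightarrow> 'p \<Rightarrow> 'p \<Rightarrow> complex"
  define C where "C = (\<lambda>K. ?m (T K)) ` {K. \<forall>l. psd (K l)}"
  have scale: "r *\<^sub>R ?m (T K) = ?m (T (\<lambda>l p q. complex_of_real r * K l p q))" for r K
    by (rule Rep_ell2_inject[THEN iffD1])
      (auto simp: Rep_matrix_ell2[OF G] scaleR_ell2.rep_eq T_def sum_distrib_left mult_ac fun_eq_iff)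
  have add: "?m (T K) + ?m (T K') = ?m (T (\<lambda>l p q. K l p q + K' l p q))" for K K'
    by (rule Rep_ell2_inject[THEN iffD1])
      (auto simp: Rep_matrix_ell2[OF G] plus_ell2.rep_eq T_def ring_distribs sum.distrib fun_eq_iff)
  have coneC: "r *\<^sub>R c \<in> C" if "c \<in> C" "0 \<le> r" for r c
  proof -
    obtain K where K: "\<And>l. psd (K l)" "c = ?m (T K)" using \<open>c \<in> C\<close> by (auto simp: C_def)
    then show ?thesis
      using psd_scale[OF K(1) \<open>0 \<le> r\<close>] unfolding K(2) scale C_def by (intro image_eqI[OF refl]) simp
  qed
  have addC: "c + c' \<in> C" if "c \<in> C" "c' \<in> C" for c c'
  proof -
    obtain K where K: "\<And>l. psd (K l)" "c = ?m (T K)" using \<open>c \<in> C\<close> by (auto simp: C_def)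
    obtain K' where K': "\<And>l. psd (K' l)" "c' = ?m (T K')" using \<open>c' \<in> C\<close> by (auto simp: C_def)
    show ?thesis
      using psd_add[OF K(1) K'(1)] unfolding K(2) K'(2) add C_def by (intro image_eqI[OF refl]) simp
  qed
  have "convex C" unfolding convex_def using coneC addC by blast
  then have "convex (closure C)" by (rule convex_closure)
  moreover have C0: "0 \<in> C"
  proof -
    have "?m (T (\<lambda>_ _ _. 0)) \<in> C" using psd_zero by (auto simp: C_def)
    then show ?thesis using coneC[of _ 0] by force
  qed
  then have "closure C \<noteq> {}" using closure_subset by blast
  ultimately obtain m where m: "m \<in> closure C" "\<forall>y\<in>closure C. dist (?m M) m \<le> dist (?m M) y"
    using closest_point_complete[OF _ closed_closure] by metis
  define r where "r = ?m M - m"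
  have var: "inner r (y - m) \<le> 0" if "y \<in> closure C" for y
    unfolding r_def by (rule any_closest_point_dot[OF \<open>convex (closure C)\<close> closed_closure m(1) that m(2)])
  have rm: "0 \<le> inner r m"
    using var[of 0] C0 closure_subset by (auto simp: inner_diff_right)
  have rc: "inner r c \<le> 0" if "c \<in> C" for c
  proof (rule ccontr)
    assume "\<not> inner r c \<le> 0"
    then have pos: "inner r c > 0" by simp
    \<comment> \<open>Chosen so that \<open>inner r (t *\<^sub>R c)\<close> is
      \<open>inner r m + 1\<close>, which the variational inequality forbids.\<close>
    define t where "t = (inner r m + 1) / inner r c"
    have "t *\<^sub>R c \<in> C" using pos rm by (intro coneC that) (simp add: t_def)
    then have "t *\<^sub>R c \<in> closure C" using closure_subset by blast
    from var[OF this] show False using pos by (simp add: inner_diff_right t_def)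
  qed
  \<comment> \<open>The hermitian part, since \<open>r\<close> is only tested on hermitian matrices;
    conjugated, since the pairing of \<open>dual\<close> is bilinear and that of \<open>ell2\<close>
    is not; negated, since \<open>r\<close> is nonpositive on the cone.\<close>
  define \<kappa> where "\<kappa> p q = (if p \<in> G \<and> q \<in> G then - (cnj (Rep_ell2 r (p, q)) + Rep_ell2 r (q, p)) / 2 else 0)" for p q
  have inner_\<kappa>: "inner r (?m f) = - Re (\<Sum>p\<in>G. \<Sum>q\<in>G. f p q * \<kappa> p q)" if f: "\<And>p q. f q p = cnj (f p q)" for f
  proof -
    let ?s = "\<Sum>p\<in>G. \<Sum>q\<in>G. Rep_ell2 r (p, q) * cnj (f p q)"
    have "(\<Sum>p\<in>G. \<Sum>q\<in>G. f p q * \<kappa> p q) =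
        - ((\<Sum>p\<in>G. \<Sum>q\<in>G. f p q * cnj (Rep_ell2 r (p, q))) + (\<Sum>p\<in>G. \<Sum>q\<in>G. f p q * Rep_ell2 r (q, p))) / 2"
      by (simp add: \<kappa>_def distrib_left sum.distrib sum_negf diff_divide_distrib sum_subtractf right_diff_distrib
          flip: sum_divide_distrib)
    also have "(\<Sum>p\<in>G. \<Sum>q\<in>G. f p q * cnj (Rep_ell2 r (p, q))) = cnj ?s"
      by (simp add: mult.commute)
    also have "(\<Sum>p\<in>G. \<Sum>q\<in>G. f p q * Rep_ell2 r (q, p)) = ?s"
      by (subst sum.swap) (intro sum.cong refl, subst f, simp)
    finally have eq: "(\<Sum>p\<in>G. \<Sum>q\<in>G. f p q * \<kappa> p q) = - (cnj ?s + ?s) / 2" .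
    have Re: "Re (- (cnj z + z) / 2) = - Re z" for z by simp
    show ?thesis unfolding inner_matrix_ell2[OF G] eq Re by simp
  qed
  have Therm: "T K q p = cnj (T K p q)" if "\<And>l. psd (K l)" for K p q
    unfolding T_def cnj_sum by (intro sum.cong refl) (simp add: D[of _ q p] psd_hermitian[OF that, of _ q p])
  have \<kappa>herm: "\<kappa> q p = cnj (\<kappa> p q)" for p q by (simp add: \<kappa>_def add.commute)
  have "psd (\<lambda>p q. D l p q * \<kappa> p q)" if l: "l \<in> L" for l
    unfolding psd_def
  proof (intro allI impI)
    fix F :: "'p set" and c assume F: "finite F"
    \<comment> \<open>The rank one kernel of \<open>b\<close>, put in place \<open>l\<close> and
      zero elsewhere, is a member of the cone whose pairing with \<open>\<kappa>\<close> is the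
      quadratic form of \<open>D l * \<kappa>\<close> at \<open>c\<close>.\<close>
    define b where "b p = (if p \<in> F then cnj (c p) else 0)" for p
    define K where "K l' = (if l' = l then (\<lambda>p q. b p * cnj (b q)) else (\<lambda>_ _. 0))" for l'
    have K: "psd (K l')" for l'
      using psd_congruence[OF psd_gram[of "\<lambda>_. 1 :: complex"], of b]
      by (simp add: K_def cinner_complex_def psd_zero)
    have TK: "T K p q = b p * cnj (b q) * D l p q" for p q
    proof -
      have "T K p q = (\<Sum>l'\<in>L. if l' = l then b p * cnj (b q) * D l p q else 0)"
        unfolding T_def by (intro sum.cong) (auto simp: K_def)
      then show ?thesis using l L by simp
    qed
    have "inner r (?m (T K)) \<le> 0" using K by (intro rc) (auto simp: C_def)
    then have "0 \<le> Re (\<Sum>p\<in>G. \<Sum>q\<in>G. T K p q * \<kappa> p q)"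
      unfolding inner_\<kappa>[of "T K", OF Therm[OF K]] by linarith
    also have "(\<Sum>p\<in>G. \<Sum>q\<in>G. T K p q * \<kappa> p q) = (\<Sum>p\<in>F \<inter> G. \<Sum>q\<in>F \<inter> G. T K p q * \<kappa> p q)"
      by (rule sum_sum_restrict[OF G]) (auto simp: TK b_def)
    also have "\<dots> = (\<Sum>p\<in>F \<inter> G. \<Sum>q\<in>F \<inter> G. cnj (c p) * c q * (D l p q * \<kappa> p q))"
      by (intro sum.cong refl) (simp add: TK b_def)
    also have "\<dots> = (\<Sum>p\<in>F. \<Sum>q\<in>F. cnj (c p) * c q * (D l p q * \<kappa> p q))"
      unfolding Int_commute[of F G]
      by (rule sum_sum_restrict[OF F, symmetric]) (auto simp: \<kappa>_def)
    finally have "0 \<le> Re (\<Sum>p\<in>F. \<Sum>q\<in>F. cnj (c p) * c q * (D l p q * \<kappa> p q))" .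
    moreover have "D l q p * \<kappa> q p = cnj (D l p q * \<kappa> p q)" for p q
      by (simp only: D[of l q p] \<kappa>herm[of q p] complex_cnj_mult)
    from hermitian_form_real[of "\<lambda>p q. D l p q * \<kappa> p q", OF this]
    have "Im (\<Sum>p\<in>F. \<Sum>q\<in>F. cnj (c p) * c q * (D l p q * \<kappa> p q)) = 0" .
    ultimately show "(\<Sum>p\<in>F. \<Sum>q\<in>F. cnj (c p) * c q * (D l p q * \<kappa> p q)) \<in> \<real>\<^sub>\<ge>\<^sub>0"
      unfolding complex_nonneg_Reals_iff ..
  qed
  then have "0 \<le> Re (\<Sum>p\<in>G. \<Sum>q\<in>G. M p q * \<kappa> p q)"
    by (rule dual) (auto simp: \<kappa>_def)
  then have "inner r (?m M) \<le> 0" unfolding inner_\<kappa>[of M, OF M] by linarith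
  moreover have "inner r (?m M) = inner r r + inner r m" by (simp add: r_def inner_diff_right)
  ultimately have "inner r r \<le> 0" using rm by simp
  then have "r = 0" using inner_gt_zero_iff[of r] by linarith
  then have "?m M = m" by (simp add: r_def)
  then obtain K where K: "\<And>l. psd (K l)" "dist (?m (T K)) (?m M) < e"
    using m(1) e unfolding closure_approachable C_def by blast
  define K' where "K' l p q = (if p \<in> G \<and> q \<in> G then K l p q else 0)" for l p q
  have "cmod (M p q - (\<Sum>l\<in>L. D l p q * K' l p q)) \<le> e" if "p \<in> G" "q \<in> G" for p q
  proof -
    have "M p q - (\<Sum>l\<in>L. D l p q * K' l p q) = Rep_ell2 (?m M - ?m (T K)) (p, q)"
      using that by (simp add: minus_ell2.rep_eq Rep_matrix_ell2[OF G] K'_def T_def)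
    then have "cmod (M p q - (\<Sum>l\<in>L. D l p q * K' l p q)) \<le> dist (?m M) (?m (T K))"
      unfolding dist_norm using ell2_coordinate_bound[of "?m M - ?m (T K)" "(p, q)"] by metis
    then show ?thesis using K(2) by (simp add: dist_commute)
  qed
  moreover have "psd (K' l)" for l
    using psd_restrict[OF K(1), of G l] by (simp add: K'_def[abs_def])
  ultimately show ?thesis by (intro exI[of _ K']) (simp add: K'_def)
qed


section \<open>Passage to the limit\<close>

lemma cluster_point_closed:
  assumes "inf (nhds x) F \<noteq> bot" "closed S" "eventually (\<lambda>y. y \<in> S) F"
  shows "x \<in> S"
proof (rule ccontr)
  assume "x \<notin> S"
  then have "eventually (\<lambda>y. y \<in> - S) (nhds x)" using assms(2) by (intro eventually_nhds_in_open) auto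
  then have "eventually (\<lambda>y. False) (inf (nhds x) F)"
    unfolding eventually_inf using assms(3) by fastforce
  then show False using assms(1) by (simp add: trivial_limit_def)
qed

lemma compact_cball_product:
  fixes R :: "'i \<Rightarrow> real"
  shows "compact {\<omega> :: 'i \<Rightarrow> complex. \<forall>i. cmod (\<omega> i) \<le> R i}"
proof -
  have "compactin (product_topology (\<lambda>_ :: 'i. euclidean :: complex topology) UNIV) (PiE UNIV (\<lambda>i. cball 0 (R i)))"
    by (subst compactin_PiE) (auto simp: compactin_euclidean_iff)
  then have "compact (PiE UNIV (\<lambda>i. cball (0 :: complex) (R i)))"
    by (simp add: euclidean_product_topology compactin_euclidean_iff)
  also have "PiE UNIV (\<lambda>i. cball (0 :: complex) (R i)) = {\<omega>. \<forall>i. cmod (\<omega> i) \<le> R i}"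
    by (auto simp: PiE_def Pi_def)
  finally show ?thesis .
qed

text \<open>Decompositions over different finite sets need not be compatible, but all of them lie in
  one product of discs whose radii depend only on the entry. Strict positivity of
  \<open>D l p p\<close> supplies these radii.\<close>

lemma psd_decomposition_limit:
  fixes M :: "'p \<Rightarrow> 'p \<Rightarrow> complex" and D :: "'l \<Rightarrow> 'p \<Rightarrow> 'p \<Rightarrow> complex"
  assumes L: "finite L" and D: "\<And>l p. l \<in> L \<Longrightarrow> Im (D l p p) = 0" "\<And>l p. l \<in> L \<Longrightarrow> 0 < Re (D l p p)"
    and approx: "\<And>G e. finite G \<Longrightarrow> e > 0 \<Longrightarrow>
      \<exists>K. (\<forall>l. psd (K l)) \<and> (\<forall>l p q. \<not> (p \<in> G \<and> q \<in> G) \<longrightarrow> K l p q = 0) \<and>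
        (\<forall>p\<in>G. \<forall>q\<in>G. cmod (M p q - (\<Sum>l\<in>L. D l p q * K l p q)) \<le> e)"
  shows "\<exists>K. (\<forall>l\<in>L. psd (K l)) \<and> (\<forall>p q. M p q = (\<Sum>l\<in>L. D l p q * K l p q))"
proof -
  \<comment> \<open>At \<open>(p, p)\<close> the real parts of the summands are nonnegative and add
    up to that of \<open>M p p\<close> within a tolerance of at most \<open>1\<close>, so this
    bounds the diagonal of \<open>K l\<close>. Off the diagonal the geometric mean of two such
    bounds is at most their sum, whence \<open>B\<close>.\<close>
  define R where "R l p = (cmod (M p p) + 1) / Re (D l p p)" for l p
  define B where "B = (\<lambda>(l, p, q). if l \<in> L then R l p + R l q else 0)"
  define good where "good G e K \<longleftrightarrow> (\<forall>l. psd (K l)) \<and> (\<forall>l p q. \<not> (p \<in> G \<and> q \<in> G) \<longrightarrow> K l p q = 0) \<and>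
        (\<forall>p\<in>G. \<forall>q\<in>G. cmod (M p q - (\<Sum>l\<in>L. D l p q * K l p q)) \<le> e)"
    for G :: "'p set" and e and K :: "'l \<Rightarrow> 'p \<Rightarrow> 'p \<Rightarrow> complex"
  have "\<forall>x. \<exists>K. finite (fst x) \<longrightarrow> good (fst x) (1 / Suc (snd x)) K"
    using approx unfolding good_def by simp
  from choice[OF this] obtain K where
    "\<forall>x. finite (fst x) \<longrightarrow> good (fst x) (1 / Suc (snd x)) (K x)" ..
  then have good: "good G (1 / Suc n) (K (G, n))" if "finite G" for G n
    using that by (metis fst_conv snd_conv)
  have K: "\<And>G n l. finite G \<Longrightarrow> psd (K (G, n) l)"
      "\<And>G n l p q. finite G \<Longrightarrow> \<not> (p \<in> G \<and> q \<in> G) \<Longrightarrow> K (G, n) l p q = 0"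
      "\<And>G n p q. finite G \<Longrightarrow> p \<in> G \<Longrightarrow> q \<in> G \<Longrightarrow> cmod (M p q - (\<Sum>l\<in>L. D l p q * K (G, n) l p q)) \<le> 1 / Suc n"
    using good unfolding good_def by auto
  define \<omega> where "\<omega> x = (\<lambda>(l, p, q). if l \<in> L then K x l p q else 0)" for x
  \<comment> \<open>Along this filter the finite sets exhaust the index type while the tolerance
    tends to zero. A cluster point inherits every closed condition that holds eventually.\<close>
  define F where "F = filtermap \<omega> (finite_subsets_at_top UNIV \<times>\<^sub>F sequentially)"
  have F: "F \<noteq> bot"
    by (simp add: F_def filtermap_bot_iff prod_filter_eq_bot)
  have evI: "eventually P F" if "\<And>G n. finite G \<Longrightarrow> G0 \<subseteq> G \<Longrightarrow> n \<ge> n0 \<Longrightarrow> P (\<omega> (G, n))" "finite G0" for P G0 n0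
  proof -
    have "eventually (\<lambda>G. finite G \<and> G0 \<subseteq> G) (finite_subsets_at_top (UNIV :: 'p set))"
      unfolding eventually_finite_subsets_at_top using that(2) by blast
    moreover have "eventually (\<lambda>n. n \<ge> n0) sequentially" by (rule eventually_ge_at_top)
    ultimately have "eventually (\<lambda>x. (finite (fst x) \<and> G0 \<subseteq> fst x) \<and> snd x \<ge> n0)
        (finite_subsets_at_top UNIV \<times>\<^sub>F sequentially)"
      by (rule eventually_prodI)
    then show ?thesis
      unfolding F_def eventually_filtermap by (rule eventually_mono) (use that(1) in force)
  qed
  have diag: "Re (K (G, n) l p p) \<le> R l p" if G: "finite G" and l: "l \<in> L" for G n l p
  proof (cases "p \<in> G")
    case True
    have pos: "0 \<le> Re (D l' p p * K (G, n) l' p p)" if "l' \<in> L" for l'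
      using D[OF that] psd_diag_Re(1)[OF K(1)[OF G]] by (simp add: less_imp_le)
    have "Re (D l p p) * Re (K (G, n) l p p) = Re (D l p p * K (G, n) l p p)" using D(1)[OF l] by simp
    also have "\<dots> \<le> (\<Sum>l\<in>L. Re (D l p p * K (G, n) l p p))"
      by (rule member_le_sum[OF l _ L]) (use pos in auto)
    also have "\<dots> = Re (M p p) - Re (M p p - (\<Sum>l\<in>L. D l p p * K (G, n) l p p))" by simp
    also have "\<dots> \<le> cmod (M p p) + cmod (M p p - (\<Sum>l\<in>L. D l p p * K (G, n) l p p))"
      using complex_Re_le_cmod[of "M p p"] abs_Re_le_cmod[of "M p p - (\<Sum>l\<in>L. D l p p * K (G, n) l p p)"] by linarith
    also have "\<dots> \<le> cmod (M p p) + 1"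
    proof -
      have "1 / real (Suc n) \<le> 1" by simp
      then show ?thesis using K(3)[OF G True True, of n] by linarith
    qed
    finally show ?thesis using D(2)[OF l, of p] by (simp add: R_def field_simps)
  next
    case False
    then show ?thesis using K(2)[OF G] D(2)[OF l, of p] by (simp add: R_def)
  qed
  have bound: "cmod (\<omega> (G, n) i) \<le> B i" if G: "finite G" for G n i
  proof -
    obtain l p q where i: "i = (l, p, q)" by (metis surj_pair)
    have "cmod (K (G, n) l p q) \<le> R l p + R l q" if l: "l \<in> L"
    proof (rule power2_le_imp_le)
      have nn: "0 \<le> R l p" "0 \<le> R l q" using D(2)[OF l] by (simp_all add: R_def less_imp_le)
      have "(cmod (K (G, n) l p q))\<^sup>2 \<le> Re (K (G, n) l p p) * Re (K (G, n) l q q)"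
        by (rule psd_entry_bound[OF K(1)[OF G]])
      also have "\<dots> \<le> R l p * R l q"
        using diag[OF G l] psd_diag_Re(1)[OF K(1)[OF G]] nn by (intro mult_mono) auto
      also have "\<dots> \<le> (R l p + R l q)\<^sup>2" using nn by (simp add: power2_eq_square algebra_simps)
      finally show "(cmod (K (G, n) l p q))\<^sup>2 \<le> (R l p + R l q)\<^sup>2" .
      show "0 \<le> R l p + R l q" using nn by simp
    qed
    then show ?thesis by (simp add: \<omega>_def B_def i)
  qed
  have "eventually (\<lambda>w. w \<in> {w. \<forall>i. cmod (w i) \<le> B i}) F"
    by (rule evI[of "{}" 0]) (use bound in auto)
  then obtain w where w: "inf (nhds w) F \<noteq> bot"
    using compact_cball_product[of B] F unfolding compact_filter by blast
  have cont: "continuous_on UNIV (\<lambda>w :: 'l \<times> 'p \<times> 'p \<Rightarrow> complex. w i)" for i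
    by (rule continuous_on_product_coordinates)
  have "psd (\<lambda>p q. w (l, p, q))" if l: "l \<in> L" for l
    unfolding psd_def
  proof (intro allI impI)
    fix A :: "'p set" and c assume A: "finite A"
    have "w \<in> (\<lambda>w. \<Sum>p\<in>A. \<Sum>q\<in>A. cnj (c p) * c q * w (l, p, q)) -` \<real>\<^sub>\<ge>\<^sub>0"
    proof (rule cluster_point_closed[OF w])
      show "closed ((\<lambda>w. \<Sum>p\<in>A. \<Sum>q\<in>A. cnj (c p) * c q * w (l, p, q)) -` \<real>\<^sub>\<ge>\<^sub>0)"
        by (intro closed_vimage closed_nonneg_Reals_complex continuous_intros cont)
      show "\<forall>\<^sub>F y in F. y \<in> (\<lambda>w. \<Sum>p\<in>A. \<Sum>q\<in>A. cnj (c p) * c q * w (l, p, q)) -` \<real>\<^sub>\<ge>\<^sub>0"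
        by (rule evI[of "{}" 0]) (use K(1) A l in \<open>auto simp: \<omega>_def psd_def\<close>)
    qed
    then show "(\<Sum>p\<in>A. \<Sum>q\<in>A. cnj (c p) * c q * w (l, p, q)) \<in> \<real>\<^sub>\<ge>\<^sub>0" by simp
  qed
  moreover have "M p q = (\<Sum>l\<in>L. D l p q * w (l, p, q))" for p q
  proof -
    have "cmod (M p q - (\<Sum>l\<in>L. D l p q * w (l, p, q))) \<le> 1 / Suc n" for n
    proof -
      have "w \<in> {w. cmod (M p q - (\<Sum>l\<in>L. D l p q * w (l, p, q))) \<le> 1 / Suc n}"
      proof (rule cluster_point_closed[OF w])
        show "closed {w. cmod (M p q - (\<Sum>l\<in>L. D l p q * w (l, p, q))) \<le> 1 / Suc n}"
          by (intro closed_Collect_le continuous_intros cont)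
        show "\<forall>\<^sub>F y in F. y \<in> {w. cmod (M p q - (\<Sum>l\<in>L. D l p q * w (l, p, q))) \<le> 1 / Suc n}"
        proof (rule evI[of "{p, q}" n])
          fix G m assume G: "finite G" "{p, q} \<subseteq> G" "m \<ge> n"
          have "cmod (M p q - (\<Sum>l\<in>L. D l p q * K (G, m) l p q)) \<le> 1 / Suc m" using K(3) G by auto
          also have "\<dots> \<le> 1 / Suc n" using G(3) by (simp add: frac_le)
          finally show "\<omega> (G, m) \<in> {w. cmod (M p q - (\<Sum>l\<in>L. D l p q * w (l, p, q))) \<le> 1 / Suc n}"
            by (simp add: \<omega>_def)
        qed simp
      qed
      then show ?thesis by simp
    qed
    then have "cmod (M p q - (\<Sum>l\<in>L. D l p q * w (l, p, q))) \<le> 0"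
      by (intro LIMSEQ_le_const[OF LIMSEQ_Suc[OF lim_1_over_n]]) auto
    then show ?thesis by simp
  qed
  ultimately show ?thesis by (intro exI[of _ "\<lambda>l p q. w (l, p, q)"]) simp
qed

section \<open>Agler decompositions\<close>

definition defect :: "('i::finite \<Rightarrow> 'x \<Rightarrow> complex) \<Rightarrow> ('i \<Rightarrow> nat) \<Rightarrow> 'x \<Rightarrow> 'x \<Rightarrow> complex" where
  "defect \<psi> l x y = (\<Prod>i\<in>UNIV. (1 - \<psi> i x * cnj (\<psi> i y)) ^ l i)"

text \<open>The kernels are scalar valued and live on pairs \<open>(x, h)\<close>. Sesquilinearity of \<open>K l\<close> in the
  second components need not be demanded: the left hand side vanishes on linear dependencies over a
  single point \<open>x\<close>, hence so does each \<open>K l\<close>, as the defects are strictly positive at \<open>(x, x)\<close>.\<close>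

definition agler_decomposition :: "('i::finite \<Rightarrow> 'x \<Rightarrow> complex) \<Rightarrow> ('i \<Rightarrow> nat) set \<Rightarrow>
    ('x \<Rightarrow> 'h::chilbert \<Rightarrow> 'h) \<Rightarrow> (('i \<Rightarrow> nat) \<Rightarrow> 'x \<times> 'h \<Rightarrow> 'x \<times> 'h \<Rightarrow> complex) \<Rightarrow> bool" where
  "agler_decomposition \<psi> \<Lambda> \<phi> K \<longleftrightarrow> (\<forall>l\<in>\<Lambda> - {\<lambda>_. 0}. psd (K l)) \<and>
     (\<forall>p q. cinner (snd q - \<phi> (fst p) (cadjoint (\<phi> (fst q)) (snd q))) (snd p) =
        (\<Sum>l\<in>\<Lambda> - {\<lambda>_. 0}. defect \<psi> l (fst p) (fst q) * K l p q))"

lemma agler_decompositionD: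
  assumes "agler_decomposition \<psi> \<Lambda> \<phi> K"
  shows "cinner (g - \<phi> x (cadjoint (\<phi> y) g)) h = (\<Sum>l\<in>\<Lambda> - {\<lambda>_. 0}. defect \<psi> l x y * K l (x, h) (y, g))"
  using assms[unfolded agler_decomposition_def, THEN conjunct2, rule_format, of "(y, g)" "(x, h)"] by simp

lemma agler_decomposition_factors:
  assumes "agler_decomposition \<psi> \<Lambda> \<phi> K"
  obtains v :: "('i::finite \<Rightarrow> nat) \<Rightarrow> 'x \<times> 'h::chilbert \<Rightarrow> ('x \<times> 'h) ell2"
  where "\<And>l p q. l \<in> \<Lambda> - {\<lambda>_. 0} \<Longrightarrow> cinner (v l q) (v l p) = K l p q"
proof -
  have "\<forall>l. \<exists>v :: 'x \<times> 'h \<Rightarrow> ('x \<times> 'h) ell2. l \<in> \<Lambda> - {\<lambda>_. 0} \<longrightarrow> (\<forall>p q. cinner (v q) (v p) = K l p q)"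
    using assms Kolmogorov_factorization[of "K _"] unfolding agler_decomposition_def by metis
  from choice[OF this] show thesis using that by blast
qed

lemma test_functions_norm: "test_functions \<psi> \<Longrightarrow> cmod (\<psi> i x) < 1"
  by (auto simp: test_functions_def)

lemma preordering_nonzero:
  assumes "preordering_set (\<Lambda> :: ('i::finite \<Rightarrow> nat) set)"
  shows "finite (\<Lambda> - {\<lambda>_. 0})" "\<Lambda> - {\<lambda>_. 0} \<noteq> {}"
proof -
  obtain l where l: "l \<in> \<Lambda>" "(\<lambda>j. if j = undefined then 1 else 0) \<le> l"
    using assms unfolding preordering_set_def by blast
  then have "l undefined \<noteq> 0" using l(2)[unfolded le_fun_def, rule_format, of undefined] by simp
  then have "l \<noteq> (\<lambda>_. 0)" by metis
  then show "\<Lambda> - {\<lambda>_. 0} \<noteq> {}" using l by blast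
  show "finite (\<Lambda> - {\<lambda>_. 0})" using assms by (simp add: preordering_set_def)
qed

section \<open>Properties of the defect functions\<close>

lemma defect_hermitian: "defect \<psi> l y x = cnj (defect \<psi> l x y)"
  by (simp add: defect_def mult.commute)

lemma defect_zero: "defect \<psi> (\<lambda>_. 0) x y = 1"
  by (simp add: defect_def)

lemma defect_diag:
  assumes "test_functions \<psi>"
  shows "Im (defect \<psi> l x x) = 0" "0 < Re (defect \<psi> l x x)"
proof -
  have "1 - \<psi> i x * cnj (\<psi> i x) = complex_of_real (1 - (cmod (\<psi> i x))\<^sup>2)" for i
    by (simp add: complex_norm_square flip: of_real_power)
  then have eq: "defect \<psi> l x x = complex_of_real (\<Prod>i\<in>UNIV. (1 - (cmod (\<psi> i x))\<^sup>2) ^ l i)"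
    by (simp add: defect_def)
  have "(cmod (\<psi> i x))\<^sup>2 < 1" for i
    using test_functions_norm[OF assms, of i x] by (simp add: power_less_one_iff)
  then have "0 < (\<Prod>i\<in>UNIV. (1 - (cmod (\<psi> i x))\<^sup>2) ^ l i)"
    by (auto intro!: prod_pos zero_less_power)
  then show "Im (defect \<psi> l x x) = 0" "0 < Re (defect \<psi> l x x)"
    unfolding eq Im_complex_of_real Re_complex_of_real by simp_all
qed

lemma defect_nonzero:
  assumes "test_functions \<psi>" shows "defect \<psi> l x y \<noteq> 0"
proof -
  have "\<psi> i x * cnj (\<psi> i y) \<noteq> 1" for i
  proof -
    have "cmod (\<psi> i x * cnj (\<psi> i y)) < 1"
      using mult_strict_mono'[OF test_functions_norm[OF assms] test_functions_norm[OF assms], of i x i y]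
      by (simp add: norm_mult)
    then show ?thesis by auto
  qed
  then show ?thesis by (simp add: defect_def)
qed

text \<open>A product of Szego kernels undoes the defect. Hence positivity after multiplication by a
  single defect already contains positivity of \<open>K\<close>.\<close>

lemma psd_defect_cancel:
  assumes "test_functions \<psi>" "psd (\<lambda>p q. defect \<psi> l (fst p) (fst q) * K p q)"
  shows "psd K"
proof -
  have "psd (\<lambda>p q. defect \<psi> l (fst p) (fst q) * K p q /
      (\<Prod>i\<in>UNIV. (1 - \<psi> i (fst p) * cnj (\<psi> i (fst q))) ^ l i))"
    by (rule psd_Szego_prod[OF assms(2), of "\<lambda>i p. \<psi> i (fst p)"]) (simp_all add: test_functions_norm[OF assms(1)])
  then show ?thesis
    using defect_nonzero[OF assms(1)] by (simp flip: defect_def)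
qed

text \<open>Gram-Schmidt: the residual of a new vector is normalized and adjoined unless it is
  zero.\<close>

lemma finite_orthonormal_expansion:
  fixes S :: "'a::chilbert set"
  assumes "finite S"
  shows "\<exists>E. finite E \<and> orthonormal E \<and> (\<forall>h\<in>S. h = (\<Sum>e\<in>E. cinner h e *\<^sub>C e))"
  using assms
proof (induction S)
  case empty
  show ?case by (rule exI[of _ "{}"]) (simp add: orthonormal_def)
next
  case (insert a S)
  then obtain E where E: "finite E" "orthonormal E" "\<And>h. h \<in> S \<Longrightarrow> h = (\<Sum>e\<in>E. cinner h e *\<^sub>C e)" by blast
  define r where "r = a - (\<Sum>e\<in>E. cinner a e *\<^sub>C e)"
  have rE: "cinner r e = 0" if "e \<in> E" for e
    using cinner_sum_orthonormal[OF E(2,1) subset_refl that, of "cinner a"] that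
    by (simp add: r_def cinner_diff_left)
  show ?case
  proof (cases "r = 0")
    case True
    then show ?thesis using E by (intro exI[of _ E]) (auto simp: r_def)
  next
    case False
    define u where "u = complex_of_real (inverse (norm r)) *\<^sub>C r"
    have ru: "r = complex_of_real (norm r) *\<^sub>C u" using False by (simp add: u_def scaleC_scaleC)
    have nu: "cinner u u = 1"
      using False by (simp add: u_def cinner_self norm_scaleC norm_inverse del: of_real_inverse)
    have uE: "cinner u e = 0" "cinner e u = 0" if "e \<in> E" for e
      using rE[OF that] cinner_commute[of e r]
      by (simp_all add: u_def cinner_scaleC_left cinner_scaleC_right)
    have "u \<notin> E" using uE(1)[of u] nu by auto
    have "orthonormal (insert u E)" using E(2) nu uE by (auto simp: orthonormal_def)
    moreover have "h = (\<Sum>e\<in>insert u E. cinner h e *\<^sub>C e)" if h: "h \<in> S" for h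
    proof -
      have "cinner h u = 0"
        by (subst E(3)[OF h]) (simp add: cinner_sum_left cinner_scaleC_left uE)
      then show ?thesis using E(1) E(3)[OF h] \<open>u \<notin> E\<close> by simp
    qed
    moreover have "a = (\<Sum>e\<in>insert u E. cinner a e *\<^sub>C e)"
    proof -
      have a: "a = r + (\<Sum>e\<in>E. cinner a e *\<^sub>C e)" by (simp add: r_def)
      have "cinner a u = cinner r u"
        by (subst a) (simp add: cinner_add_left cinner_sum_left cinner_scaleC_left uE)
      also have "\<dots> = complex_of_real (norm r)" by (subst ru) (simp only: cinner_scaleC_left nu mult_1_right)
      finally have "cinner a u *\<^sub>C u = r" using ru by simp
      then show ?thesis using a E(1) \<open>u \<notin> E\<close> by simp
    qed
    ultimately show ?thesis using E(1) by (intro exI[of _ "insert u E"]) auto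
  qed
qed

text \<open>This is the congruence \<open>t\<^sup>* K t\<close>: coefficients \<open>c\<close> on
  the \<open>a\<close> side turn into the coefficients \<open>\<Sum>a. c a * t p a\<close> for
  \<open>K\<close>.\<close>

lemma psd_pullback:
  fixes K :: "'p \<Rightarrow> 'p \<Rightarrow> complex" and t :: "'p \<Rightarrow> 'a \<Rightarrow> complex"
  assumes "psd K" "finite G"
  shows "psd (\<lambda>a b. \<Sum>p\<in>G. \<Sum>q\<in>G. cnj (t p a) * t q b * K p q)"
  unfolding psd_def
proof (intro allI impI)
  fix F :: "'a set" and c assume F: "finite F"
  have "(\<Sum>a\<in>F. \<Sum>b\<in>F. cnj (c a) * c b * (\<Sum>p\<in>G. \<Sum>q\<in>G. cnj (t p a) * t q b * K p q))
      = (\<Sum>a\<in>F. \<Sum>b\<in>F. \<Sum>p\<in>G. \<Sum>q\<in>G. cnj (c a * t p a) * (c b * t q b) * K p q)"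
    by (simp add: sum_distrib_left mult_ac)
  also have "\<dots> = (\<Sum>p\<in>G. \<Sum>q\<in>G. \<Sum>a\<in>F. \<Sum>b\<in>F. cnj (c a * t p a) * (c b * t q b) * K p q)"
    by (rule sum_swap_pairs)
  also have "\<dots> = (\<Sum>p\<in>G. \<Sum>q\<in>G. cnj (\<Sum>a\<in>F. c a * t p a) * (\<Sum>b\<in>F. c b * t q b) * K p q)"
  proof -
    have "cnj (\<Sum>a\<in>F. c a * t p a) * (\<Sum>b\<in>F. c b * t q b) = (\<Sum>a\<in>F. \<Sum>b\<in>F. cnj (c a * t p a) * (c b * t q b))" for p q
      by (simp only: cnj_sum sum_product)
    then show ?thesis by (simp only: sum_distrib_right)
  qed
  also have "\<dots> \<in> \<real>\<^sub>\<ge>\<^sub>0" by (rule psdD[OF assms])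
  finally show "(\<Sum>a\<in>F. \<Sum>b\<in>F. cnj (c a) * c b * (\<Sum>p\<in>G. \<Sum>q\<in>G. cnj (t p a) * t q b * K p q)) \<in> \<real>\<^sub>\<ge>\<^sub>0" .
qed

text \<open>A functional nonnegative on the cone is turned into an admissible kernel. The conjugation
  \<open>J\<close> makes the pairing of the functional with \<open>1 - \<phi> \<phi>\<^sup>*\<close> a value of the quadratic form of
  \<open>(1 - \<phi> \<phi>\<^sup>*) \<otimes> k\<close>, taken at the vectors \<open>\<Sum>e. e \<otimes> e\<close>.\<close>

lemma unit_ball_dual:
  fixes \<phi> :: "'x \<Rightarrow> 'h::chilbert \<Rightarrow> 'h" and \<kappa> :: "'x \<times> 'h \<Rightarrow> 'x \<times> 'h \<Rightarrow> complex"
  assumes \<psi>: "test_functions \<psi>" and \<Lambda>: "preordering_set \<Lambda>" and \<phi>: "\<And>x. bounded_clinear (\<phi> x)"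
    and bd: "Hinf_bound \<psi> \<Lambda> \<phi> 1" and G: "finite G"
    and \<kappa>: "\<And>l. l \<in> \<Lambda> - {\<lambda>_. 0} \<Longrightarrow> psd (\<lambda>p q. defect \<psi> l (fst p) (fst q) * \<kappa> p q)"
  shows "0 \<le> Re (\<Sum>p\<in>G. \<Sum>q\<in>G.
    cinner (snd q - \<phi> (fst p) (cadjoint (\<phi> (fst q)) (snd q))) (snd p) * \<kappa> p q)"
proof -
  define N where "N x y h = 1\<^sup>2 *\<^sub>R h - \<phi> x (cadjoint (\<phi> y) h)" for x y h
  have N: "bounded_clinear (N x y)" for x y
    unfolding N_def by (intro bounded_clinear_intros bounded_clinear_compose[OF \<phi>] bounded_clinear_cadjoint \<phi>)
  obtain E where E: "finite E" "orthonormal E" "\<And>h. h \<in> snd ` G \<Longrightarrow> h = (\<Sum>e\<in>E. cinner h e *\<^sub>C e)"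
    using finite_orthonormal_expansion[of "snd ` G"] G by blast
  define J where "J h = (\<Sum>e\<in>E. cinner e h *\<^sub>C e)" for h
  have J: "cinner (J h) a = cinner a h" "cinner a (J h) = cinner h a" if "a \<in> E" for a h
  proof -
    show "cinner (J h) a = cinner a h"
      unfolding J_def using cinner_sum_orthonormal[OF E(2,1) subset_refl that, of "\<lambda>e. cinner e h"] that by simp
    then show "cinner a (J h) = cinner h a" by (metis cinner_commute)
  qed
  define t where "t q = (\<lambda>(y, u). if fst q = y then cinner u (J (snd q)) else 0)" for q :: "'x \<times> 'h"
  \<comment> \<open>Finite rank operators: \<open>\<kappa> p q\<close> multiplies the rank one
    operator that pairs with \<open>J (snd q)\<close> and points along \<open>J (snd p)\<close>;
    only members of \<open>G\<close> over \<open>x\<close> and \<open>y\<close> contribute.\<close>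
  define k where "k x y u = (\<Sum>p\<in>G. \<Sum>q\<in>G. ((if fst p = x \<and> fst q = y then \<kappa> p q else 0) * cinner u (J (snd q))) *\<^sub>C J (snd p))"
    for x y u
  have k: "bounded_clinear (k x y)" for x y
    unfolding k_def scaleC_scaleC[symmetric]
    by (intro bounded_clinear_intros bounded_clinear_cinner_scaleC)
  have ck: "cinner (k x y u') u = (\<Sum>p\<in>G. \<Sum>q\<in>G. cnj (t p (x, u)) * t q (y, u') * \<kappa> p q)" for x y u u'
    unfolding k_def cinner_sum_left
    by (intro sum.cong refl) (auto simp: t_def cinner_scaleC_left cinner_commute[of "J _" u])
  have psdk: "psd (\<lambda>a b. f (fst a) (fst b) * cinner (k (fst a) (fst b) (snd b)) (snd a))"
    if "psd (\<lambda>p q. f (fst p) (fst q) * \<kappa> p q)" for f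
  proof -
    have "f (fst a) (fst b) * cinner (k (fst a) (fst b) (snd b)) (snd a) =
        (\<Sum>p\<in>G. \<Sum>q\<in>G. cnj (t p a) * t q b * (f (fst p) (fst q) * \<kappa> p q))" for a b
      unfolding ck prod.collapse sum_distrib_left
      by (intro sum.cong refl) (auto simp: t_def split: prod.splits)
    then show ?thesis using psd_pullback[OF that G, of t] by simp
  qed
  have psd\<kappa>: "psd (\<lambda>p q. defect \<psi> l (fst p) (fst q) * \<kappa> p q)" if l: "l \<in> \<Lambda> \<or> l = (\<lambda>_. 0)" for l
  proof (cases "l = (\<lambda>_. 0)")
    \<comment> \<open>Here the claim is positivity of \<open>\<kappa>\<close> itself, obtained by
      cancelling the defect of any nonzero index of the preordering.\<close>
    case True
    obtain m where "m \<in> \<Lambda> - {\<lambda>_. 0}" using preordering_nonzero[OF \<Lambda>] by blast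
    from psd_defect_cancel[OF \<psi> \<kappa>[OF this]] show ?thesis using True by (simp add: defect_zero)
  qed (use \<kappa> l in blast)
  have pos: "positive_kernel (\<lambda>x y h. defect \<psi> l x y *\<^sub>C k x y h)" if "l \<in> \<Lambda> \<or> l = (\<lambda>_. 0)" for l
  proof -
    have "positive_kernel (\<lambda>x y h. defect \<psi> l x y *\<^sub>C k x y h) \<longleftrightarrow>
        psd (\<lambda>p q. defect \<psi> l (fst p) (fst q) * cinner (k (fst p) (fst q) (snd q)) (snd p))"
      by (subst positive_kernel_iff_psd) (auto intro: bounded_clinear_cmul k simp: cinner_scaleC_left)
    then show ?thesis using psdk[OF psd\<kappa>[OF that]] by blast
  qed
  have "k \<in> adm_kernels \<psi> \<Lambda>"
    unfolding adm_kernels_def using k pos pos[of "\<lambda>_. 0", unfolded defect_zero] by (auto simp: defect_def)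
  then have *: "positive_kernel_on tensor_space (\<lambda>x y. op_tensor (N x y) (k x y))"
    using bd unfolding Hinf_bound_def N_def by blast
  define A where "A = fst ` G \<times> E"
  have "a \<otimes>\<^sub>h b \<in> tensor_space" for a :: 'h and b :: 'h
  proof -
    have "a \<otimes>\<^sub>h b \<in> range (\<lambda>(a :: 'h, b :: 'h). a \<otimes>\<^sub>h b)" by (rule range_eqI[of _ _ "(a, b)"]) simp
    then show ?thesis
      unfolding tensor_space_def by (intro closure_subset[THEN subsetD] real_vector.span_base)
  qed
  then have "(\<Sum>r\<in>A. \<Sum>s\<in>A. cinner (op_tensor (N (fst r) (fst s)) (k (fst r) (fst s)) (snd s \<otimes>\<^sub>h snd s)) (snd r \<otimes>\<^sub>h snd r)) \<in> \<real>\<^sub>\<ge>\<^sub>0"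
    using positive_kernel_onD[OF *, of A "\<lambda>r. snd r \<otimes>\<^sub>h snd r" fst] G E(1) by (simp add: A_def)
  also have "(\<Sum>r\<in>A. \<Sum>s\<in>A. cinner (op_tensor (N (fst r) (fst s)) (k (fst r) (fst s)) (snd s \<otimes>\<^sub>h snd s)) (snd r \<otimes>\<^sub>h snd r))
      = (\<Sum>r\<in>A. \<Sum>s\<in>A. \<Sum>p\<in>G. \<Sum>q\<in>G. cinner (N (fst r) (fst s) (snd s)) (snd r) * (cnj (t p r) * t q s * \<kappa> p q))"
    by (simp add: op_tensor_htensor[OF N k] cinner_htensor ck sum_distrib_left)
  also have "\<dots> = (\<Sum>p\<in>G. \<Sum>q\<in>G. \<Sum>r\<in>A. \<Sum>s\<in>A. cinner (N (fst r) (fst s) (snd s)) (snd r) * (cnj (t p r) * t q s * \<kappa> p q))"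
    by (rule sum_swap_pairs)
  also have "\<dots> = (\<Sum>p\<in>G. \<Sum>q\<in>G. cinner (N (fst p) (fst q) (snd q)) (snd p) * \<kappa> p q)"
  proof (intro sum.cong refl)
    fix p q assume pq: "p \<in> G" "q \<in> G"
    have A_sum: "(\<Sum>r\<in>A. f r) = (\<Sum>e\<in>E. f (fst p', e))" if "p' \<in> G" "\<And>x e. x \<noteq> fst p' \<Longrightarrow> f (x, e) = 0"
      for p' and f :: "'x \<times> 'h \<Rightarrow> complex"
    proof -
      have "(\<Sum>r\<in>A. f r) = (\<Sum>r\<in>{fst p'} \<times> E. f r)"
        unfolding A_def using that G E(1) by (intro sum.mono_neutral_right) auto
      also have "\<dots> = (\<Sum>e\<in>E. f (fst p', e))"
        by (rule sum.reindex_bij_witness[of _ "\<lambda>e. (fst p', e)" snd]) auto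
      finally show ?thesis .
    qed
    have "(\<Sum>r\<in>A. \<Sum>s\<in>A. cinner (N (fst r) (fst s) (snd s)) (snd r) * (cnj (t p r) * t q s * \<kappa> p q))
      = (\<Sum>a\<in>E. \<Sum>b\<in>E. cinner (N (fst p) (fst q) b) a * (cnj (t p (fst p, a)) * t q (fst q, b) * \<kappa> p q))"
      by (subst A_sum[OF pq(1)], simp add: t_def, intro sum.cong refl, subst A_sum[OF pq(2)]) (simp_all add: t_def)
    \<comment> \<open>The conjugation turns the pairings with basis vectors into the coordinates of
      \<open>snd p\<close> and \<open>snd q\<close>, from which the form of \<open>N\<close> at
      these two vectors is reassembled.\<close>
    also have "\<dots> = (\<Sum>a\<in>E. \<Sum>b\<in>E. cnj (cinner (snd p) a) * cinner (snd q) b * cinner (N (fst p) (fst q) b) a) * \<kappa> p q"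
      unfolding sum_distrib_right by (intro sum.cong refl) (simp add: t_def J)
    also have "(\<Sum>a\<in>E. \<Sum>b\<in>E. cnj (cinner (snd p) a) * cinner (snd q) b * cinner (N (fst p) (fst q) b) a)
        = cinner (N (fst p) (fst q) (\<Sum>b\<in>E. cinner (snd q) b *\<^sub>C b)) (\<Sum>a\<in>E. cinner (snd p) a *\<^sub>C a)"
      by (simp only: bounded_clinear_sum[OF N] bounded_clinear_scaleC[OF N] cinner_sum_sum)
    also have "\<dots> = cinner (N (fst p) (fst q) (snd q)) (snd p)"
      using E(3)[of "snd p"] E(3)[of "snd q"] pq by simp
    finally show "(\<Sum>r\<in>A. \<Sum>s\<in>A. cinner (N (fst r) (fst s) (snd s)) (snd r) * (cnj (t p r) * t q s * \<kappa> p q))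
      = cinner (N (fst p) (fst q) (snd q)) (snd p) * \<kappa> p q" .
  qed
  finally show ?thesis by (simp add: N_def complex_nonneg_Reals_iff)
qed

lemma agler_decomposition_exists:
  fixes \<phi> :: "'x \<Rightarrow> 'h::chilbert \<Rightarrow> 'h"
  assumes \<psi>: "test_functions \<psi>" and \<Lambda>: "preordering_set \<Lambda>" and \<phi>: "\<And>x. bounded_clinear (\<phi> x)"
    and bd: "Hinf_bound \<psi> \<Lambda> \<phi> 1"
  shows "\<exists>K. agler_decomposition \<psi> \<Lambda> \<phi> K"
proof -
  define M where "M p q = cinner (snd q - \<phi> (fst p) (cadjoint (\<phi> (fst q)) (snd q))) (snd p)" for p q
  have M: "M p q = cinner (snd q) (snd p) - cinner (cadjoint (\<phi> (fst q)) (snd q)) (cadjoint (\<phi> (fst p)) (snd p))" for p q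
    by (simp add: M_def cinner_diff_left cinner_cadjoint \<phi>)
  have "\<exists>K. (\<forall>l\<in>\<Lambda> - {\<lambda>_. 0}. psd (K l)) \<and>
      (\<forall>p q. M p q = (\<Sum>l\<in>\<Lambda> - {\<lambda>_. 0}. defect \<psi> l (fst p) (fst q) * K l p q))"
  proof (rule psd_decomposition_limit[OF preordering_nonzero(1)[OF \<Lambda>]])
    fix G :: "('x \<times> 'h) set" and e :: real assume "finite G" "e > 0"
    then show "\<exists>K. (\<forall>l. psd (K l)) \<and> (\<forall>l p q. \<not> (p \<in> G \<and> q \<in> G) \<longrightarrow> K l p q = 0) \<and>
        (\<forall>p\<in>G. \<forall>q\<in>G. cmod (M p q - (\<Sum>l\<in>\<Lambda> - {\<lambda>_. 0}. defect \<psi> l (fst p) (fst q) * K l p q)) \<le> e)"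
    proof (rule psd_cone_approximation[OF _ preordering_nonzero(1)[OF \<Lambda>]])
      show "M q p = cnj (M p q)" for p q by (simp add: M flip: cinner_commute)
      show "defect \<psi> l (fst q) (fst p) = cnj (defect \<psi> l (fst p) (fst q))" for l and p q :: "'x \<times> 'h"
        by (rule defect_hermitian)
      fix \<kappa> :: "'x \<times> 'h \<Rightarrow> 'x \<times> 'h \<Rightarrow> complex"
      assume "\<And>l. l \<in> \<Lambda> - {\<lambda>_. 0} \<Longrightarrow> psd (\<lambda>p q. defect \<psi> l (fst p) (fst q) * \<kappa> p q)"
      from unit_ball_dual[OF \<psi> \<Lambda> \<phi> bd \<open>finite G\<close> this]
      show "0 \<le> Re (\<Sum>p\<in>G. \<Sum>q\<in>G. M p q * \<kappa> p q)" unfolding M_def .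
    qed
  qed (use defect_diag[OF \<psi>] in auto)
  then show ?thesis unfolding agler_decomposition_def M_def by blast
qed

section \<open>Matrix functions\<close>

lemma mat_adjoint_dim [simp]:
  "dim_row (mat_adjoint A) = dim_col A" "dim_col (mat_adjoint A) = dim_row A"
  by (simp_all add: mat_adjoint_def)

lemma mat_adjoint_index:
  fixes A :: "complex mat"
  assumes "i < dim_col A" "j < dim_row A"
  shows "mat_adjoint A $$ (i, j) = cnj (A $$ (j, i))"
  using assms by (simp add: mat_adjoint_def mat_of_rows_index vec_index_conjugate)

lemma mat_adjoint_carrier: "A \<in> carrier_mat m n \<Longrightarrow> mat_adjoint A \<in> carrier_mat n m"
  by (rule carrier_matI) (auto dest: carrier_matD)

lemma mat_adjoint_zero: "mat_adjoint (0\<^sub>m 0 0 :: complex mat) = 0\<^sub>m 0 0"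
  by (rule eq_matI) auto

lemma mult_index_sum:
  fixes A B :: "complex mat"
  assumes "A \<in> carrier_mat m n" "B \<in> carrier_mat n k" "i < m" "j < k"
  shows "(A * B) $$ (i, j) = (\<Sum>r<n. A $$ (i, r) * B $$ (r, j))"
  using assms by (auto simp: scalar_prod_def atLeast0LessThan intro!: sum.cong)

lemma mult_adjoint_index_sum:
  fixes A B :: "complex mat"
  assumes "A \<in> carrier_mat m n" "B \<in> carrier_mat k n" "i < m" "j < k"
  shows "(A * mat_adjoint B) $$ (i, j) = (\<Sum>r<n. A $$ (i, r) * cnj (B $$ (j, r)))"
  by (subst mult_index_sum[OF assms(1) mat_adjoint_carrier[OF assms(2)] assms(3,4)])
    (use assms in \<open>auto simp: mat_adjoint_index intro!: sum.cong\<close>)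

lemma psi_row_carrier: "psi_row \<psi> S n x \<in> carrier_mat 1 n"
  by (simp add: psi_row_def)

lemma psi_row_index: "j < n \<Longrightarrow> psi_row \<psi> S n x $$ (0, j) = (\<Prod>s\<in>S j. \<psi> (fst s) x)"
  by (simp add: psi_row_def)

lemma nlam_pos: "0 < nlam l"
  by (simp add: nlam_def)

lemma finite_slots: "finite (slots l)"
proof -
  have "slots l = (SIGMA i:UNIV. {..<l i})" by (auto simp: slots_def)
  then show ?thesis by simp
qed

lemma psi_row_product:
  "(psi_row \<psi> S n x * mat_adjoint (psi_row \<psi> S' n y)) $$ (0, 0)
    = (\<Sum>j<n. (\<Prod>s\<in>S j. \<psi> (fst s) x) * cnj (\<Prod>s\<in>S' j. \<psi> (fst s) y))"
  by (subst mult_adjoint_index_sum[OF psi_row_carrier psi_row_carrier]) (auto simp: psi_row_index)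

text \<open>The defect is a product of factors \<open>1 - z s\<close> over all slots. Expanding it
  gives a sum over subsets of slots with the sign of their parity, and \<open>ev\<close> and
  \<open>od\<close> enumerate the two parities.\<close>

lemma psi_rows_defect:
  assumes ord: "subset_orders \<Lambda> ev od" and l: "l \<in> \<Lambda> - {\<lambda>_. 0}"
  shows "(\<Sum>j<nlam l. (\<Prod>s\<in>ev l j. \<psi> (fst s) x) * cnj (\<Prod>s\<in>ev l j. \<psi> (fst s) y))
       - (\<Sum>j<nlam l. (\<Prod>s\<in>od l j. \<psi> (fst s) x) * cnj (\<Prod>s\<in>od l j. \<psi> (fst s) y)) = defect \<psi> l x y"
proof -
  let ?z = "\<lambda>s. \<psi> (fst s) x * cnj (\<psi> (fst s) y)"
  have ev: "bij_betw (ev l) {..<nlam l} {S. S \<subseteq> slots l \<and> even (card S)}"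
    and od: "bij_betw (od l) {..<nlam l} {S. S \<subseteq> slots l \<and> odd (card S)}"
    using ord l by (auto simp: subset_orders_def)
  have "defect \<psi> l x y = (\<Prod>s\<in>slots l. 1 - ?z s)"
  proof -
    have "slots l = (SIGMA i:UNIV. {..<l i})" by (auto simp: slots_def)
    then have "(\<Prod>i\<in>UNIV. \<Prod>j<l i. 1 - \<psi> i x * cnj (\<psi> i y)) = (\<Prod>s\<in>slots l. 1 - ?z s)"
      by (subst prod.Sigma) (simp_all add: split_def)
    then show ?thesis by (simp add: defect_def)
  qed
  also have "\<dots> = (\<Sum>S\<in>Pow (slots l). (-1) ^ card S * prod ?z S)"
    by (simp add: prod_diff_conv_sum[OF finite_slots])
  also have "Pow (slots l) = {S. S \<subseteq> slots l \<and> even (card S)} \<union> {S. S \<subseteq> slots l \<and> odd (card S)}" by auto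
  also have "(\<Sum>S\<in>\<dots>. (-1) ^ card S * prod ?z S) =
      (\<Sum>S\<in>{S. S \<subseteq> slots l \<and> even (card S)}. (-1) ^ card S * prod ?z S) +
      (\<Sum>S\<in>{S. S \<subseteq> slots l \<and> odd (card S)}. (-1) ^ card S * prod ?z S)"
    using finite_slots[of l] by (intro sum.union_disjoint) (auto intro: finite_subset[of _ "Pow (slots l)"])
  also have "(\<Sum>S\<in>{S. S \<subseteq> slots l \<and> even (card S)}. (-1) ^ card S * prod ?z S) = (\<Sum>j<nlam l. prod ?z (ev l j))"
    by (subst sum.reindex_bij_betw[OF ev, symmetric]) (use ev in \<open>auto intro!: sum.cong dest!: bij_betwE\<close>)
  also have "(\<Sum>S\<in>{S. S \<subseteq> slots l \<and> odd (card S)}. (-1) ^ card S * prod ?z S) = (\<Sum>j<nlam l. - prod ?z (od l j))"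
    by (subst sum.reindex_bij_betw[OF od, symmetric]) (use od in \<open>auto intro!: sum.cong dest!: bij_betwE\<close>)
  finally show ?thesis by (simp add: prod.distrib sum_negf)
qed

text \<open>\<open>E_diff\<close> and the class projections below have this form, so computations
  with them in the algebra reduce to scalar functions of the index.\<close>

definition scalar_matfun :: "('i::finite \<Rightarrow> nat) set \<Rightarrow> (('i \<Rightarrow> nat) \<Rightarrow> complex) \<Rightarrow> 'i matfun" where
  "scalar_matfun \<Lambda> g = on_nonzero \<Lambda> (\<lambda>l. g l \<cdot>\<^sub>m 1\<^sub>m (nlam l))"

lemma scalar_matfun_cong:
  "(\<And>l. l \<in> \<Lambda> - {\<lambda>_. 0} \<Longrightarrow> g l = g' l) \<Longrightarrow> scalar_matfun \<Lambda> g = scalar_matfun \<Lambda> g'"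
  by (auto simp: scalar_matfun_def on_nonzero_def fun_eq_iff)

lemma scalar_matfun_one: "mf_one \<Lambda> = scalar_matfun \<Lambda> (\<lambda>_. 1)"
  by (auto simp: scalar_matfun_def on_nonzero_def mf_one_def fun_eq_iff)

lemma scalar_matfun_add:
  "mf_add (scalar_matfun \<Lambda> g) (scalar_matfun \<Lambda> g') = scalar_matfun \<Lambda> (\<lambda>l. g l + g' l)"
  by (auto simp: scalar_matfun_def on_nonzero_def mf_add_def fun_eq_iff intro!: eq_matI)

lemma scalar_matfun_scale: "mf_scale c (scalar_matfun \<Lambda> g) = scalar_matfun \<Lambda> (\<lambda>l. c * g l)"
  by (auto simp: scalar_matfun_def on_nonzero_def mf_scale_def fun_eq_iff intro!: eq_matI)

lemma scalar_matfun_mult: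
  "mf_mult (scalar_matfun \<Lambda> g) (scalar_matfun \<Lambda> g') = scalar_matfun \<Lambda> (\<lambda>l. g l * g' l)"
proof (rule ext)
  fix l
  show "mf_mult (scalar_matfun \<Lambda> g) (scalar_matfun \<Lambda> g') l = scalar_matfun \<Lambda> (\<lambda>l. g l * g' l) l"
  proof (cases "l \<in> \<Lambda> \<and> l \<noteq> (\<lambda>_. 0)")
    case True
    have "(g l \<cdot>\<^sub>m 1\<^sub>m (nlam l)) * (g' l \<cdot>\<^sub>m 1\<^sub>m (nlam l)) = (g l * g' l) \<cdot>\<^sub>m 1\<^sub>m (nlam l)"
      by (subst mult_smult_assoc_mat[of _ "nlam l" "nlam l" _ "nlam l"]) (auto intro!: eq_matI)
    then show ?thesis using True by (simp add: mf_mult_def scalar_matfun_def on_nonzero_def)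
  qed (auto simp: mf_mult_def scalar_matfun_def on_nonzero_def intro!: eq_matI)
qed

lemma scalar_matfun_star: "mf_star (scalar_matfun \<Lambda> g) = scalar_matfun \<Lambda> (\<lambda>l. cnj (g l))"
  by (auto simp: scalar_matfun_def on_nonzero_def mf_star_def fun_eq_iff mat_adjoint_index mat_adjoint_zero intro!: eq_matI)

lemma E_diff_scalar:
  assumes ord: "subset_orders \<Lambda> ev od"
  shows "E_diff \<Lambda> \<psi> ev od x y = scalar_matfun \<Lambda> (\<lambda>l. defect \<psi> l x y)"
proof (rule ext)
  fix l
  show "E_diff \<Lambda> \<psi> ev od x y l = scalar_matfun \<Lambda> (\<lambda>l. defect \<psi> l x y) l"
  proof (cases "l \<in> \<Lambda> - {\<lambda>_. 0}")
    case True
    let ?p = "psi_row \<psi> (ev l) (nlam l)" and ?m = "psi_row \<psi> (od l) (nlam l)"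
    have "(?p x * mat_adjoint (?p y) - ?m x * mat_adjoint (?m y)) $$ (0, 0)
        = (?p x * mat_adjoint (?p y)) $$ (0, 0) - (?m x * mat_adjoint (?m y)) $$ (0, 0)"
      by (rule index_minus_mat) (simp_all add: psi_row_def)
    then show ?thesis
      using True psi_rows_defect[OF ord True, of \<psi> x y]
      by (simp add: E_diff_def scalar_matfun_def on_nonzero_def psi_row_product Let_def)
  qed (auto simp: E_diff_def scalar_matfun_def on_nonzero_def)
qed

lemma sigma_carrier: "sigma \<psi> ev od l x \<in> carrier_mat (nlam l) (nlam l)"
  unfolding sigma_def Let_def
  by (intro smult_carrier_mat mult_carrier_mat[of _ _ 1] mat_adjoint_carrier psi_row_carrier)

lemma matfuns_iff:
  "f \<in> matfuns \<Lambda> \<longleftrightarrow> (\<forall>l. if l \<in> \<Lambda> - {\<lambda>_. 0} then f l \<in> carrier_mat (nlam l) (nlam l) else f l = 0\<^sub>m 0 0)"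
  by (simp add: matfuns_def on_nonzero_def fun_eq_iff[of f]) metis

lemma on_nonzero_matfuns:
  "(\<And>l. f l \<in> carrier_mat (nlam l) (nlam l)) \<Longrightarrow> on_nonzero \<Lambda> f \<in> matfuns \<Lambda>"
  by (simp add: matfuns_iff on_nonzero_def)

lemma Cb_matfuns: "f \<in> Cb \<Lambda> \<psi> ev od \<Longrightarrow> f \<in> matfuns \<Lambda>"
proof (induction rule: Cb.induct)
  case (gen x)
  show ?case unfolding E_fun_def by (rule on_nonzero_matfuns[OF sigma_carrier])
next
  case (diff x y)
  show ?case unfolding E_diff_def by (rule on_nonzero_matfuns) (simp add: Let_def)
next
  case one
  show ?case unfolding mf_one_def by (rule on_nonzero_matfuns) simp
next
  case (add f g)
  then show ?case unfolding matfuns_iff mf_add_def by (metis add_carrier_mat left_add_zero_mat zero_carrier_mat)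
next
  case (scale f c)
  have "c \<cdot>\<^sub>m 0\<^sub>m 0 0 = 0\<^sub>m 0 0" by (rule eq_matI) auto
  then show ?case using scale unfolding matfuns_iff mf_scale_def by (metis smult_carrier_mat)
next
  case (mult f g)
  have "0\<^sub>m 0 0 * 0\<^sub>m 0 0 = (0\<^sub>m 0 0 :: complex mat)" by (rule eq_matI) auto
  then show ?case using mult unfolding matfuns_iff mf_mult_def by (metis mult_carrier_mat)
next
  case (star f)
  then show ?case unfolding matfuns_iff mf_star_def by (metis mat_adjoint_carrier mat_adjoint_zero)
qed

lemma Cb_carrier:
  "f \<in> Cb \<Lambda> \<psi> ev od \<Longrightarrow> l \<in> \<Lambda> - {\<lambda>_. 0} \<Longrightarrow> f l \<in> carrier_mat (nlam l) (nlam l)"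
  using Cb_matfuns by (fastforce simp: matfuns_def)


section \<open>From Agler decompositions to completely positive kernels\<close>

text \<open>At a single point \<open>x\<close> and a combination \<open>s\<close> of the
  \<open>h i\<close>, the decomposition equates the squared norm of \<open>s\<close> minus that of
  \<open>cadjoint (\<phi> x) s\<close> with a sum of nonnegative terms, one for each index. The
  claim keeps one of these terms.\<close>

lemma agler_vector_bound:
  fixes \<phi> :: "'x \<Rightarrow> 'h::chilbert \<Rightarrow> 'h" and v :: "('i::finite \<Rightarrow> nat) \<Rightarrow> 'x \<times> 'h \<Rightarrow> 'e::chilbert"
  assumes \<psi>: "test_functions \<psi>" and \<Lambda>: "preordering_set \<Lambda>" and \<phi>: "\<And>x. bounded_clinear (\<phi> x)"
    and K: "agler_decomposition \<psi> \<Lambda> \<phi> K"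
    and v: "\<And>l p q. l \<in> \<Lambda> - {\<lambda>_. 0} \<Longrightarrow> cinner (v l q) (v l p) = K l p q"
    and l: "l \<in> \<Lambda> - {\<lambda>_. 0}"
  shows "Re (defect \<psi> l x x) * (norm (\<Sum>i\<in>F. c i *\<^sub>C v l (x, h i)))\<^sup>2 \<le> (norm (\<Sum>i\<in>F. c i *\<^sub>C h i))\<^sup>2"
proof -
  let ?w = "\<lambda>m. \<Sum>i\<in>F. c i *\<^sub>C v m (x, h i)" and ?s = "\<Sum>i\<in>F. c i *\<^sub>C h i"
  have b: "bounded_clinear (\<lambda>u. \<phi> x (cadjoint (\<phi> x) u))"
    by (intro bounded_clinear_compose[OF \<phi>] bounded_clinear_cadjoint \<phi>)
  have "(\<Sum>m\<in>\<Lambda> - {\<lambda>_. 0}. defect \<psi> m x x * cinner (?w m) (?w m))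
      = (\<Sum>m\<in>\<Lambda> - {\<lambda>_. 0}. \<Sum>i\<in>F. \<Sum>j\<in>F. cnj (c i) * c j * (defect \<psi> m x x * K m (x, h i) (x, h j)))"
    unfolding cinner_sum_sum sum_distrib_left by (intro sum.cong refl) (simp add: v mult_ac)
  also have "\<dots> = (\<Sum>i\<in>F. \<Sum>j\<in>F. \<Sum>m\<in>\<Lambda> - {\<lambda>_. 0}. cnj (c i) * c j * (defect \<psi> m x x * K m (x, h i) (x, h j)))"
    by (subst sum.swap, intro sum.cong refl sum.swap)
  also have "\<dots> = (\<Sum>i\<in>F. \<Sum>j\<in>F. cnj (c i) * c j * cinner (h j - \<phi> x (cadjoint (\<phi> x) (h j))) (h i))"
    by (intro sum.cong refl) (simp only: sum_distrib_left[symmetric] agler_decompositionD[OF K])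
  also have "\<dots> = cinner (\<Sum>j\<in>F. c j *\<^sub>C (h j - \<phi> x (cadjoint (\<phi> x) (h j)))) ?s"
    by (rule cinner_sum_sum[symmetric])
  also have "(\<Sum>j\<in>F. c j *\<^sub>C (h j - \<phi> x (cadjoint (\<phi> x) (h j)))) = ?s - \<phi> x (cadjoint (\<phi> x) ?s)"
    by (simp add: bounded_clinear_simps[OF b] scaleC_diff_right sum_subtractf)
  also have "cinner \<dots> ?s = complex_of_real ((norm ?s)\<^sup>2 - (norm (cadjoint (\<phi> x) ?s))\<^sup>2)"
    by (simp add: cinner_diff_left cinner_cadjoint[OF \<phi>, symmetric] cinner_self)
  finally have eq: "(\<Sum>m\<in>\<Lambda> - {\<lambda>_. 0}. defect \<psi> m x x * cinner (?w m) (?w m))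
      = complex_of_real ((norm ?s)\<^sup>2 - (norm (cadjoint (\<phi> x) ?s))\<^sup>2)" .
  have "Re (defect \<psi> l x x) * (norm (?w l))\<^sup>2 \<le> (\<Sum>m\<in>\<Lambda> - {\<lambda>_. 0}. Re (defect \<psi> m x x) * (norm (?w m))\<^sup>2)"
    using defect_diag(2)[OF \<psi>, of _ x] preordering_nonzero(1)[OF \<Lambda>]
    by (intro member_le_sum[OF l]) (simp_all add: less_imp_le)
  also have "\<dots> = Re (\<Sum>m\<in>\<Lambda> - {\<lambda>_. 0}. defect \<psi> m x x * cinner (?w m) (?w m))"
    by (simp add: cinner_self defect_diag(1)[OF \<psi>] flip: of_real_power)
  also have "\<dots> \<le> (norm ?s)\<^sup>2" unfolding eq Re_complex_of_real by simp
  finally show ?thesis .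
qed

text \<open>By the norm bound a linear dependency among vectors \<open>h\<close> over the same point
  is passed on to the \<open>v l (x, h)\<close>. Additivity and homogeneity are the dependencies
  among \<open>a + b, a, b\<close> and among \<open>c *\<^sub>C a, a\<close>.\<close>

lemma agler_kernel_linear:
  fixes \<phi> :: "'x \<Rightarrow> 'h::chilbert \<Rightarrow> 'h" and v :: "('i::finite \<Rightarrow> nat) \<Rightarrow> 'x \<times> 'h \<Rightarrow> 'e::chilbert"
  assumes \<psi>: "test_functions \<psi>" and \<Lambda>: "preordering_set \<Lambda>" and \<phi>: "\<And>x. bounded_clinear (\<phi> x)"
    and K: "agler_decomposition \<psi> \<Lambda> \<phi> K"
    and v: "\<And>l p q. l \<in> \<Lambda> - {\<lambda>_. 0} \<Longrightarrow> cinner (v l q) (v l p) = K l p q"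
    and l: "l \<in> \<Lambda> - {\<lambda>_. 0}"
  shows "bounded_clinear (\<lambda>h. v l (x, h))"
proof -
  let ?d = "Re (defect \<psi> l x x)"
  note bd = agler_vector_bound[OF \<psi> \<Lambda> \<phi> K v l, of x]
  have d: "0 < ?d" by (rule defect_diag(2)[OF \<psi>])
  have zero: "(\<Sum>i\<in>F. c i *\<^sub>C v l (x, h i)) = 0" if "(\<Sum>i\<in>F. c i *\<^sub>C h i) = 0" for F :: "nat set" and c h
  proof -
    have "?d * (norm (\<Sum>i\<in>F. c i *\<^sub>C v l (x, h i)))\<^sup>2 \<le> 0" using bd[of c h F] that by simp
    then show ?thesis using d by (simp add: mult_le_0_iff)
  qed
  show ?thesis
  proof (rule bounded_clinear_isometricI[where K = "sqrt (1 / ?d)"])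
    fix a b :: 'h and c
    have "v l (x, a + b) - v l (x, a) - v l (x, b) = 0"
      using zero[of "\<lambda>i. if i = 0 then 1 else -1" "\<lambda>i. if i = 0 then a + b else if i = 1 then a else b" "{0, 1, 2}"]
      by (simp add: scaleC_minus_one algebra_simps)
    then show "v l (x, a + b) = v l (x, a) + v l (x, b)" by (simp add: algebra_simps)
    have "v l (x, c *\<^sub>C a) - c *\<^sub>C v l (x, a) = 0"
      using zero[of "\<lambda>i. if i = 0 then 1 else -c" "\<lambda>i. if i = 0 then c *\<^sub>C a else a" "{0, 1}"]
      by (simp add: scaleC_minus_left)
    then show "v l (x, c *\<^sub>C a) = c *\<^sub>C v l (x, a)" by simp
    show "norm (v l (x, a)) \<le> norm a * sqrt (1 / ?d)"
    proof (rule power2_le_imp_le)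
      show "(norm (v l (x, a)))\<^sup>2 \<le> (norm a * sqrt (1 / ?d))\<^sup>2"
        using bd[of "\<lambda>_. 1" "\<lambda>_. a" "{0 :: nat}"] d by (simp add: power_mult_distrib field_simps)
    qed (use d in simp)
  qed
qed

text \<open>Each \<open>K l\<close> is multiplied by the corner entry \<open>f l $$ (0, 0)\<close>.
  This entry is a vector state of the matrix algebra, hence completely positive, and on the scalar
  matrices of \<open>E_diff\<close> it returns the scalar.\<close>

lemma cp_kernel_exists:
  fixes \<phi> :: "'x \<Rightarrow> 'h::chilbert \<Rightarrow> 'h" and \<psi> :: "'i::finite \<Rightarrow> 'x \<Rightarrow> complex"
  assumes \<psi>: "test_functions \<psi>" and \<Lambda>: "preordering_set \<Lambda>" and ord: "subset_orders \<Lambda> ev od"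
    and \<phi>: "\<And>x. bounded_clinear (\<phi> x)" and K: "agler_decomposition \<psi> \<Lambda> \<phi> K"
  shows "\<exists>\<Gamma> \<in> cp_kernels (Cb \<Lambda> \<psi> ev od). \<forall>x y.
    (\<lambda>h. h - \<phi> x (cadjoint (\<phi> y) h)) = \<Gamma> x y (E_diff \<Lambda> \<psi> ev od x y)"
proof -
  let ?L = "\<Lambda> - {\<lambda>_. 0}" and ?C = "Cb \<Lambda> \<psi> ev od"
  have psdK: "psd (K l)" if "l \<in> ?L" for l using K that by (auto simp: agler_decomposition_def)
  obtain v :: "('i \<Rightarrow> nat) \<Rightarrow> 'x \<times> 'h \<Rightarrow> ('x \<times> 'h) ell2"
    where v: "\<And>l p q. l \<in> ?L \<Longrightarrow> cinner (v l q) (v l p) = K l p q"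
    by (rule agler_decomposition_factors[OF K]) blast
  define T where "T l x h = v l (x, h)" for l x h
  have T: "bounded_clinear (T l x)" if "l \<in> ?L" for l x
    using agler_kernel_linear[OF \<psi> \<Lambda> \<phi> K v that] by (simp add: T_def[abs_def])
  define k where "k l x y h = cadjoint (T l x) (T l y h)" for l x y h
  have k: "bounded_clinear (k l x y)" if "l \<in> ?L" for l x y
    unfolding k_def by (intro bounded_clinear_compose[OF bounded_clinear_cadjoint] T that)
  have ck: "cinner (k l x y g) h = K l (x, h) (y, g)" if "l \<in> ?L" for l x y g h
    by (simp add: k_def cinner_cadjoint_left[OF T[OF that]] T_def v[OF that])
  define \<Gamma> where "\<Gamma> x y f h = (\<Sum>l\<in>?L. f l $$ (0, 0) *\<^sub>C k l x y h)" for x y and f :: "'i matfun" and h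
  have "\<Gamma> \<in> cp_kernels ?C"
    unfolding cp_kernels_def
  proof (rule CollectI, intro conjI allI ballI impI)
    fix x y f g h c assume f: "f \<in> ?C"
    show "bounded_clinear (\<Gamma> x y f)"
      unfolding \<Gamma>_def by (intro bounded_clinear_sums bounded_clinear_cmul k)
    note cf = Cb_carrier[OF f]
    have "mf_scale c f l $$ (0, 0) = c * f l $$ (0, 0)" if "l \<in> ?L" for l
      using cf[OF that] nlam_pos[of l] by (simp add: mf_scale_def)
    then show "\<Gamma> x y (mf_scale c f) h = c *\<^sub>C \<Gamma> x y f h"
      by (simp add: \<Gamma>_def scaleC_sum_right scaleC_scaleC)
    assume g: "g \<in> ?C"
    have "mf_add f g l $$ (0, 0) = f l $$ (0, 0) + g l $$ (0, 0)" if "l \<in> ?L" for l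
      using cf[OF that] Cb_carrier[OF g that] nlam_pos[of l] by (simp add: mf_add_def)
    then show "\<Gamma> x y (mf_add f g) h = \<Gamma> x y f h + \<Gamma> x y g h"
      by (simp add: \<Gamma>_def scaleC_add_left sum.distrib)
  next
    fix n and x :: "nat \<Rightarrow> 'x" and a :: "nat \<Rightarrow> 'i matfun" and h :: "nat \<Rightarrow> 'h"
    assume a: "\<forall>i<n. a i \<in> ?C"
    \<comment> \<open>The corner of the product is a sum over first row entries, so the form splits
      into forms of \<open>K l\<close> whose coefficients are the conjugates of these
      entries.\<close>
    have "mf_mult (a i) (mf_star (a j)) l $$ (0, 0) = (\<Sum>r<nlam l. a i l $$ (0, r) * cnj (a j l $$ (0, r)))"
      if "l \<in> ?L" "i < n" "j < n" for i j l
      unfolding mf_mult_def mf_star_def using a that nlam_pos[of l]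
      by (intro mult_adjoint_index_sum) (auto intro!: Cb_carrier)
    then have "(\<Sum>i<n. \<Sum>j<n. cinner (\<Gamma> (x i) (x j) (mf_mult (a i) (mf_star (a j))) (h j)) (h i))
      = (\<Sum>i<n. \<Sum>j<n. \<Sum>l\<in>?L. \<Sum>r<nlam l. a i l $$ (0, r) * cnj (a j l $$ (0, r)) * K l (x i, h i) (x j, h j))"
      unfolding \<Gamma>_def cinner_sum_left
      by (intro sum.cong refl) (simp add: cinner_scaleC_left ck sum_distrib_right)
    also have "\<dots> = (\<Sum>l\<in>?L. \<Sum>r<nlam l. \<Sum>i<n. \<Sum>j<n. a i l $$ (0, r) * cnj (a j l $$ (0, r)) * K l (x i, h i) (x j, h j))"
      by (rule sum_swap_pairs)
    also have "\<dots> \<in> \<real>\<^sub>\<ge>\<^sub>0"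
    proof (rule sum_nonneg_Reals, rule sum_nonneg_Reals)
      fix l r assume "l \<in> ?L"
      from psdD[OF psdK[OF this] finite_lessThan[of n], of "\<lambda>i. cnj (a i l $$ (0, r))" "\<lambda>i. (x i, h i)"]
      show "(\<Sum>i<n. \<Sum>j<n. a i l $$ (0, r) * cnj (a j l $$ (0, r)) * K l (x i, h i) (x j, h j)) \<in> \<real>\<^sub>\<ge>\<^sub>0"
        by simp
    qed
    finally show "(\<Sum>i<n. \<Sum>j<n. cinner (\<Gamma> (x i) (x j) (mf_mult (a i) (mf_star (a j))) (h j)) (h i)) \<in> \<real>\<^sub>\<ge>\<^sub>0" .
  qed
  moreover have "h - \<phi> x (cadjoint (\<phi> y) h) = \<Gamma> x y (E_diff \<Lambda> \<psi> ev od x y) h" for x y h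
  proof (rule cinner_eqI)
    fix u
    have "E_diff \<Lambda> \<psi> ev od x y l $$ (0, 0) = defect \<psi> l x y" if "l \<in> ?L" for l
      using that nlam_pos[of l] by (simp add: E_diff_scalar[OF ord] scalar_matfun_def on_nonzero_def)
    then have "cinner (\<Gamma> x y (E_diff \<Lambda> \<psi> ev od x y) h) u = (\<Sum>l\<in>?L. defect \<psi> l x y * K l (x, u) (y, h))"
      unfolding \<Gamma>_def cinner_sum_left by (intro sum.cong refl) (simp add: cinner_scaleC_left ck)
    also have "\<dots> = cinner (h - \<phi> x (cadjoint (\<phi> y) h)) u"
      by (rule agler_decompositionD[OF K, symmetric])
    finally show "cinner (h - \<phi> x (cadjoint (\<phi> y) h)) u = cinner (\<Gamma> x y (E_diff \<Lambda> \<psi> ev od x y) h) u" by simp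
  qed
  ultimately show ?thesis by (intro bexI[of _ \<Gamma>]) auto
qed


section \<open>From completely positive kernels to the unit ball\<close>

text \<open>The algebra need not contain the projections onto the single summands: indices with the same
  defect function cannot be told apart. Lagrange interpolation gives the projections onto the classes.\<close>

lemma Cb_class_projection:
  assumes \<Lambda>: "preordering_set \<Lambda>" and ord: "subset_orders \<Lambda> ev od"
  shows "scalar_matfun \<Lambda> (\<lambda>m. if \<forall>x y. defect \<psi> m x y = defect \<psi> l x y then 1 else 0) \<in> Cb \<Lambda> \<psi> ev od"
proof -
  let ?same = "\<lambda>m. \<forall>x y. defect \<psi> m x y = defect \<psi> l x y" and ?C = "Cb \<Lambda> \<psi> ev od"
  define B where "B = {m \<in> \<Lambda> - {\<lambda>_. 0}. \<not> ?same m}"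
  have B: "finite B" using preordering_nonzero(1)[OF \<Lambda>] by (simp add: B_def)
  have "\<forall>m. \<exists>z. m \<in> B \<longrightarrow> defect \<psi> m (fst z) (snd z) \<noteq> defect \<psi> l (fst z) (snd z)"
    by (auto simp: B_def)
  from choice[OF this] obtain z where
    z: "\<And>m. m \<in> B \<Longrightarrow> defect \<psi> m (fst (z m)) (snd (z m)) \<noteq> defect \<psi> l (fst (z m)) (snd (z m))" by blast
  define D where "D m m' = defect \<psi> m' (fst (z m)) (snd (z m))" for m m'
  \<comment> \<open>A Lagrange factor: affine in the defect at the separating pair
    \<open>z m\<close>, equal to \<open>1\<close> on the class of \<open>l\<close> and to
    \<open>0\<close> at \<open>m\<close>.\<close>
  define g where "g m m' = (D m m' - D m m) / (D m l - D m m)" for m m'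
  have const: "scalar_matfun \<Lambda> (\<lambda>_. c) \<in> ?C" for c
    using Cb.scale[OF Cb.one, of c \<Lambda> \<psi> ev od] by (simp add: scalar_matfun_one scalar_matfun_scale)
  have g: "scalar_matfun \<Lambda> (g m) \<in> ?C" for m
  proof -
    have "scalar_matfun \<Lambda> (D m) \<in> ?C"
      using Cb.diff[of \<Lambda> \<psi> ev od "fst (z m)" "snd (z m)"] by (simp add: E_diff_scalar[OF ord] D_def[abs_def])
    from Cb.scale[OF Cb.add[OF this const], of "1 / (D m l - D m m)" "- D m m"]
    show ?thesis by (simp add: scalar_matfun_add scalar_matfun_scale g_def[abs_def])
  qed
  have "scalar_matfun \<Lambda> (\<lambda>m'. \<Prod>m\<in>A. g m m') \<in> ?C" if "finite A" for A
    using that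
  proof (induction A)
    case (insert m A)
    from Cb.mult[OF g[of m] insert.IH] show ?case using insert.hyps by (simp add: scalar_matfun_mult)
  qed (simp add: const)
  from this[OF B] have "scalar_matfun \<Lambda> (\<lambda>m'. \<Prod>m\<in>B. g m m') \<in> ?C" .
  also have "scalar_matfun \<Lambda> (\<lambda>m'. \<Prod>m\<in>B. g m m') = scalar_matfun \<Lambda> (\<lambda>m. if ?same m then 1 else 0)"
  proof (rule scalar_matfun_cong)
    fix m' assume m': "m' \<in> \<Lambda> - {\<lambda>_. 0}"
    show "(\<Prod>m\<in>B. g m m') = (if ?same m' then 1 else 0)"
    proof (cases "?same m'")
      case True
      have "g m m' = 1" if "m \<in> B" for m using z[OF that] True by (simp add: g_def D_def)
      then show ?thesis using True by simp
    next
      case False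
      then have "m' \<in> B" "g m' m' = 0" using m' by (auto simp: B_def g_def)
      then show ?thesis using B False by (auto intro: prod_zero)
    qed
  qed
  finally show ?thesis .
qed

text \<open>The class projections split \<open>\<Gamma>\<close> at \<open>E_diff\<close> into
  positive kernels \<open>k l\<close> with the defects as scalar coefficients. After tensoring with
  an admissible \<open>j\<close> the defect is moved over to \<open>j\<close>, where admissibility
  makes the product positive, and a Schur product with \<open>k l\<close> remains.\<close>

lemma Hinf_bound_of_cp_kernel:
  fixes \<phi> :: "'x \<Rightarrow> 'h::chilbert \<Rightarrow> 'h" and \<psi> :: "'i::finite \<Rightarrow> 'x \<Rightarrow> complex"
  assumes \<Lambda>: "preordering_set \<Lambda>" and ord: "subset_orders \<Lambda> ev od"
    and \<phi>: "\<And>x. bounded_clinear (\<phi> x)" and \<Gamma>: "\<Gamma> \<in> cp_kernels (Cb \<Lambda> \<psi> ev od)"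
    and eq: "\<And>x y. (\<lambda>h. h - \<phi> x (cadjoint (\<phi> y) h)) = \<Gamma> x y (E_diff \<Lambda> \<psi> ev od x y)"
  shows "Hinf_bound \<psi> \<Lambda> \<phi> 1"
proof -
  let ?L = "\<Lambda> - {\<lambda>_. 0}" and ?C = "Cb \<Lambda> \<psi> ev od" and ?S = "scalar_matfun \<Lambda>"
  have L: "finite ?L" by (rule preordering_nonzero(1)[OF \<Lambda>])
  have G_lin: "bounded_clinear (\<Gamma> x y a)" "\<Gamma> x y (mf_scale c a) h = c *\<^sub>C \<Gamma> x y a h" if "a \<in> ?C" for x y a c h
    using \<Gamma> that by (auto simp: cp_kernels_def)
  have cp: "\<forall>(n :: nat) x a h. (\<forall>i<n. a i \<in> ?C) \<longrightarrow>
      (\<Sum>i<n. \<Sum>j<n. cinner (\<Gamma> (x i) (x j) (mf_mult (a i) (mf_star (a j))) (h j)) (h i)) \<in> \<real>\<^sub>\<ge>\<^sub>0"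
    using \<Gamma> by (simp add: cp_kernels_def)
  have G_add: "\<Gamma> x y (mf_add a b) h = \<Gamma> x y a h + \<Gamma> x y b h" if "a \<in> ?C" "b \<in> ?C" for x y a b h
    using \<Gamma> that by (auto simp: cp_kernels_def)
  \<comment> \<open>Membership is carried along in the induction because additivity of
    \<open>\<Gamma>\<close> is available on the algebra only.\<close>
  have G_sum: "?S (\<lambda>m. \<Sum>l\<in>A. d l * g l m) \<in> ?C \<and>
      \<Gamma> x y (?S (\<lambda>m. \<Sum>l\<in>A. d l * g l m)) h = (\<Sum>l\<in>A. d l *\<^sub>C \<Gamma> x y (?S (g l)) h)"
    if "finite A" and g: "\<And>l. ?S (g l) \<in> ?C" for A d x y h and g :: "('i \<Rightarrow> nat) \<Rightarrow> ('i \<Rightarrow> nat) \<Rightarrow> complex"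
    using that(1)
  proof (induction A)
    case empty
    show ?case
      using Cb.scale[OF Cb.one, of 0 \<Lambda> \<psi> ev od] G_lin(2)[OF Cb.one, of x y 0 h]
      by (simp add: scalar_matfun_one scalar_matfun_scale)
  next
    case (insert l A)
    from G_add[OF Cb.scale[OF g[of l], of "d l"], of "?S (\<lambda>m. \<Sum>l\<in>A. d l * g l m)"]
      Cb.add[OF Cb.scale[OF g[of l], of "d l"], of "?S (\<lambda>m. \<Sum>l\<in>A. d l * g l m)"]
    show ?case using insert G_lin(2)[OF g] by (simp add: scalar_matfun_scale scalar_matfun_add)
  qed
  define same where "same l m \<longleftrightarrow> (\<forall>x y. defect \<psi> m x y = defect \<psi> l x y)" for l m
  define e where "e l m = (if same l m then 1 else 0 :: complex)" for l m
  have e: "?S (e l) \<in> ?C" for l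
    using Cb_class_projection[OF \<Lambda> ord, of \<psi> l] by (simp add: e_def[abs_def] same_def)
  \<comment> \<open>In a sum over all \<open>l\<close> every class occurs once for each of its
    members; the weight compensates for that.\<close>
  define w where "w l = 1 / real (card {m\<in>?L. same l m})" for l
  define k where "k l x y = \<Gamma> x y (?S (e l))" for l x y
  have k: "bounded_clinear (k l x y)" for l x y unfolding k_def by (rule G_lin(1)[OF e])
  have "positive_kernel (k l)" for l
    unfolding positive_kernel_on_def
  proof (intro allI impI)
    fix n :: nat and x :: "nat \<Rightarrow> 'x" and h :: "nat \<Rightarrow> 'h"
    \<comment> \<open>The class projection is a self-adjoint idempotent, so complete positivity for
      this constant family says that \<open>k l\<close> is a positive kernel.\<close>
    have "mf_mult (?S (e l)) (mf_star (?S (e l))) = ?S (e l)"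
      by (simp add: scalar_matfun_star scalar_matfun_mult) (rule scalar_matfun_cong, simp add: e_def)
    then show "(\<Sum>i<n. \<Sum>j<n. cinner (k l (x i) (x j) (h j)) (h i)) \<in> \<real>\<^sub>\<ge>\<^sub>0"
      using cp[rule_format, of n "\<lambda>_. ?S (e l)" x h] e[of l] by (simp add: k_def)
  qed
  then have psdk: "psd (\<lambda>p q. cinner (k l (fst p) (fst q) (snd q)) (snd p))" for l
    using positive_kernel_iff_psd[of "k l"] k by blast
  have "defect \<psi> m x y = (\<Sum>l\<in>?L. (complex_of_real (w l) * defect \<psi> l x y) * e l m)" if m: "m \<in> ?L" for m x y
  proof -
    let ?c = "{l\<in>?L. same m l}"
    have c: "finite ?c" "m \<in> ?c" using L m by (auto simp: same_def)
    have same: "same l m \<longleftrightarrow> l \<in> ?c" "l \<in> ?c \<Longrightarrow> {m\<in>?L. same l m} = ?c" if "l \<in> ?L" for l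
      using that by (auto simp: same_def)
    have "(\<Sum>l\<in>?L. (complex_of_real (w l) * defect \<psi> l x y) * e l m)
        = (\<Sum>l\<in>?L. if l \<in> ?c then complex_of_real (1 / real (card ?c)) * defect \<psi> m x y else 0)"
    proof (intro sum.cong refl)
      fix l assume l: "l \<in> ?L"
      show "(complex_of_real (w l) * defect \<psi> l x y) * e l m
          = (if l \<in> ?c then complex_of_real (1 / real (card ?c)) * defect \<psi> m x y else 0)"
      proof (cases "l \<in> ?c")
        case True
        then have "defect \<psi> l x y = defect \<psi> m x y" by (auto simp: same_def)
        then show ?thesis using same[OF l] True by (simp only: w_def e_def if_True mult_1_right)
      next
        case False
        then have "\<not> same l m" using same(1)[OF l] by simp
        then show ?thesis using False by (simp only: e_def if_False mult_zero_right)
      qed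
    qed
    also have "\<dots> = of_nat (card ?c) * (complex_of_real (1 / real (card ?c)) * defect \<psi> m x y)"
    proof -
      have "?L \<inter> ?c = ?c" by blast
      then show ?thesis by (subst sum.inter_restrict[OF L, symmetric]) simp
    qed
    also have "\<dots> = defect \<psi> m x y"
    proof -
      have "card ?c \<noteq> 0" using c by (metis card_0_eq empty_iff)
      then show ?thesis by simp
    qed
    finally show ?thesis by simp
  qed
  then have "E_diff \<Lambda> \<psi> ev od x y = ?S (\<lambda>m. \<Sum>l\<in>?L. (complex_of_real (w l) * defect \<psi> l x y) * e l m)" for x y
    unfolding E_diff_scalar[OF ord] by (rule scalar_matfun_cong)
  then have N: "h - \<phi> x (cadjoint (\<phi> y) h) = (\<Sum>l\<in>?L. (complex_of_real (w l) * defect \<psi> l x y) *\<^sub>C k l x y h)" for x y h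
    using fun_cong[OF eq[of x y], of h]
      G_sum[OF L, of e, OF e, where d = "\<lambda>l. complex_of_real (w l) * defect \<psi> l x y" and x = x and y = y and h = h] by (simp add: k_def)
  show ?thesis
    unfolding Hinf_bound_def
  proof (intro conjI allI impI)
    fix j :: "'x \<Rightarrow> 'x \<Rightarrow> 'h \<Rightarrow> 'h" assume j: "j \<in> adm_kernels \<psi> \<Lambda>"
    have bj: "bounded_clinear (j x y)" for x y using j by (simp add: adm_kernels_def)
    have psdj: "psd (\<lambda>p q. defect \<psi> l (fst p) (fst q) * cinner (j (fst p) (fst q) (snd q)) (snd p))" if "l \<in> ?L" for l
    proof -
      have "positive_kernel (\<lambda>x y h. defect \<psi> l x y *\<^sub>C j x y h)"
        using j that by (simp add: adm_kernels_def defect_def)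
      then show ?thesis
        by (subst (asm) positive_kernel_iff_psd) (auto intro: bounded_clinear_cmul bj simp: cinner_scaleC_left)
    qed
    have bN: "bounded_clinear (\<lambda>h. 1\<^sup>2 *\<^sub>R h - \<phi> x (cadjoint (\<phi> y) h))" for x y
      by (intro bounded_clinear_intros bounded_clinear_compose[OF \<phi>] bounded_clinear_cadjoint \<phi>)
    have "psd (\<lambda>r s. \<Sum>l\<in>?L. complex_of_real (w l) *
        (cinner (k l (fst r) (fst s) (fst (snd s))) (fst (snd r)) *
        (defect \<psi> l (fst r) (fst s) * cinner (j (fst r) (fst s) (snd (snd s))) (snd (snd r)))))"
    proof (rule psd_sum, rule psd_scale[OF psd_Schur_product])
      fix l assume l: "l \<in> ?L"
      show "0 \<le> w l" by (simp add: w_def)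
      show "psd (\<lambda>(r :: 'x \<times> 'h \<times> 'h) s. cinner (k l (fst r) (fst s) (fst (snd s))) (fst (snd r)))"
        using psd_compose[OF psdk, of l "\<lambda>r. (fst r, fst (snd r))"] by simp
      show "psd (\<lambda>(r :: 'x \<times> 'h \<times> 'h) s. defect \<psi> l (fst r) (fst s) * cinner (j (fst r) (fst s) (snd (snd s))) (snd (snd r)))"
        using psd_compose[OF psdj[OF l], of "\<lambda>r. (fst r, snd (snd r))"] by simp
    qed
    also have "(\<lambda>r s. \<Sum>l\<in>?L. complex_of_real (w l) *
        (cinner (k l (fst r) (fst s) (fst (snd s))) (fst (snd r)) *
        (defect \<psi> l (fst r) (fst s) * cinner (j (fst r) (fst s) (snd (snd s))) (snd (snd r)))))
      = (\<lambda>(x, a, b) (y, a', b'). cinner (1\<^sup>2 *\<^sub>R a' - \<phi> x (cadjoint (\<phi> y) a')) a * cinner (j x y b') b)"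
      by (simp add: fun_eq_iff N cinner_sum_left cinner_scaleC_left sum_distrib_left sum_distrib_right mult_ac)
    finally show "positive_kernel_on tensor_space
        (\<lambda>x y. op_tensor (\<lambda>h. 1\<^sup>2 *\<^sub>R h - \<phi> x (cadjoint (\<phi> y) h)) (j x y))"
      by (rule positive_kernel_on_tensor_space[OF bN bj])
  qed simp
qed

section \<open>Coordinate isometries\<close>

text \<open>An injection of index sets induces an isometry of sequence spaces, with adjoint
  \<open>coord_pull\<close>. In this way orthogonality of subspaces of the fixed state space becomes
  disjointness of sets of indices.\<close>

definition coord_embed :: "('a \<Rightarrow> 'b) \<Rightarrow> 'a ell2 \<Rightarrow> 'b ell2" where
  "coord_embed f u = Abs_ell2 (\<lambda>b. if b \<in> range f then Rep_ell2 u (inv_into UNIV f b) else 0)"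

definition coord_pull :: "('a \<Rightarrow> 'b) \<Rightarrow> 'b ell2 \<Rightarrow> 'a ell2" where
  "coord_pull f v = Abs_ell2 (\<lambda>a. Rep_ell2 v (f a))"

lemma Rep_coord_embed:
  assumes "inj f"
  shows "Rep_ell2 (coord_embed f u) = (\<lambda>b. if b \<in> range f then Rep_ell2 u (inv_into UNIV f b) else 0)"
  unfolding coord_embed_def
proof (rule Abs_ell2_inverse, rule CollectI)
  have "(\<lambda>b. (cmod (Rep_ell2 u (inv_into UNIV f b)))\<^sup>2) summable_on range f"
    by (subst summable_on_reindex[OF assms]) (simp add: o_def inv_f_f[OF assms] ell2_sq_summable)
  then show "(\<lambda>b. (cmod (if b \<in> range f then Rep_ell2 u (inv_into UNIV f b) else 0))\<^sup>2) summable_on UNIV"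
    by (rule summable_on_cong_neutral[THEN iffD1, rotated 3]) auto
qed

lemma Rep_coord_pull:
  assumes "inj f"
  shows "Rep_ell2 (coord_pull f v) = (\<lambda>a. Rep_ell2 v (f a))"
  unfolding coord_pull_def
proof (rule Abs_ell2_inverse, rule CollectI)
  have "(\<lambda>b. (cmod (Rep_ell2 v b))\<^sup>2) summable_on range f"
    by (rule summable_on_subset_banach[OF ell2_sq_summable]) simp
  then show "(\<lambda>a. (cmod (Rep_ell2 v (f a)))\<^sup>2) summable_on UNIV"
    by (subst (asm) summable_on_reindex[OF assms]) (simp add: o_def)
qed

lemma cinner_coord_embed:
  assumes "inj f"
  shows "cinner (coord_embed f u) v = cinner u (coord_pull f v)"
proof -
  have "cinner (coord_embed f u) v = (\<Sum>\<^sub>\<infinity>b\<in>range f. Rep_ell2 u (inv_into UNIV f b) * cnj (Rep_ell2 v b))"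
    unfolding cinner_ell2_def Rep_coord_embed[OF assms] by (rule infsum_cong_neutral) auto
  also have "\<dots> = cinner u (coord_pull f v)"
    unfolding cinner_ell2_def Rep_coord_pull[OF assms]
    by (subst infsum_reindex[OF assms]) (simp add: o_def inv_f_f[OF assms])
  finally show ?thesis .
qed

lemma coord_pull_embed: "inj f \<Longrightarrow> coord_pull f (coord_embed f u) = u"
  by (rule Rep_ell2_inject[THEN iffD1]) (simp add: Rep_coord_pull Rep_coord_embed inv_f_f fun_eq_iff)

lemma coord_pull_embed_disjoint:
  "inj f \<Longrightarrow> inj g \<Longrightarrow> range f \<inter> range g = {} \<Longrightarrow> coord_pull g (coord_embed f u) = 0"
  by (rule Rep_ell2_inject[THEN iffD1])
    (auto simp: Rep_coord_pull Rep_coord_embed zero_ell2.rep_eq fun_eq_iff)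

text \<open>An everywhere defined formal adjoint forces additivity and homogeneity.\<close>

lemma bounded_clinear_of_adjoint:
  fixes T :: "'a::chilbert \<Rightarrow> 'b::chilbert"
  assumes adj: "\<And>x y. cinner (T x) y = cinner x (S y)" and bd: "\<And>x. norm (T x) \<le> norm x"
  shows "bounded_clinear T"
proof (rule bounded_clinear_isometricI[where K = 1])
  show "T (x + y) = T x + T y" for x y
    by (rule cinner_eqI) (simp add: adj cinner_add_left)
  show "T (c *\<^sub>C x) = c *\<^sub>C T x" for c x
    by (rule cinner_eqI) (simp add: adj cinner_scaleC_left)
  show "norm (T x) \<le> norm x * 1" for x using bd by simp
qed

lemma norm_le_of_cinner:
  assumes "cinner x x = cinner z (y :: 'a::chilbert)" "norm z \<le> norm (x :: 'b::chilbert)"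
  shows "norm x \<le> norm y"
proof -
  have "(norm x)\<^sup>2 = cmod (cinner z y)"
    by (metis assms(1) abs_power2 cinner_self norm_of_real)
  also have "\<dots> \<le> norm z * norm y" by (rule cinner_Cauchy_Schwarz)
  also have "\<dots> \<le> norm x * norm y" using assms(2) by (rule mult_right_mono) simp
  finally show ?thesis by (cases "x = 0") (auto simp: power2_eq_square)
qed

lemma norm_coord_embed:
  assumes "inj f" shows "norm (coord_embed f u) = norm u"
proof -
  have "cinner (coord_embed f u) (coord_embed f u) = cinner u u"
    by (simp add: cinner_coord_embed[OF assms] coord_pull_embed[OF assms])
  then have "(norm (coord_embed f u))\<^sup>2 = (norm u)\<^sup>2" unfolding cinner_self by (simp only: of_real_eq_iff)
  then show ?thesis by (simp add: power2_eq_iff_nonneg)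
qed

lemma bounded_clinear_coord_embed: "inj f \<Longrightarrow> bounded_clinear (coord_embed f)"
  by (rule bounded_clinear_of_adjoint[OF cinner_coord_embed]) (simp_all add: norm_coord_embed)

lemma cinner_coord_pull:
  assumes "inj f" shows "cinner (coord_pull f v) u = cinner v (coord_embed f u)"
  by (metis assms cinner_commute cinner_coord_embed)

lemma bounded_clinear_coord_pull: "inj f \<Longrightarrow> bounded_clinear (coord_pull f)"
  by (rule bounded_clinear_of_adjoint[OF cinner_coord_pull])
    (auto intro: norm_le_of_cinner[of _ "coord_embed f (coord_pull f _)"]
      simp: norm_coord_embed cinner_coord_embed)

lemma coord_embed_compose:
  assumes "inj f" "inj g" shows "coord_embed g (coord_embed f u) = coord_embed (g \<circ> f) u"
proof (rule cinner_eqI)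
  fix z
  have "coord_pull f (coord_pull g z) = coord_pull (g \<circ> f) z"
    by (rule Rep_ell2_inject[THEN iffD1]) (simp add: Rep_coord_pull assms inj_compose)
  then show "cinner (coord_embed g (coord_embed f u)) z = cinner (coord_embed (g \<circ> f) u) z"
    by (simp add: cinner_coord_embed assms inj_compose)
qed

lemma Rep_ell2_sum: "Rep_ell2 (\<Sum>k\<in>A. u k) i = (\<Sum>k\<in>A. Rep_ell2 (u k) i)"
  by (induction A rule: infinite_finite_induct) (auto simp: zero_ell2.rep_eq plus_ell2.rep_eq)

text \<open>The ranges of the \<open>f k\<close> partition the index set, so exactly one summand
  sees a given coordinate.\<close>

lemma coord_resolution:
  assumes T: "finite T" and inj: "\<And>k. k \<in> T \<Longrightarrow> inj (f k)"
    and disj: "\<And>k k' a a'. k \<in> T \<Longrightarrow> k' \<in> T \<Longrightarrow> f k a = f k' a' \<Longrightarrow> k = k'"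
    and cover: "\<And>b. \<exists>k\<in>T. b \<in> range (f k)"
  shows "(\<Sum>k\<in>T. coord_embed (f k) (coord_pull (f k) u)) = u"
proof (rule Rep_ell2_inject[THEN iffD1], rule ext)
  fix b
  obtain k0 a where k0: "k0 \<in> T" "b = f k0 a" using cover by blast
  have "Rep_ell2 (\<Sum>k\<in>T. coord_embed (f k) (coord_pull (f k) u)) b = (\<Sum>k\<in>T. if k = k0 then Rep_ell2 u b else 0)"
    unfolding Rep_ell2_sum
  proof (intro sum.cong refl)
    fix k assume k: "k \<in> T"
    show "Rep_ell2 (coord_embed (f k) (coord_pull (f k) u)) b = (if k = k0 then Rep_ell2 u b else 0)"
    proof (cases "k = k0")
      case False
      have "b \<notin> range (f k)"
      proof
        assume "b \<in> range (f k)"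
        then obtain a' where "b = f k a'" by blast
        then have "k = k0" using disj[OF k k0(1), of a' a] k0(2) by simp
        then show False using False by simp
      qed
      then show ?thesis using False by (simp add: Rep_coord_embed[OF inj[OF k]])
    qed (use k0(2) inj[OF k] in \<open>simp add: Rep_coord_embed Rep_coord_pull inv_f_f\<close>)
  qed
  then show "Rep_ell2 (\<Sum>k\<in>T. coord_embed (f k) (coord_pull (f k) u)) b = Rep_ell2 u b"
    using T k0(1) by simp
qed


section \<open>Representations in diagonal form\<close>

text \<open>A finite family of isometries \<open>U l i\<close> of the state space whose ranges decompose it
  orthogonally, as in the Cuntz relations. The copies \<open>i < n l\<close> with the same \<open>l\<close> play
  the role of the standard basis vectors in \<open>ran P\<^sub>l \<otimes> \<complex>\<^bsup>n\<^esup>\<close>.\<close>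

locale isometry_family =
  fixes L :: "'l set" and n :: "'l \<Rightarrow> nat" and U Us :: "'l \<Rightarrow> nat \<Rightarrow> 'e::chilbert \<Rightarrow> 'e"
  assumes L: "finite L"
    and U: "l \<in> L \<Longrightarrow> i < n l \<Longrightarrow> bounded_clinear (U l i)"
    and Us: "l \<in> L \<Longrightarrow> i < n l \<Longrightarrow> bounded_clinear (Us l i)"
    and adj: "l \<in> L \<Longrightarrow> i < n l \<Longrightarrow> cinner (U l i u) v = cinner u (Us l i v)"
    and iso: "l \<in> L \<Longrightarrow> i < n l \<Longrightarrow> m \<in> L \<Longrightarrow> j < n m \<Longrightarrow> Us l i (U m j u) = (if l = m \<and> i = j then u else 0)"
    and resolution: "(\<Sum>l\<in>L. \<Sum>i<n l. U l i (Us l i u)) = u"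
begin

lemma adj_left: "l \<in> L \<Longrightarrow> i < n l \<Longrightarrow> cinner (Us l i u) v = cinner u (U l i v)"
  by (metis adj cinner_commute)

lemma component_sum:
  assumes "l \<in> L" "i < n l"
  shows "Us l i (\<Sum>m\<in>L. \<Sum>j<n m. U m j (w m j)) = w l i"
proof -
  have "Us l i (\<Sum>m\<in>L. \<Sum>j<n m. U m j (w m j)) = (\<Sum>m\<in>L. \<Sum>j<n m. if l = m \<and> i = j then w m j else 0)"
    unfolding bounded_clinear_sum[OF Us[OF assms]] by (intro sum.cong refl) (simp add: iso assms)
  also have "\<dots> = (\<Sum>m\<in>L. if m = l then w l i else 0)"
    by (intro sum.cong refl) (use assms in \<open>auto intro: sum.neutral simp: if_distrib cong: if_cong\<close>)
  also have "\<dots> = w l i" using L assms(1) by simp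
  finally show ?thesis .
qed

lemma component_eqI:
  assumes "\<And>l i. l \<in> L \<Longrightarrow> i < n l \<Longrightarrow> Us l i u = Us l i v"
  shows "u = v"
proof -
  have "(\<Sum>l\<in>L. \<Sum>i<n l. U l i (Us l i u)) = (\<Sum>l\<in>L. \<Sum>i<n l. U l i (Us l i v))"
    by (intro sum.cong refl) (simp add: assms)
  then show ?thesis by (simp only: resolution)
qed

lemma cinner_components: "cinner u v = (\<Sum>l\<in>L. \<Sum>i<n l. cinner (Us l i u) (Us l i v))"
proof -
  have "cinner u v = cinner (\<Sum>l\<in>L. \<Sum>i<n l. U l i (Us l i u)) v" by (simp only: resolution)
  also have "\<dots> = (\<Sum>l\<in>L. \<Sum>i<n l. cinner (Us l i u) (Us l i v))"
    unfolding cinner_sum_left by (intro sum.cong refl) (simp add: adj)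
  finally show ?thesis .
qed

lemma norm_components: "(norm u)\<^sup>2 = (\<Sum>l\<in>L. \<Sum>i<n l. (norm (Us l i u))\<^sup>2)"
proof -
  have "complex_of_real ((norm u)\<^sup>2) = complex_of_real (\<Sum>l\<in>L. \<Sum>i<n l. (norm (Us l i u))\<^sup>2)"
    unfolding cinner_self[symmetric] of_real_sum by (rule cinner_components)
  then show ?thesis by (simp only: of_real_eq_iff)
qed

text \<open>With the components \<open>Us l j u\<close> arranged as a column, this is multiplication
  by the matrix \<open>f l\<close> in each block, that is
  \<open>\<Sum>\<lambda>. P\<^sub>\<lambda> \<otimes> f(\<lambda>)\<close>.\<close>

definition rep :: "('l \<Rightarrow> complex mat) \<Rightarrow> 'e \<Rightarrow> 'e" where
  "rep f u = (\<Sum>l\<in>L. \<Sum>i<n l. U l i (\<Sum>j<n l. f l $$ (i, j) *\<^sub>C Us l j u))"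

lemma component_rep: "l \<in> L \<Longrightarrow> i < n l \<Longrightarrow> Us l i (rep f u) = (\<Sum>j<n l. f l $$ (i, j) *\<^sub>C Us l j u)"
  unfolding rep_def by (rule component_sum)

lemma bounded_clinear_rep: "bounded_clinear (rep f)"
  unfolding rep_def
  by (intro bounded_clinear_sums bounded_clinear_compose[OF U] bounded_clinear_cmul Us) auto

lemma rep_add:
  assumes "\<And>l. l \<in> L \<Longrightarrow> f l \<in> carrier_mat (n l) (n l)" "\<And>l. l \<in> L \<Longrightarrow> g l \<in> carrier_mat (n l) (n l)"
  shows "rep (\<lambda>l. f l + g l) u = rep f u + rep g u"
proof (rule component_eqI)
  fix l i assume l: "l \<in> L" "i < n l"
  have "(f l + g l) $$ (i, j) = f l $$ (i, j) + g l $$ (i, j)" if "j < n l" for j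
    using assms[OF l(1)] l(2) that by simp
  then show "Us l i (rep (\<lambda>l. f l + g l) u) = Us l i (rep f u + rep g u)"
    by (simp add: bounded_clinear_add[OF Us[OF l]] component_rep[OF l] scaleC_add_left sum.distrib)
qed

lemma rep_scale:
  assumes "\<And>l. l \<in> L \<Longrightarrow> f l \<in> carrier_mat (n l) (n l)"
  shows "rep (\<lambda>l. c \<cdot>\<^sub>m f l) u = c *\<^sub>C rep f u"
proof (rule component_eqI)
  fix l i assume l: "l \<in> L" "i < n l"
  have "(c \<cdot>\<^sub>m f l) $$ (i, j) = c * f l $$ (i, j)" if "j < n l" for j
    using assms[OF l(1)] l(2) that by simp
  then show "Us l i (rep (\<lambda>l. c \<cdot>\<^sub>m f l) u) = Us l i (c *\<^sub>C rep f u)"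
    by (simp add: bounded_clinear_scaleC[OF Us[OF l]] component_rep[OF l] scaleC_sum_right scaleC_scaleC)
qed

lemma rep_mult:
  assumes "\<And>l. l \<in> L \<Longrightarrow> f l \<in> carrier_mat (n l) (n l)" "\<And>l. l \<in> L \<Longrightarrow> g l \<in> carrier_mat (n l) (n l)"
  shows "rep (\<lambda>l. f l * g l) u = rep f (rep g u)"
proof (rule component_eqI)
  fix l i assume l: "l \<in> L" "i < n l"
  have "Us l i (rep (\<lambda>l. f l * g l) u) = (\<Sum>j<n l. (\<Sum>k<n l. f l $$ (i, k) * g l $$ (k, j)) *\<^sub>C Us l j u)"
    unfolding component_rep[OF l]
    by (intro sum.cong refl) (simp add: mult_index_sum[OF assms[OF l(1)] l(2)])
  also have "\<dots> = (\<Sum>k<n l. f l $$ (i, k) *\<^sub>C (\<Sum>j<n l. g l $$ (k, j) *\<^sub>C Us l j u))"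
    unfolding scaleC_sum_left scaleC_sum_right by (subst sum.swap) (simp add: scaleC_scaleC)
  also have "\<dots> = Us l i (rep f (rep g u))"
    unfolding component_rep[OF l] by (intro sum.cong refl) (simp add: component_rep[OF l(1)])
  finally show "Us l i (rep (\<lambda>l. f l * g l) u) = Us l i (rep f (rep g u))" .
qed

lemma cinner_rep: "cinner (rep f u) v = (\<Sum>l\<in>L. \<Sum>j<n l. cinner (Us l j u) (\<Sum>i<n l. cnj (f l $$ (i, j)) *\<^sub>C Us l i v))"
proof -
  have "cinner (rep f u) v = (\<Sum>l\<in>L. \<Sum>i<n l. \<Sum>j<n l. f l $$ (i, j) * cinner (Us l j u) (Us l i v))"
    unfolding cinner_components[of "rep f u"]
    by (intro sum.cong refl) (simp add: component_rep cinner_sum_left cinner_scaleC_left)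
  also have "\<dots> = (\<Sum>l\<in>L. \<Sum>j<n l. \<Sum>i<n l. f l $$ (i, j) * cinner (Us l j u) (Us l i v))"
    by (intro sum.cong refl sum.swap)
  finally show ?thesis by (simp add: cinner_sum_right cinner_scaleC_right)
qed

lemma cinner_rep_star:
  assumes "\<And>l. l \<in> L \<Longrightarrow> f l \<in> carrier_mat (n l) (n l)"
  shows "cinner (rep f u) v = cinner u (rep (\<lambda>l. mat_adjoint (f l)) v)"
  unfolding cinner_rep cinner_components[of u]
proof (intro sum.cong refl)
  fix l j assume "l \<in> L" "j \<in> {..<n l}"
  then have l: "l \<in> L" "j < n l" by auto
  have "mat_adjoint (f l) $$ (j, i) = cnj (f l $$ (i, j))" if "i < n l" for i
    using assms[OF l(1)] l(2) that by (intro mat_adjoint_index) auto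
  then show "cinner (Us l j u) (\<Sum>i<n l. cnj (f l $$ (i, j)) *\<^sub>C Us l i v)
      = cinner (Us l j u) (Us l j (rep (\<lambda>l. mat_adjoint (f l)) v))"
    by (simp add: component_rep[OF l])
qed

lemma rep_identity:
  assumes "\<And>l. l \<in> L \<Longrightarrow> f l = 1\<^sub>m (n l)" shows "rep f u = u"
proof (rule component_eqI)
  fix l i assume l: "l \<in> L" "i < n l"
  have "Us l i (rep f u) = (\<Sum>j<n l. if j = i then Us l j u else 0)"
    unfolding component_rep[OF l] by (intro sum.cong refl) (use assms[OF l(1)] l(2) in auto)
  then show "Us l i (rep f u) = Us l i u" using l(2) by simp
qed

end

locale matfun_isometry_family = isometry_family "\<Lambda> - {\<lambda>_. 0}" nlam U Us
  for \<Lambda> :: "('i::finite \<Rightarrow> nat) set" and U Us :: "('i \<Rightarrow> nat) \<Rightarrow> nat \<Rightarrow> 'e::chilbert \<Rightarrow> 'e"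
begin

lemma unital_star_rep_rep:
  assumes A: "\<And>f l. f \<in> \<A> \<Longrightarrow> l \<in> \<Lambda> - {\<lambda>_. 0} \<Longrightarrow> f l \<in> carrier_mat (nlam l) (nlam l)"
  shows "unital_star_rep \<Lambda> \<A> rep"
  unfolding unital_star_rep_def
proof (intro conjI ballI allI)
  show "rep (mf_one \<Lambda>) = id"
    by (rule ext) (simp, rule rep_identity, simp add: mf_one_def on_nonzero_def)
  fix f c assume f: "f \<in> \<A>"
  show "bounded_clinear (rep f)" by (rule bounded_clinear_rep)
  show "rep (mf_scale c f) = (\<lambda>u. c *\<^sub>C rep f u)" unfolding mf_scale_def by (intro ext rep_scale A f)
  show "rep (mf_star f) = cadjoint (rep f)"
    unfolding mf_star_def by (rule cadjointI[symmetric], rule cinner_rep_star, rule A[OF f])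
  fix g assume g: "g \<in> \<A>"
  show "rep (mf_add f g) = (\<lambda>u. rep f u + rep g u)" unfolding mf_add_def by (intro ext rep_add A f g)
  show "rep (mf_mult f g) = rep f \<circ> rep g" unfolding mf_mult_def o_def by (intro ext rep_mult A f g)
qed

text \<open>Copy \<open>0\<close>, present because \<open>nlam l\<close> is positive, serves as
  \<open>ran P\<^sub>\<lambda>\<close>. A component \<open>Us l j u\<close> ranges over the whole
  space, and \<open>U l 0\<close> moves it into that copy for every \<open>j\<close>.\<close>

lemma diagonal_form_rep: "diagonal_form \<Lambda> \<A> rep"
proof -
  let ?L = "\<Lambda> - {\<lambda>_. 0}"
  note pos = nlam_pos
  define P where "P l u = U l 0 (Us l 0 u)" for l u
  define V where "V u l j = (if l \<in> ?L \<and> j < nlam l then U l 0 (Us l j u) else 0)" for u l j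
  have UsU: "Us l 0 (U l 0 u) = u" if "l \<in> ?L" for l u using iso[OF that pos that pos] by simp
  have P: "orthogonal_projection (P l)" if l: "l \<in> ?L" for l
    unfolding orthogonal_projection_def
  proof (intro conjI)
    show "bounded_clinear (P l)" unfolding P_def by (intro bounded_clinear_compose[OF U] Us l pos)
    show "P l \<circ> P l = P l" by (simp add: P_def fun_eq_iff UsU[OF l])
    show "cadjoint (P l) = P l" by (rule cadjointI) (simp only: P_def adj[OF l pos] adj_left[OF l pos])
  qed
  have Pfix: "w = U l 0 (Us l 0 w)" if "l \<in> ?L" "w \<in> range (P l)" for l w
    using that by (auto simp: P_def iso pos)
  have V0: "Us l 0 (V u l j) = Us l j u" if "l \<in> ?L" "j < nlam l" for u l j
    using that pos by (simp add: V_def iso)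
  show ?thesis
    unfolding diagonal_form_def Let_def
  proof (intro exI[of _ P] exI[of _ V] conjI ballI allI impI P)
    fix l m u v assume "l \<in> ?L" "m \<in> ?L" "l \<noteq> m"
    then show "cinner (P l u) (P m v) = 0" by (simp add: P_def adj iso pos)
  next
    show "bij_betw V UNIV {w. \<forall>l j. if l \<in> ?L \<and> j < nlam l then w l j \<in> range (P l) else w l j = 0}"
      unfolding bij_betw_def
    proof (intro conjI)
      show "inj V"
      proof (rule injI)
        fix u v assume eq: "V u = V v"
        show "u = v"
        proof (rule component_eqI)
          fix l i assume l: "l \<in> ?L" "i < nlam l"
          have "Us l 0 (V u l i) = Us l 0 (V v l i)" by (simp only: eq)
          then show "Us l i u = Us l i v" by (simp only: V0[OF l])
        qed
      qed
      show "range V = {w. \<forall>l j. if l \<in> ?L \<and> j < nlam l then w l j \<in> range (P l) else w l j = 0}"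
      proof (intro equalityI subsetI)
        fix w assume "w \<in> range V"
        then obtain u where w: "w = V u" by blast
        have "U l 0 (Us l j u) \<in> range (P l)" if "l \<in> ?L" "j < nlam l" for l j
          by (rule range_eqI[of _ _ "U l 0 (Us l j u)"]) (simp add: P_def UsU[OF that(1)])
        then show "w \<in> {w. \<forall>l j. if l \<in> ?L \<and> j < nlam l then w l j \<in> range (P l) else w l j = 0}"
          by (simp add: w V_def)
      next
        fix w assume "w \<in> {w. \<forall>l j. if l \<in> ?L \<and> j < nlam l then w l j \<in> range (P l) else w l j = 0}"
        then have H: "if l \<in> ?L \<and> j < nlam l then w l j \<in> range (P l) else w l j = 0" for l j
          by blast
        have w: "w l j \<in> range (P l)" if "l \<in> ?L" "j < nlam l" for l j
          using H[of l j] unfolding if_P[OF conjI[OF that]] .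
        have w': "w l j = 0" if "\<not> (l \<in> ?L \<and> j < nlam l)" for l j
          using H[of l j] unfolding if_not_P[OF that] .
        \<comment> \<open>The preimage: each entry is pulled back from copy \<open>0\<close> and
          placed in the copy with its own index \<open>j\<close>.\<close>
        have "w = V (\<Sum>m\<in> ?L. \<Sum>j<nlam m. U m j (Us m 0 (w m j)))"
        proof (intro ext)
          fix l j
          show "w l j = V (\<Sum>m\<in> ?L. \<Sum>j<nlam m. U m j (Us m 0 (w m j))) l j"
          proof (cases "l \<in> ?L \<and> j < nlam l")
            case True
            then have l: "l \<in> ?L" "j < nlam l" by auto
            show ?thesis
              unfolding V_def if_P[OF True] component_sum[OF l] by (rule Pfix[OF l(1) w[OF l]])
          next
            case False
            show ?thesis unfolding V_def if_not_P[OF False] by (rule w'[OF False])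
          qed
        qed
        then show "w \<in> range V" by blast
      qed
    qed
  next
    fix u v l j
    show "V (u + v) l j = V u l j + V v l j"
      using pos[of l] by (simp add: V_def bounded_clinear_add[OF U] bounded_clinear_add[OF Us])
    fix c show "V (c *\<^sub>C u) l j = c *\<^sub>C V u l j"
      using pos[of l] by (simp add: V_def bounded_clinear_scaleC[OF U] bounded_clinear_scaleC[OF Us])
  next
    fix u v
    have "cinner (V u l j) (V v l j) = cinner (Us l j u) (Us l j v)" if "l \<in> ?L" "j < nlam l" for l j
      using that pos[of l] by (simp add: V_def adj iso)
    then show "cinner u v = (\<Sum>l\<in> ?L. \<Sum>j<nlam l. cinner (V u l j) (V v l j))"
      by (subst cinner_components) (intro sum.cong refl, simp)
  next
    fix f u l i assume l: "l \<in> ?L" "i < nlam l"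
    show "V (rep f u) l i = (\<Sum>j<nlam l. f l $$ (i, j) *\<^sub>C V u l j)"
      using l pos[of l]
      by (simp add: V_def component_rep bounded_clinear_sum[OF U] bounded_clinear_scaleC[OF U])
  qed
qed

end


section \<open>Unitary extension\<close>

text \<open>A Halmos dilation: on the orthogonal complement \<open>K\<^sub>0\<close> of \<open>ran J\<close> and its copy \<open>J K\<^sub>0\<close> the
  unitary is the block matrix with rows \<open>(V, 1 - V V\<^sup>*)\<close> and \<open>(1 - V\<^sup>* V, V\<^sup>*)\<close>, and elsewhere it is
  the identity.\<close>

lemma unitary_extension:
  fixes V Vs J Js :: "'a::chilbert \<Rightarrow> 'a"
  assumes b: "bounded_clinear V" "bounded_clinear Vs" "bounded_clinear J" "bounded_clinear Js"
    and aV: "\<And>x y. cinner (V x) y = cinner x (Vs y)" and aJ: "\<And>x y. cinner (J x) y = cinner x (Js y)"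
    and r: "\<And>x. V (Vs (V x)) = V x" "\<And>x. Vs (V (Vs x)) = Vs x" "\<And>x. Js (J x) = x"
      "\<And>x. V (J x) = 0" "\<And>x. Vs (J x) = 0"
  obtains W Ws where "unitary_op W" "unitary_op Ws" "\<And>x y. cinner (Ws x) y = cinner x (W y)"
    "\<And>x. Vs (V x) = x \<Longrightarrow> Js x = 0 \<Longrightarrow> W x = V x"
proof -
  have aVs: "cinner (Vs x) y = cinner x (V y)" and aJs: "cinner (Js x) y = cinner x (J y)" for x y
    by (metis aV cinner_commute) (metis aJ cinner_commute)
  have r': "Js (V x) = 0" "Js (Vs x) = 0" for x
  proof -
    have "cinner (Js (V x)) z = cinner 0 z" "cinner (Js (Vs x)) z = cinner 0 z" for z
      by (simp_all only: aJs aV aVs r cinner_zero_right cinner_zero_left)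
    then show "Js (V x) = 0" "Js (Vs x) = 0" by (blast intro: cinner_eqI)+
  qed
  \<comment> \<open>The first two summands land in \<open>K\<^sub>0\<close>, the next two in its
    copy, and the last one is the identity on the range of \<open>J \<circ> J\<close>. The corner
    \<open>V\<^sup>*\<close> carries no sign because \<open>V (1 - V\<^sup>* V) = 0\<close> for a
    partial isometry.\<close>
  define H where "H V Vs x = V x + (Js x - J (Js (Js x)) - V (Vs (Js x))) + J (x - J (Js x) - Vs (V x))
      + J (Vs (Js x)) + J (J (Js (Js x)))" for V Vs x
  note lin = bounded_clinear_add[OF b(1)] bounded_clinear_add[OF b(2)] bounded_clinear_add[OF b(3)] bounded_clinear_add[OF b(4)]
    bounded_clinear_diff[OF b(1)] bounded_clinear_diff[OF b(2)] bounded_clinear_diff[OF b(3)] bounded_clinear_diff[OF b(4)]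
    bounded_clinear_zero[OF b(1)] bounded_clinear_zero[OF b(2)] bounded_clinear_zero[OF b(3)] bounded_clinear_zero[OF b(4)]
  have bH: "bounded_clinear (H V Vs)" "bounded_clinear (H Vs V)"
    unfolding H_def
    by (intro bounded_clinear_plus bounded_clinear_sub bounded_clinear_compose[OF b(1)] bounded_clinear_compose[OF b(2)]
        bounded_clinear_compose[OF b(3)] bounded_clinear_compose[OF b(4)] b bounded_clinear_id)+
  have HH: "H Vs V (H V Vs x) = x" "H V Vs (H Vs V x) = x" for x
    unfolding H_def by (simp_all add: lin r r')
  have aH: "cinner (H V Vs x) y = cinner x (H Vs V y)" for x y
    unfolding H_def by (simp add: cinner_left_simps cinner_right_simps lin aV aVs aJ aJs)
  have aH': "cinner (H Vs V x) y = cinner x (H V Vs y)" for x y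
    by (metis aH cinner_commute)
  have "cadjoint (H V Vs) = H Vs V" "cadjoint (H Vs V) = H V Vs"
    by (rule cadjointI, rule aH) (rule cadjointI, rule aH')
  then have "unitary_op (H V Vs)" "unitary_op (H Vs V)"
    by (simp_all add: unitary_op_def bH fun_eq_iff HH)
  moreover have "H V Vs x = V x" if "Vs (V x) = x" "Js x = 0" for x
    by (simp add: H_def that lin)
  ultimately show thesis using that aH' by blast
qed


section \<open>The transfer function\<close>

lemma unitary_norm:
  assumes "unitary_op U" shows "norm (U x) = norm x"
proof -
  have "bounded_clinear U" "cadjoint U (U x) = x" using assms by (auto simp: unitary_op_def fun_eq_iff)
  then have "cinner (U x) (U x) = cinner x x" by (metis cinner_cadjoint)
  then have "(norm (U x))\<^sup>2 = (norm x)\<^sup>2" unfolding cinner_self by (simp only: of_real_eq_iff)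
  then show ?thesis by (simp add: power2_eq_iff_nonneg)
qed

text \<open>The state \<open>w\<close> solves \<open>U (S x w, h) = (w, y)\<close> with
  \<open>y\<close> the value of the transfer function. When this is paired with
  \<open>(a g, g)\<close>, the hypothesis \<open>ab\<close> cancels the state terms and leaves
  \<open>y\<close> paired with \<open>g\<close> on one side and \<open>f\<close> paired with
  \<open>g\<close> on the other.\<close>

lemma transfer_function_eqI:
  fixes U W :: "'e::chilbert \<times> 'h::chilbert \<Rightarrow> 'e \<times> 'h"
  assumes U: "unitary_op U" and adj: "\<And>z w. cinner (U z) w = cinner z (W w)"
    and S: "bounded_clinear (S x)" "\<And>u. norm (S x u) \<le> c * norm u" "0 \<le> c" "c < 1"
    and W: "\<And>g. W (a g, g) = (b g, t g)"
    and ab: "\<And>u g. cinner (S x u) (b g) = cinner u (a g)"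
    and t: "\<And>g. cinner h (t g) = cinner f g"
  shows "transfer_function U S x h = f"
proof -
  have bU: "bounded_clinear U" using U by (simp add: unitary_op_def)
  define A where "A u = fst (U (u, 0))" for u
  define B where "B h = fst (U (0, h))" for h
  have A: "bounded_clinear A"
    unfolding A_def by (intro bounded_clinear_compose[OF bounded_clinear_fst] bounded_clinear_compose[OF bU] bounded_clinear_intros)
  have nA: "norm (A u) \<le> norm u" for u
    unfolding A_def using norm_fst_le[of "fst (U (u, 0))" "snd (U (u, 0))"] unitary_norm[OF U, of "(u, 0)"]
    by (simp add: norm_Pair)
  \<comment> \<open>As \<open>A\<close> is a contraction and \<open>S x\<close> a strict one, the
    state equation has a solution by Banach's fixed point theorem; hence the preimage chosen by
    \<open>inv_into\<close> is a genuine one.\<close>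
  have surj: "B h \<in> range (\<lambda>u. u - A (S x u))"
  proof -
    have "\<exists>!u. B h + A (S x u) = u"
    proof (rule banach_fix_type[OF S(3,4)], intro allI)
      fix u v
      have "dist (B h + A (S x u)) (B h + A (S x v)) = norm (A (S x (u - v)))"
        by (simp add: dist_norm bounded_clinear_diff[OF A] bounded_clinear_diff[OF S(1)])
      also have "\<dots> \<le> norm (S x (u - v))" by (rule nA)
      also have "\<dots> \<le> c * dist u v" using S(2) by (simp add: dist_norm)
      finally show "dist (B h + A (S x u)) (B h + A (S x v)) \<le> c * dist u v" .
    qed
    then obtain u where u: "B h + A (S x u) = u" by blast
    have "B h = u - A (S x u)" using u by (simp add: eq_diff_eq)
    then show ?thesis by (rule range_eqI)
  qed
  define w where "w = inv_into UNIV (\<lambda>u. u - A (S x u)) (B h)"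
  have w: "w = A (S x w) + B h"
    using f_inv_into_f[OF surj] by (simp add: w_def algebra_simps)
  have split: "U (S x w, h) = U (S x w, 0) + U (0, h)"
    using bounded_clinear_add[OF bU, of "(S x w, 0)" "(0, h)"] by simp
  have f1: "fst (U (S x w, h)) = w" unfolding split using w by (simp add: A_def B_def)
  have tf: "transfer_function U S x h = snd (U (S x w, h))"
    unfolding transfer_function_def Let_def A_def[symmetric] B_def[symmetric] w_def[symmetric] split
    by simp
  show ?thesis
  proof (rule cinner_eqI)
    fix g
    have "cinner w (a g) + cinner (snd (U (S x w, h))) g = cinner (U (S x w, h)) (a g, g)"
      by (simp add: cinner_prod_def f1)
    also have "\<dots> = cinner (S x w) (b g) + cinner h (t g)"
      unfolding adj W by (simp add: cinner_prod_def)
    finally show "cinner (transfer_function U S x h) g = cinner f g" by (simp add: tf ab t)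
  qed
qed

lemma sigma_index:
  fixes \<psi> :: "'i::finite \<Rightarrow> 'x \<Rightarrow> complex" and x :: 'x
  defines "p \<equiv> \<lambda>S j. \<Prod>s\<in>S j. \<psi> (fst s) x"
  assumes "i < nlam l" "j < nlam l"
  shows "sigma \<psi> ev od l x $$ (i, j)
    = inverse (complex_of_real (\<Sum>r<nlam l. (cmod (p (ev l) r))\<^sup>2)) * (cnj (p (ev l) i) * p (od l) j)"
proof -
  let ?P = "psi_row \<psi> (ev l) (nlam l) x" and ?M = "psi_row \<psi> (od l) (nlam l) x"
  have "(?P * mat_adjoint ?P) $$ (0, 0) = complex_of_real (\<Sum>r<nlam l. (cmod (p (ev l) r))\<^sup>2)"
    by (simp add: psi_row_product p_def complex_norm_square flip: of_real_power)
  moreover have "(mat_adjoint ?P * ?M) $$ (i, j) = cnj (p (ev l) i) * p (od l) j"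
    using assms(2,3) psi_row_carrier[of \<psi> "ev l" "nlam l" x] psi_row_carrier[of \<psi> "od l" "nlam l" x]
    by (subst mult_index_sum[OF mat_adjoint_carrier[OF psi_row_carrier] psi_row_carrier])
      (auto simp: mat_adjoint_index psi_row_index p_def)
  moreover have "mat_adjoint ?P * ?M \<in> carrier_mat (nlam l) (nlam l)"
    by (intro mult_carrier_mat[of _ _ 1] mat_adjoint_carrier psi_row_carrier)
  ultimately show ?thesis
    using assms(2,3) by (simp add: sigma_def Let_def psi_row_carrier[THEN carrier_matD(2)])
qed

text \<open>The matrix is the rank one product of a conjugated row \<open>p\<close> and a row
  \<open>m\<close>, divided by the squared norm \<open>P\<close> of \<open>p\<close>. Its squared
  norm is that of \<open>m\<close> over \<open>P\<close>; having vectors \<open>y j\<close> as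
  entries only tensors it with an identity.\<close>

lemma rank_one_bound:
  fixes y :: "nat \<Rightarrow> 'e::chilbert" and p m :: "nat \<Rightarrow> complex" and N :: nat
  defines "P \<equiv> \<Sum>r<N. (cmod (p r))\<^sup>2"
  assumes P: "P > 0"
  shows "(\<Sum>i<N. (norm (\<Sum>j<N. (inverse (complex_of_real P) * (cnj (p i) * m j)) *\<^sub>C y j))\<^sup>2)
    \<le> (\<Sum>r<N. (cmod (m r))\<^sup>2) / P * (\<Sum>j<N. (norm (y j))\<^sup>2)"
proof -
  define s where "s = (\<Sum>j<N. m j *\<^sub>C y j)"
  have "(\<Sum>j<N. (inverse (complex_of_real P) * (cnj (p i) * m j)) *\<^sub>C y j)
      = (inverse (complex_of_real P) * cnj (p i)) *\<^sub>C s" for i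
    by (simp add: s_def scaleC_sum_right scaleC_scaleC mult.assoc)
  moreover have "(norm ((inverse (complex_of_real P) * cnj (p i)) *\<^sub>C s))\<^sup>2 = (cmod (p i))\<^sup>2 * ((norm s)\<^sup>2 / P\<^sup>2)" for i
    by (simp add: norm_scaleC norm_mult norm_inverse power_mult_distrib power_inverse divide_inverse mult_ac)
  ultimately have "(\<Sum>i<N. (norm (\<Sum>j<N. (inverse (complex_of_real P) * (cnj (p i) * m j)) *\<^sub>C y j))\<^sup>2)
      = (\<Sum>i<N. (cmod (p i))\<^sup>2 * ((norm s)\<^sup>2 / P\<^sup>2))"
    by (simp only:)
  also have "\<dots> = (norm s)\<^sup>2 / P"
    using P by (simp add: P_def power2_eq_square flip: sum_distrib_right sum_divide_distrib)
  also have "\<dots> \<le> ((\<Sum>r<N. (cmod (m r))\<^sup>2) * (\<Sum>j<N. (norm (y j))\<^sup>2)) / P"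
  proof (rule divide_right_mono)
    have "norm s \<le> (\<Sum>j<N. \<bar>cmod (m j)\<bar> * \<bar>norm (y j)\<bar>)"
      unfolding s_def by (rule sum_norm_le) (simp add: norm_scaleC)
    also have "\<dots> \<le> L2_set (\<lambda>j. cmod (m j)) {..<N} * L2_set (\<lambda>j. norm (y j)) {..<N}"
      by (rule L2_set_mult_ineq)
    finally have "(norm s)\<^sup>2 \<le> (L2_set (\<lambda>j. cmod (m j)) {..<N} * L2_set (\<lambda>j. norm (y j)) {..<N})\<^sup>2"
      by (rule power_mono) simp
    then show "(norm s)\<^sup>2 \<le> (\<Sum>r<N. (cmod (m r))\<^sup>2) * (\<Sum>j<N. (norm (y j))\<^sup>2)"
      by (simp add: power_mult_distrib L2_set_def sum_nonneg)
  qed (use P in simp)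
  finally show ?thesis by simp
qed

text \<open>A lurking isometry argument: the Gram kernels of \<open>\<alpha>\<close> and
  \<open>\<beta>\<close> agree, and the unitary \<open>W\<close> extends the isometry between their
  spans. \<open>J\<close> embeds the state space together with the coefficient space into the state
  space, orthogonally to both families, as \<open>unitary_extension\<close> requires.\<close>

lemma transfer_representation_exists:
  fixes \<phi> :: "'x \<Rightarrow> 'h::chilbert \<Rightarrow> 'h" and \<psi> :: "'i::finite \<Rightarrow> 'x \<Rightarrow> complex"
  assumes \<psi>: "test_functions \<psi>" and \<Lambda>: "preordering_set \<Lambda>" and ord: "subset_orders \<Lambda> ev od"
    and \<phi>: "\<And>x. bounded_clinear (\<phi> x)" and K: "agler_decomposition \<psi> \<Lambda> \<phi> K"
  shows "has_transfer_representation \<Lambda> \<psi> ev od \<phi>"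
proof -
  let ?L = "\<Lambda> - {\<lambda>_. 0}"
  note L = preordering_nonzero[OF \<Lambda>]
  obtain v :: "('i \<Rightarrow> nat) \<Rightarrow> 'x \<times> 'h \<Rightarrow> ('x \<times> 'h) ell2"
    where v: "\<And>l p q. l \<in> ?L \<Longrightarrow> cinner (v l q) (v l p) = K l p q"
    by (rule agler_decomposition_factors[OF K]) blast
  \<comment> \<open>Moves the coefficient space isometrically into a sequence space, from where it
    can be placed on coordinates of the state space.\<close>
  obtain \<eta> :: "'h \<Rightarrow> 'h ell2" where \<eta>: "\<And>g h. cinner (\<eta> h) (\<eta> g) = cinner h g"
    using Kolmogorov_factorization[OF psd_gram[of "\<lambda>h :: 'h. h"]] by metis

  define T where "T = (SIGMA l:?L. {..<nlam l})"
  have T: "finite T" "T \<noteq> {}"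
    using L nlam_pos by (auto simp: T_def)
  then have "countable (T \<times> (UNIV :: nat set))" "infinite (T \<times> (UNIV :: nat set))"
    by (auto simp: finite_cartesian_product_iff countable_finite)
  \<comment> \<open>Splits the index set \<open>'x \<times> 'h \<times> nat\<close> into one copy of
    itself for each pair \<open>(l, i)\<close>. Surjectivity yields the resolution of the
    identity.\<close>
  then obtain enc :: "(('i \<Rightarrow> nat) \<times> nat) \<times> nat \<Rightarrow> nat" where enc: "bij_betw enc (T \<times> UNIV) UNIV"
    by (rule countableE_infinite)
  have enc_eq: "enc (k, m) = enc (k', m') \<longleftrightarrow> k = k' \<and> m = m'" if "k \<in> T" "k' \<in> T" for k k' m m'
    by (subst inj_on_eq_iff[OF bij_betw_imp_inj_on[OF enc]]) (use that in auto)
  define f where "f k = (\<lambda>(x :: 'x, h :: 'h, m). (x, h, enc (k, m)))" for k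
  have inj_f: "inj (f k)" if "k \<in> T" for k
    using enc_eq[OF that that] by (auto simp: inj_def f_def)
  define U where "U l i = coord_embed (f (l, i))" for l i
  define Us where "Us l i = coord_pull (f (l, i))" for l i
  have Tk: "(l, i) \<in> T" if "l \<in> ?L" "i < nlam l" for l i using that by (simp add: T_def)
  interpret F: matfun_isometry_family \<Lambda> U Us
  proof
    show "finite ?L" by (rule L(1))
    fix l i and u w :: "('x \<times> 'h \<times> nat) ell2" assume l: "l \<in> ?L" "i < nlam l"
    note inj = inj_f[OF Tk[OF l]]
    show "bounded_clinear (U l i)" unfolding U_def by (rule bounded_clinear_coord_embed[OF inj])
    show "bounded_clinear (Us l i)" unfolding Us_def by (rule bounded_clinear_coord_pull[OF inj])
    show "cinner (U l i u) w = cinner u (Us l i w)" unfolding U_def Us_def by (rule cinner_coord_embed[OF inj])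
    fix m j assume m: "m \<in> ?L" "j < nlam m"
    show "Us l i (U m j u) = (if l = m \<and> i = j then u else 0)"
    proof (cases "l = m \<and> i = j")
      case True
      then show ?thesis using coord_pull_embed[OF inj] by (simp add: U_def Us_def)
    next
      case False
      have "range (f (m, j)) \<inter> range (f (l, i)) = {}"
        using enc_eq[OF Tk[OF m] Tk[OF l]] False by (auto simp: f_def)
      then show ?thesis
        using coord_pull_embed_disjoint[OF inj_f[OF Tk[OF m]] inj] False by (auto simp: U_def Us_def)
    qed
  next
    fix u :: "('x \<times> 'h \<times> nat) ell2"
    have "(\<Sum>k\<in>T. coord_embed (f k) (coord_pull (f k) u)) = u"
    proof (rule coord_resolution[OF T(1) inj_f])
      fix k k' a a' assume "k \<in> T" "k' \<in> T" "f k a = f k' a'"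
      then show "k = k'" using enc_eq by (auto simp: f_def split: prod.splits)
    next
      fix b :: "'x \<times> 'h \<times> nat"
      obtain x h m where b: "b = (x, h, m)" by (metis surj_pair)
      have "m \<in> enc ` (T \<times> UNIV)" using bij_betw_imp_surj_on[OF enc] by simp
      then obtain z where z: "z \<in> T \<times> UNIV" "m = enc z" by (rule imageE)
      obtain k m' where "z = (k, m')" by (rule prod.exhaust)
      with z have "k \<in> T" "m = enc (k, m')" by simp_all
      then show "\<exists>k\<in>T. b \<in> range (f k)"
        by (intro bexI[of _ k] range_eqI[of _ _ "(x, h, m')"]) (simp_all add: b f_def)
    qed
    then show "(\<Sum>l\<in>?L. \<Sum>i<nlam l. U l i (Us l i u)) = u"
      unfolding T_def using L(1) by (subst sum.Sigma) (simp_all add: split_def U_def Us_def)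
  qed

  define pr where "pr S j x = (\<Prod>s\<in>S j. \<psi> (fst s) x)" for S :: "nat \<Rightarrow> ('i \<times> nat) set" and j x
  have pr: "(\<Sum>j<nlam l. pr (ev l) j x * cnj (pr (ev l) j y)) - (\<Sum>j<nlam l. pr (od l) j x * cnj (pr (od l) j y))
      = defect \<psi> l x y" if "l \<in> ?L" for l x y
    using psi_rows_defect[OF ord that, of \<psi> x y] by (simp only: pr_def)
  define e0 where "e0 = (\<lambda>(x :: 'x, h :: 'h). (x, h, 0 :: nat))"
  have inj_e0: "inj e0" by (auto simp: inj_def e0_def)
  define w where "w l q = coord_embed e0 (v l q)" for l q
  have ww: "cinner (w l q) (w l p) = K l p q" if "l \<in> ?L" for l p q
    by (simp add: w_def cinner_coord_embed[OF inj_e0] coord_pull_embed[OF inj_e0] v[OF that])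
  \<comment> \<open>In block form this is the direct sum over \<open>l\<close> of the adjoint row of
    products listed by \<open>S l\<close>, taken at the point \<open>fst q\<close>, tensored with
    the Gram vector of \<open>K l\<close>.\<close>
  define vec where "vec S q = (\<Sum>l\<in>?L. \<Sum>i<nlam l. U l i (cnj (pr (S l) i (fst q)) *\<^sub>C w l q))"
    for S :: "('i \<Rightarrow> nat) \<Rightarrow> nat \<Rightarrow> ('i \<times> nat) set" and q
  have comp_vec: "Us l i (vec S q) = cnj (pr (S l) i (fst q)) *\<^sub>C w l q" if "l \<in> ?L" "i < nlam l" for l i S q
    unfolding vec_def by (rule F.component_sum[OF that])
  have gram_vec: "cinner (vec S q) (vec S p)
      = (\<Sum>l\<in>?L. (\<Sum>i<nlam l. pr (S l) i (fst p) * cnj (pr (S l) i (fst q))) * K l p q)" for S p q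
    unfolding F.cinner_components[of "vec S q"] sum_distrib_right
    by (intro sum.cong refl) (simp add: comp_vec cinner_scaleC_left cinner_scaleC_right ww mult_ac)
  define \<alpha> where "\<alpha> q = (vec od q, snd q)" for q
  define \<beta> where "\<beta> q = (vec ev q, cadjoint (\<phi> (fst q)) (snd q))" for q
  have gram: "cinner (\<alpha> q) (\<alpha> p) = cinner (\<beta> q) (\<beta> p)" for p q
  proof -
    have "cinner (snd q) (snd p) - cinner (cadjoint (\<phi> (fst q)) (snd q)) (cadjoint (\<phi> (fst p)) (snd p))
        = (\<Sum>l\<in>?L. defect \<psi> l (fst p) (fst q) * K l p q)"
      using agler_decompositionD[OF K, of "snd q" "fst p" "fst q" "snd p"]
      by (simp add: cinner_diff_left cinner_cadjoint \<phi>)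
    also have "\<dots> = (\<Sum>l\<in>?L. ((\<Sum>i<nlam l. pr (ev l) i (fst p) * cnj (pr (ev l) i (fst q)))
        - (\<Sum>i<nlam l. pr (od l) i (fst p) * cnj (pr (od l) i (fst q)))) * K l p q)"
      by (intro sum.cong refl) (simp only: pr)
    also have "\<dots> = cinner (vec ev q) (vec ev p) - cinner (vec od q) (vec od p)"
      by (simp only: gram_vec left_diff_distrib sum_subtractf)
    finally show ?thesis by (simp add: \<alpha>_def \<beta>_def cinner_prod_def algebra_simps)
  qed

  obtain k0 where k0: "k0 \<in> T" using T by blast
  \<comment> \<open>Inside each block the vectors \<open>vec\<close> occupy only the slot
    \<open>0\<close> fixed by \<open>e0\<close>. In block \<open>k0\<close>, slot \<open>1\<close>
    receives the coefficient space and the slots from \<open>2\<close> on receive a copy of the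
    state space.\<close>
  define g1 where "g1 = (\<lambda>(x :: 'x, h :: 'h, m). (x, h, enc (k0, Suc (Suc m))))"
  define g2 where "g2 = (\<lambda>h :: 'h. (undefined :: 'x, h, enc (k0, 1)))"
  have inj_g: "inj g1" "inj g2"
    using enc_eq[OF k0 k0] by (auto simp: inj_def g1_def g2_def)
  have disj_g: "range g1 \<inter> range g2 = {}" "range g2 \<inter> range g1 = {}"
    using enc_eq[OF k0 k0] by (auto simp: g1_def g2_def)
  note g_simps = coord_pull_embed[OF inj_g(1)] coord_pull_embed[OF inj_g(2)]
    coord_pull_embed_disjoint[OF inj_g disj_g(1)] coord_pull_embed_disjoint[OF inj_g(2,1) disj_g(2)]
  note bounded_g = bounded_clinear_coord_embed[OF inj_g(1)] bounded_clinear_coord_embed[OF inj_g(2)]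
    bounded_clinear_coord_pull[OF inj_g(1)] bounded_clinear_coord_pull[OF inj_g(2)]
  have \<eta>_bounded: "bounded_clinear \<eta>"
  proof (rule bounded_clinear_isometricI[where K = 1])
    fix g h :: 'h and c
    \<comment> \<open>A map preserving inner products is linear, since its failure to be linear is a
      vector of norm zero.\<close>
    have "cinner (\<eta> (g + h) - \<eta> g - \<eta> h) (\<eta> (g + h) - \<eta> g - \<eta> h) = 0"
      by (simp add: cinner_left_simps cinner_right_simps \<eta>)
    then show "\<eta> (g + h) = \<eta> g + \<eta> h" by (simp add: algebra_simps)
    have "cinner (\<eta> (c *\<^sub>C g) - c *\<^sub>C \<eta> g) (\<eta> (c *\<^sub>C g) - c *\<^sub>C \<eta> g) = 0"
      by (simp add: cinner_left_simps cinner_right_simps \<eta>)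
    then show "\<eta> (c *\<^sub>C g) = c *\<^sub>C \<eta> g" by simp
    have "(norm (\<eta> g))\<^sup>2 = (norm g)\<^sup>2" using \<eta>[of g g] unfolding cinner_self by (simp only: of_real_eq_iff)
    then show "norm (\<eta> g) \<le> norm g * 1" by (simp add: power2_eq_iff_nonneg)
  qed
  have \<eta>_iso: "cadjoint \<eta> (\<eta> h) = h" for h
    by (rule cinner_eqI) (simp add: cinner_cadjoint_left[OF \<eta>_bounded] \<eta>)
  define J where "J z = (coord_embed g1 (fst z) + coord_embed g2 (\<eta> (snd z)), 0 :: 'h)" for z
  define Js where "Js z = (coord_pull g1 (fst z), cadjoint \<eta> (coord_pull g2 (fst z)))" for z :: "_ \<times> 'h"
  have bJ: "bounded_clinear J"
    unfolding J_def
    by (intro bounded_clinear_intros bounded_clinear_compose[OF bounded_g(1)] bounded_clinear_compose[OF bounded_g(2)]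
        bounded_clinear_compose[OF \<eta>_bounded] bounded_clinear_fst bounded_clinear_snd)
  have bJs: "bounded_clinear Js"
    unfolding Js_def
    by (intro bounded_clinear_intros bounded_clinear_compose[OF bounded_g(3)] bounded_clinear_compose[OF bounded_g(4)]
        bounded_clinear_compose[OF bounded_clinear_cadjoint[OF \<eta>_bounded]] bounded_clinear_fst)
  have adjJ: "cinner (J z) z' = cinner z (Js z')" for z z'
    by (simp add: J_def Js_def cinner_prod_def cinner_add_left cinner_coord_embed inj_g cinner_cadjoint \<eta>_bounded)
  have JsJ: "Js (J z) = z" for z
    by (simp add: J_def Js_def bounded_clinear_add[OF bounded_g(3)] bounded_clinear_add[OF bounded_g(4)] g_simps \<eta>_iso)
  have Js_vec: "Js (vec S q, h) = 0" for S q h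
  proof -
    have pull0: "coord_pull g (U l i (c *\<^sub>C w l q)) = 0"
      if l: "l \<in> ?L" "i < nlam l" and g: "inj g" "range (f (l, i) \<circ> e0) \<inter> range g = {}"
      for l i c and g :: "'a \<Rightarrow> 'x \<times> 'h \<times> nat"
    proof -
      have "U l i (c *\<^sub>C w l q) = c *\<^sub>C coord_embed (f (l, i) \<circ> e0) (v l q)"
        using inj_f[OF Tk[OF l]]
        by (simp add: U_def w_def bounded_clinear_scaleC bounded_clinear_coord_embed coord_embed_compose[OF inj_e0])
      then show ?thesis
        using coord_pull_embed_disjoint[OF inj_compose[OF inj_f[OF Tk[OF l]] inj_e0] g]
        by (simp add: bounded_clinear_scaleC[OF bounded_clinear_coord_pull[OF g(1)]])
    qed
    have disj: "range (f (l, i) \<circ> e0) \<inter> range g1 = {}" "range (f (l, i) \<circ> e0) \<inter> range g2 = {}"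
      if "l \<in> ?L" "i < nlam l" for l i
      using enc_eq[OF Tk[OF that] k0] by (auto simp: f_def e0_def g1_def g2_def)
    have "coord_pull g1 (vec S q) = 0"
      unfolding vec_def bounded_clinear_sum[OF bounded_g(3)]
    proof (intro sum.neutral ballI)
      fix l i assume "l \<in> ?L" "i \<in> {..<nlam l}"
      then have l: "l \<in> ?L" "i < nlam l" by auto
      show "coord_pull g1 (U l i (cnj (pr (S l) i (fst q)) *\<^sub>C w l q)) = 0"
        by (rule pull0[OF l inj_g(1) disj(1)[OF l]])
    qed
    moreover have "coord_pull g2 (vec S q) = 0"
      unfolding vec_def bounded_clinear_sum[OF bounded_g(4)]
    proof (intro sum.neutral ballI)
      fix l i assume "l \<in> ?L" "i \<in> {..<nlam l}"
      then have l: "l \<in> ?L" "i < nlam l" by auto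
      show "coord_pull g2 (U l i (cnj (pr (S l) i (fst q)) *\<^sub>C w l q)) = 0"
        by (rule pull0[OF l inj_g(2) disj(2)[OF l]])
    qed
    ultimately show ?thesis by (simp add: Js_def bounded_clinear_zero[OF bounded_clinear_cadjoint[OF \<eta>_bounded]] zero_prod_def)
  qed

  obtain V Vs where bV: "bounded_clinear V" "bounded_clinear Vs" and adjV: "\<And>x y. cinner (V x) y = cinner x (Vs y)"
    and V\<alpha>: "\<And>q. V (\<alpha> q) = \<beta> q" "\<And>q. Vs (\<beta> q) = \<alpha> q"
    and VVV: "\<And>x. V (Vs (V x)) = V x" "\<And>x. Vs (V (Vs x)) = Vs x"
    and V0: "\<And>y. (\<And>q. cinner (\<alpha> q) y = 0) \<Longrightarrow> V y = 0" "\<And>y. (\<And>q. cinner (\<beta> q) y = 0) \<Longrightarrow> Vs y = 0"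
    using partial_isometry_exists[of \<alpha> \<beta>, OF gram] by blast
  have adjJ': "cinner x (J y) = cinner (Js x) y" for x y by (metis adjJ cinner_commute)
  \<comment> \<open>The range of \<open>J\<close> is orthogonal to all \<open>\<alpha> q\<close> and
    \<open>\<beta> q\<close>: its first components use spare slots only, and its second components
    are zero.\<close>
  have "V (J y) = 0" "Vs (J y) = 0" for y
    by (rule V0, simp add: adjJ' \<alpha>_def Js_vec) (rule V0, simp add: adjJ' \<beta>_def Js_vec)
  from unitary_extension[OF bV bJ bJs adjV adjJ VVV JsJ this] obtain W Ws
    where W: "unitary_op W" "unitary_op Ws" "\<And>x y. cinner (Ws x) y = cinner x (W y)"
      "\<And>x. Vs (V x) = x \<Longrightarrow> Js x = 0 \<Longrightarrow> W x = V x" by blast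
  have W\<alpha>: "W (\<alpha> q) = \<beta> q" for q
    using W(4)[of "\<alpha> q"] V\<alpha> by (simp add: \<alpha>_def[of q] Js_vec) (simp add: \<alpha>_def)

  let ?E = "E_fun \<Lambda> \<psi> ev od"
  define P where "P l x = (\<Sum>r<nlam l. (cmod (pr (ev l) r x))\<^sup>2)" for l x
  define M where "M l x = (\<Sum>r<nlam l. (cmod (pr (od l) r x))\<^sup>2)" for l x
  have MP: "0 \<le> M l x" "M l x < P l x" if "l \<in> ?L" for l x
  proof -
    show "0 \<le> M l x" by (simp add: M_def sum_nonneg)
    have "complex_of_real (P l x - M l x) = defect \<psi> l x x"
      unfolding pr[OF that, symmetric] P_def M_def of_real_diff of_real_sum complex_norm_square ..
    then have "P l x - M l x = Re (defect \<psi> l x x)" by (metis Re_complex_of_real)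
    then show "M l x < P l x" using defect_diag(2)[OF \<psi>, of l x] by simp
  qed
  have E_index: "?E x l $$ (i, j) = inverse (complex_of_real (P l x)) * (cnj (pr (ev l) i x) * pr (od l) j x)"
    if "l \<in> ?L" "i < nlam l" "j < nlam l" for l i j x
    using sigma_index[OF that(2,3), of \<psi> ev od x] that(1)
    by (simp add: E_fun_def on_nonzero_def P_def pr_def)
  \<comment> \<open>The adjoint form of \<open>\<psi>\<^sub>\<lambda>\<^sup>+
    \<sigma>\<^sub>\<lambda> = \<psi>\<^sub>\<lambda>\<^sup>-\<close>, tensored with the Gram
    vectors.\<close>
  have rep_ev: "cinner (F.rep (?E x) u) (vec ev (x, g)) = cinner u (vec od (x, g))" for x u g
    unfolding F.cinner_rep F.cinner_components[of u]
  proof (intro sum.cong refl)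
    fix l j assume "l \<in> ?L" "j \<in> {..<nlam l}"
    then have l: "l \<in> ?L" "j < nlam l" by auto
    have P0: "complex_of_real (P l x) \<noteq> 0" using MP[OF l(1), of x] by simp
    have "(\<Sum>i<nlam l. cnj (?E x l $$ (i, j)) *\<^sub>C Us l i (vec ev (x, g)))
        = (\<Sum>i<nlam l. inverse (complex_of_real (P l x)) * cnj (pr (od l) j x) * (pr (ev l) i x * cnj (pr (ev l) i x))) *\<^sub>C w l (x, g)"
      unfolding scaleC_sum_left
      by (intro sum.cong refl) (simp add: E_index[OF l(1) _ l(2)] comp_vec[OF l(1)] scaleC_scaleC mult_ac)
    also have "(\<Sum>i<nlam l. inverse (complex_of_real (P l x)) * cnj (pr (od l) j x) * (pr (ev l) i x * cnj (pr (ev l) i x)))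
        = inverse (complex_of_real (P l x)) * cnj (pr (od l) j x) * complex_of_real (P l x)"
      unfolding sum_distrib_left[symmetric] by (simp only: P_def of_real_sum complex_norm_square)
    also have "\<dots> = cnj (pr (od l) j x)" using P0 by simp
    finally show "cinner (Us l j u) (\<Sum>i<nlam l. cnj (?E x l $$ (i, j)) *\<^sub>C Us l i (vec ev (x, g)))
        = cinner (Us l j u) (Us l j (vec od (x, g)))"
      by (simp add: comp_vec[OF l])
  qed
  \<comment> \<open>\<open>M l x / P l x\<close> bounds the squared norm of
    \<open>\<sigma>\<^sub>\<lambda>(x)\<close> and is below \<open>1\<close>, because
    \<open>P l x - M l x\<close> is the defect at \<open>(x, x)\<close>. The maximum over finitely
    many indices stays below \<open>1\<close>.\<close>
  define c where "c x = Max ((\<lambda>l. M l x / P l x) ` ?L)" for x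
  have ratio: "M l x / P l x \<le> c x" if "l \<in> ?L" for l x
    unfolding c_def using that L(1) by (intro Max_ge) auto
  have c: "0 \<le> c x" "c x < 1" for x
  proof -
    have "c x \<in> (\<lambda>l. M l x / P l x) ` ?L" unfolding c_def using L by (intro Max_in) auto
    then obtain l where l: "l \<in> ?L" "c x = M l x / P l x" by blast
    have "0 < P l x" using MP[OF l(1), of x] by linarith
    then show "0 \<le> c x" "c x < 1" unfolding l(2) using MP[OF l(1), of x] by simp_all
  qed
  have contraction: "norm (F.rep (?E x) u) \<le> sqrt (c x) * norm u" for x u
  proof (rule power2_le_imp_le)
    have "(norm (F.rep (?E x) u))\<^sup>2 = (\<Sum>l\<in>?L. \<Sum>i<nlam l. (norm (\<Sum>j<nlam l.
        (inverse (complex_of_real (P l x)) * (cnj (pr (ev l) i x) * pr (od l) j x)) *\<^sub>C Us l j u))\<^sup>2)"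
      unfolding F.norm_components[of "F.rep (?E x) u"]
      by (intro sum.cong refl) (simp add: F.component_rep E_index)
    also have "\<dots> \<le> (\<Sum>l\<in>?L. M l x / P l x * (\<Sum>j<nlam l. (norm (Us l j u))\<^sup>2))"
    proof (rule sum_mono)
      fix l assume "l \<in> ?L"
      then have "0 < P l x" using MP[of l x] by simp
      then show "(\<Sum>i<nlam l. (norm (\<Sum>j<nlam l.
          (inverse (complex_of_real (P l x)) * (cnj (pr (ev l) i x) * pr (od l) j x)) *\<^sub>C Us l j u))\<^sup>2)
          \<le> M l x / P l x * (\<Sum>j<nlam l. (norm (Us l j u))\<^sup>2)"
        unfolding P_def M_def by (rule rank_one_bound)
    qed
    also have "\<dots> \<le> (\<Sum>l\<in>?L. c x * (\<Sum>j<nlam l. (norm (Us l j u))\<^sup>2))"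
      by (intro sum_mono mult_right_mono ratio sum_nonneg) auto
    also have "\<dots> = (sqrt (c x) * norm u)\<^sup>2"
      using c(1)[of x] by (simp add: power_mult_distrib F.norm_components[of u] sum_distrib_left)
    finally show "(norm (F.rep (?E x) u))\<^sup>2 \<le> (sqrt (c x) * norm u)\<^sup>2" .
    show "0 \<le> sqrt (c x) * norm u" using c(1) by simp
  qed
  \<comment> \<open>\<open>W\<close> produces values of the adjoint of \<open>\<phi> x\<close>, so
    \<open>\<phi>\<close> itself is the transfer function of the adjoint colligation
    \<open>Ws\<close>.\<close>
  have "transfer_function Ws (\<lambda>x. F.rep (?E x)) x h = \<phi> x h" for x h
  proof (rule transfer_function_eqI[OF W(2,3), where a = "\<lambda>g. vec od (x, g)" and b = "\<lambda>g. vec ev (x, g)"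
        and t = "cadjoint (\<phi> x)" and c = "sqrt (c x)"])
    show "bounded_clinear (F.rep (?E x))" by (rule F.bounded_clinear_rep)
    show "norm (F.rep (?E x) u) \<le> sqrt (c x) * norm u" for u by (rule contraction)
    show "0 \<le> sqrt (c x)" "sqrt (c x) < 1" using c by simp_all
    show "W (vec od (x, g), g) = (vec ev (x, g), cadjoint (\<phi> x) g)" for g
      using W\<alpha>[of "(x, g)"] by (simp add: \<alpha>_def \<beta>_def)
    show "cinner (F.rep (?E x) u) (vec ev (x, g)) = cinner u (vec od (x, g))" for u g by (rule rep_ev)
    show "cinner h (cadjoint (\<phi> x) g) = cinner (\<phi> x h) g" for g by (rule cinner_cadjoint[OF \<phi>])
  qed
  then have "\<phi> = transfer_function Ws (\<lambda>x. F.rep (?E x))" by (simp add: fun_eq_iff)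
  moreover have "unitary_colligation \<Lambda> (Cb \<Lambda> \<psi> ev od) Ws F.rep"
    unfolding unitary_colligation_def
    by (intro conjI W(2) F.unital_star_rep_rep F.diagonal_form_rep Cb_carrier)
  ultimately show ?thesis unfolding has_transfer_representation_def by blast
qed

theorem theorem4p2:
  fixes \<psi> :: "'i::finite \<Rightarrow> 'x \<Rightarrow> complex"
    and \<Lambda> :: "('i \<Rightarrow> nat) set"
    and ev od :: "('i \<Rightarrow> nat) \<Rightarrow> nat \<Rightarrow> ('i \<times> nat) set"
    and \<phi> :: "'x \<Rightarrow> 'h::chilbert \<Rightarrow> 'h"
  assumes "test_functions \<psi>"
    and "preordering_set \<Lambda>"
    and "\<And>i. \<psi> i \<in> A_algebra \<psi> \<Lambda>"
    and "subset_orders \<Lambda> ev od"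
    and "\<And>x. bounded_clinear (\<phi> x)"
  shows "(\<phi> \<in> Hinf_unit_ball \<psi> \<Lambda> \<longleftrightarrow>
            (\<exists>\<Gamma> \<in> cp_kernels (Cb \<Lambda> \<psi> ev od). \<forall>x y.
               (\<lambda>h. h - \<phi> x (cadjoint (\<phi> y) h)) = \<Gamma> x y (E_diff \<Lambda> \<psi> ev od x y))) \<and>
         (\<phi> \<in> Hinf_unit_ball \<psi> \<Lambda> \<longrightarrow> has_transfer_representation \<Lambda> \<psi> ev od \<phi>)"
proof -
  note \<psi> = assms(1) and \<Lambda> = assms(2) and ord = assms(4) and \<phi> = assms(5)
  have decomp: "\<exists>K. agler_decomposition \<psi> \<Lambda> \<phi> K" if "\<phi> \<in> Hinf_unit_ball \<psi> \<Lambda>"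
    using agler_decomposition_exists[OF \<psi> \<Lambda> \<phi>] that by (simp add: Hinf_unit_ball_iff[OF \<phi>])
  have "\<phi> \<in> Hinf_unit_ball \<psi> \<Lambda>"
    if "\<Gamma> \<in> cp_kernels (Cb \<Lambda> \<psi> ev od)"
      "\<And>x y. (\<lambda>h. h - \<phi> x (cadjoint (\<phi> y) h)) = \<Gamma> x y (E_diff \<Lambda> \<psi> ev od x y)" for \<Gamma>
    unfolding Hinf_unit_ball_iff[OF \<phi>] by (rule Hinf_bound_of_cp_kernel[OF \<Lambda> ord \<phi> that])
  moreover have "\<exists>\<Gamma> \<in> cp_kernels (Cb \<Lambda> \<psi> ev od). \<forall>x y.
      (\<lambda>h. h - \<phi> x (cadjoint (\<phi> y) h)) = \<Gamma> x y (E_diff \<Lambda> \<psi> ev od x y)"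
    "has_transfer_representation \<Lambda> \<psi> ev od \<phi>" if ball: "\<phi> \<in> Hinf_unit_ball \<psi> \<Lambda>"
  proof -
    obtain K where K: "agler_decomposition \<psi> \<Lambda> \<phi> K" using decomp[OF ball] by blast
    show "\<exists>\<Gamma> \<in> cp_kernels (Cb \<Lambda> \<psi> ev od). \<forall>x y.
      (\<lambda>h. h - \<phi> x (cadjoint (\<phi> y) h)) = \<Gamma> x y (E_diff \<Lambda> \<psi> ev od x y)"
      by (rule cp_kernel_exists[OF \<psi> \<Lambda> ord \<phi> K])
    show "has_transfer_representation \<Lambda> \<psi> ev od \<phi>"
      by (rule transfer_representation_exists[OF \<psi> \<Lambda> ord \<phi> K])
  qed
  ultimately show ?thesis by blast
qed

end
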